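(* Assume that $\mathbf E\cap\mathbf D=\overline{\mathbb Q}$. Let $a>0$ be a rational number and $s\ge0$ an integer, excluding the case where both $s=0$ and $a\in\mathbb N$. Then $\Gamma^{(s)}(a)$, the $s$-th derivative of Euler's Gamma function at $a$, is a transcendental number.
   Context: Throughout, $\overline{\mathbb Q}$ is the field of algebraic numbers, seen as a subfield of $\mathbb C$. An $E$-function is a power series $F(x)=\sum_{n\ge0}\frac{a_n}{n!}x^n$ with all $a_n\in\overline{\mathbb Q}$ such that: - $F$ satisfies a nonzero linear differential equation with coefficients in $\overline{\mathbb Q}(x)$; - there is $C>0$ such that $|\sigma(a_n)|\le C^{n+1}$ for all $n$ and all $\sigma\in\mathrm{Gal}(\overline{\mathbb Q}/\mathbb Q)$; - the least common denominator of $a_0,\dots,a_n$ is at most $C^{n+1}$ for all $n$. A $G$-function is a power series $\sum a_nx^n\in\overline{\mathbb Q}[[x]]$ such that $\sum\frac{a_n}{n!}x^n$ is an $E$-function. In that case $\mathfrak f(z)=\sum n!a_nz^n$ is called an Э-function. For an Э-function $\mathfrak f$ and a direction $\theta$ which is not one of its finitely many (mod $2\pi$) anti-Stokes directions, $\mathfrak f_\theta(1/z)$ denotes the Ramis 1-sum (equivalently, Borel–Laplace sum) of $\mathfrak f(1/z)$ in the direction $\theta$. It is holomorphic on a large sector $\theta-\frac\pi2-\varepsilon<\arg z<\theta+\frac\pi2+\varepsilon$ and asymptotic to $\mathfrak f(1/z)$ there. For example, if $g(x)=\sum a_nx^n$, $\theta=0$ is not anti-Stokes and $z>0$, then $\mathfrak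 f_0(1/z)=\int_0^\infty g(t/z)e^{-t}dt$. We define two sets: - $\mathbf E$ is the set of values of $E$-functions at algebraic points; - $\mathbf D$ is the set of numbers $\mathfrak f_\theta(1)$, where $\mathfrak f$ is an Э-function and $\theta=0$ if $0$ is not anti-Stokes for $\mathfrak f$, while $\theta>0$ is sufficiently small otherwise. *)

theory Defs
  imports "HOL-Complex_Analysis.Complex_Analysis"
begin

definition Qbar :: "complex set" where
  "Qbar = {x. algebraic x}"

text \<open>An automorphism of \<open>Qbar\<close> is a total function on the complex numbers here; its values
  outside \<open>Qbar\<close> are irrelevant.\<close>

definition Gal_Qbar :: "(complex \<Rightarrow> complex) set" where
  "Gal_Qbar = {\<sigma>. bij_betw \<sigma> Qbar Qbar \<and>
     (\<forall>x\<in>Qbar. \<forall>y\<in>Qbar. \<sigma> (x + y) = \<sigma> x + \<sigma> y \<and> \<sigma> (x * y) = \<sigma> x * \<sigma> y) \<and>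
     (\<forall>q\<in>\<rat>. \<sigma> q = q)}"

definition common_denom :: "(nat \<Rightarrow> complex) \<Rightarrow> nat \<Rightarrow> nat" where
  "common_denom a n = (LEAST d. d > 0 \<and> (\<forall>k\<le>n. algebraic_int (of_nat d * a k)))"

text \<open>The field of rational functions over \<open>Qbar\<close>, embedded into the field of formal Laurent
  series (by expansion at 0) so that it acts on power series.\<close>

definition Qbar_rat_funs :: "complex fls set" where
  "Qbar_rat_funs = {fps_to_fls (fps_of_poly p) / fps_to_fls (fps_of_poly q) | p q.
     (\<forall>i. coeff p i \<in> Qbar) \<and> (\<forall>i. coeff q i \<in> Qbar) \<and> q \<noteq> 0}"

definition satisfies_linear_ode :: "complex fps \<Rightarrow> bool" where
  "satisfies_linear_ode F \<longleftrightarrow> (\<exists>m c.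
     (\<forall>i\<le>m. c i \<in> Qbar_rat_funs) \<and> (\<exists>i\<le>m. c i \<noteq> 0) \<and>
     (\<Sum>i\<le>m. c i * fps_to_fls ((fps_deriv ^^ i) F)) = 0)"

definition E_function :: "complex fps \<Rightarrow> bool" where
  "E_function F \<longleftrightarrow> (\<exists>a.
     F = Abs_fps (\<lambda>n. a n / fact n) \<and> (\<forall>n. a n \<in> Qbar) \<and>
     satisfies_linear_ode F \<and>
     (\<exists>C::real. C > 0 \<and>
        (\<forall>n. \<forall>\<sigma>\<in>Gal_Qbar. norm (\<sigma> (a n)) \<le> C ^ (n + 1)) \<and>
        (\<forall>n. real (common_denom a n) \<le> C ^ (n + 1))))"

definition G_function :: "complex fps \<Rightarrow> bool" where
  "G_function g \<longleftrightarrow> (\<forall>n. fps_nth g n \<in> Qbar) \<and> E_function (Abs_fps (\<lambda>n. fps_nth g n / fact n))"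

text \<open>The third class of arithmetic Gevrey series, whose name is the reversed letter E.\<close>

definition Rev_E_function :: "complex fps \<Rightarrow> bool" where
  "Rev_E_function f \<longleftrightarrow> (\<exists>g. G_function g \<and> f = Abs_fps (\<lambda>n. fact n * fps_nth g n))"

definition borel_transform :: "complex fps \<Rightarrow> complex fps" where
  "borel_transform f = Abs_fps (\<lambda>n. fps_nth f n / fact n)"

definition sector :: "real \<Rightarrow> real \<Rightarrow> complex set" where
  "sector \<phi> \<epsilon> = {rcis r \<psi> | r \<psi>. r > 0 \<and> \<bar>\<psi> - \<phi>\<bar> < \<epsilon>}"

text \<open>Directions \<open>\<theta>\<close> refer to the argument of \<open>z\<close> in the series \<open>f(1/z)\<close>. Its Laplace
  integral has the kernel \<open>exp (- z * u)\<close>, so the corresponding ray in the Borel plane has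
  argument \<open>- \<theta>\<close>. The function \<open>G\<close> is the continuation of the Borel transform from a
  neighbourhood of 0 to a sector around that ray; it is unique there.\<close>

definition borel_continuation :: "complex fps \<Rightarrow> real \<Rightarrow> (complex \<Rightarrow> complex) \<Rightarrow> bool" where
  "borel_continuation f \<theta> G \<longleftrightarrow> G has_fps_expansion borel_transform f \<and>
     (\<exists>\<epsilon>>0. G holomorphic_on sector (- \<theta>) \<epsilon> \<and>
        (\<exists>K B. \<forall>u\<in>sector (- \<theta>) \<epsilon>. norm (G u) \<le> K * exp (B * norm u)))"

text \<open>The anti-Stokes (singular) directions are those in which \<open>f(1/z)\<close> is not 1-summable.\<close>

definition anti_Stokes :: "complex fps \<Rightarrow> real \<Rightarrow> bool" where
  "anti_Stokes f \<theta> \<longleftrightarrow> \<not> (\<exists>G. borel_continuation f \<theta> G)"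

text \<open>\<open>has_1_sum f \<theta> z v\<close>: the sum of \<open>f(1/z)\<close> in the direction \<open>\<theta>\<close> takes the value \<open>v\<close> at \<open>z\<close>,
  that is, \<open>v\<close> is \<open>z\<close> times the integral of \<open>G u * exp (- z * u)\<close> over the ray of argument
  \<open>- \<theta>\<close>. If \<open>arg z = \<theta>\<close>, the substitution \<open>u = t / z\<close> turns this into the integral of
  \<open>G (t / z) * exp (- t)\<close> over \<open>t > 0\<close>. Only points of the half-plane
  \<open>\<bar>arg z - \<theta>\<bar> < pi / 2\<close> are covered; the rest of the large sector on which the sum is
  holomorphic would be reached by rotating the ray.\<close>

definition has_1_sum :: "complex fps \<Rightarrow> real \<Rightarrow> complex \<Rightarrow> complex \<Rightarrow> bool" where
  "has_1_sum f \<theta> z v \<longleftrightarrow> Re (z * cis (- \<theta>)) > 0 \<and>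
     (\<exists>G I. borel_continuation f \<theta> G \<and>
        ((\<lambda>r. G (rcis r (- \<theta>)) * exp (- z * rcis r (- \<theta>)) * cis (- \<theta>)) has_integral I) {0..} \<and>
        v = z * I)"

definition E_values :: "complex set" where
  "E_values = {eval_fps F \<alpha> | F \<alpha>. E_function F \<and> \<alpha> \<in> Qbar}"

definition D_values :: "complex set" where
  "D_values = {v. \<exists>f. Rev_E_function f \<and>
     (if \<not> anti_Stokes f 0 then has_1_sum f 0 1 v
      else (\<forall>\<^sub>F \<theta> in at_right 0. has_1_sum f \<theta> 1 v))}"

end

theory Submission
  imports
    Defs
    "Jordan_Normal_Form.Determinant"
    "HOL-Computational_Algebra.Field_as_Ring"
    "HOL-Computational_Algebra.Squarefree"
    "HOL-Real_Asymp.Real_Asymp"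
begin

text \<open>
  Splitting Euler's integral at 1 gives \<open>\<Gamma>\<^sup>(\<^sup>s\<^sup>)(a) = c f(1) + v / e\<close>, where \<open>c = (- 1)\<^sup>s s!\<close>, the E-function \<open>f\<close>
  is the sum of \<open>(- x)\<^sup>n / (n! (n + a)\<^sup>s\<^sup>+\<^sup>1)\<close>, and \<open>v\<close> is the Laplace integral at 1 of
  \<open>(1 + u)\<^sup>a\<^sup>-\<^sup>1 (ln (1 + u))\<^sup>s\<close>, so that \<open>v\<close> lies in \<open>D\<close>. If the left-hand side \<open>A\<close> is algebraic, then
  \<open>v = e (A - c f(1))\<close> also lies in \<open>E\<close>, hence is algebraic by assumption. The relation
  \<open>A = c f(1) + v / e\<close> then makes \<open>1 / e\<close> and \<open>f(1)\<close> algebraically dependent.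

  This contradicts the Siegel-Shidlovskii theorem. Only the special case of a tower
  \<open>e\<^sup>-\<^sup>x, y\<^sub>1, \<dots>, y\<^sub>q\<close> is needed, in which \<open>(x d/dx + \<kappa>) y\<^sub>j = y\<^sub>j\<^sub>-\<^sub>1\<close>. It is proved with simultaneous
  approximations of all monomials of bounded degree with a common denominator: a relation between
  the values at 1 forces the iterates of the approximation to be dependent, and the resulting
  differential module would contain an eigenform, that is, a rational solution of a first-order
  equation that has none. For \<open>a \<notin> \<nat>\<close> the tower consists of the series for
  \<open>1, \<dots>, s + 1\<close>, with \<open>\<kappa> = a\<close>. For \<open>a \<in> \<nat>\<close> the first of them is elementary; it is dropped, and the
  others are multiplied by \<open>x\<^sup>a\<close>, with \<open>\<kappa> = 0\<close>.
\<close>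

text \<open>The relation at 1 has integer coefficients because the algebraicity of \<open>A\<close>
  and \<open>v\<close> enters only through a dimension count: the (L + 1)^2 products of powers of
  1/e and f(1) lie in a rational span whose dimension grows linearly in L. Hence no number field
  occurs in the approximation argument. The relation makes one fixed integer combination of the
  approximating polynomials, and of many of their iterates, vanish at 1. The determinant of the
  first iterates is then divisible by a power of x and by a power of x - 1 whose degrees together
  exceed its own, so it is 0. The real obstacle is to exclude a vanishing determinant, and this is
  where the shape of the tower matters. The system on monomials is triangular, and an eigenform in a
  stable module can only belong to a power of the exponential. Such a power is a unit as a power
  series, so its product with the common denominator cannot vanish to the order that a remainder
  has.\<close>

no_notation vec_nth (infixl \<open>$\<close> 90)
no_notation fps_nth (infixl \<open>$\<close> 75)
hide_const (open) Determinants.det Finite_Cartesian_Product.vec Finite_Cartesian_Product.row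

section \<open>Sequences with geometrically bounded denominators\<close>

text \<open>\<open>D n\<close> carries terms into \<int>, so all terms are rational: Galois
  conjugation acts trivially on them and denominators are ordinary ones. One \<open>D n\<close>
  serves the whole initial segment because a convolution combines all earlier terms.\<close>

definition arith_geom :: "(nat \<Rightarrow> complex) \<Rightarrow> bool" where
  "arith_geom a \<longleftrightarrow> (\<exists>(C::nat) (D::nat \<Rightarrow> nat). C \<ge> 1 \<and> (\<forall>n. D n > 0 \<and> D n \<le> C ^ (n + 1) \<and>
     norm (a n) \<le> real C ^ (n + 1) \<and> (\<forall>k\<le>n. of_nat (D n) * a k \<in> \<int>)))"

lemma arith_geomI:
  fixes C C' :: nat and D :: "nat \<Rightarrow> nat"
  assumes "\<And>n. D n > 0" "\<And>n. D n \<le> C ^ (n + 1)" "\<And>n. norm (a n) \<le> real C' ^ (n + 1)"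
    "\<And>n k. k \<le> n \<Longrightarrow> of_nat (D n) * a k \<in> \<int>"
  shows "arith_geom a"
proof -
  define B where "B = max 1 (max C C')"
  have B: "C \<le> B" "C' \<le> B" by (auto simp: B_def)
  have "D n \<le> B ^ (n + 1)" for n
    by (rule order.trans[OF assms(2) power_mono[OF B(1)]]) simp
  moreover have "norm (a n) \<le> real B ^ (n + 1)" for n
    by (rule order.trans[OF assms(3) power_mono]) (use B in auto)
  moreover have "B \<ge> 1" by (simp add: B_def)
  ultimately show ?thesis unfolding arith_geom_def using assms by blast
qed

text \<open>Covers both the Cauchy product and the binomial convolution.\<close>

lemma arith_geom_convolution:
  assumes "arith_geom a" "arith_geom b" "\<And>n k. k \<le> n \<Longrightarrow> w n k \<le> (2::nat) ^ n"
  shows "arith_geom (\<lambda>n. \<Sum>k\<le>n. of_nat (w n k) * a k * b (n - k))"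
proof -
  obtain C D where C: "C \<ge> 1" "\<And>n. D n > 0" "\<And>n. D n \<le> C ^ (n + 1)" "\<And>n. norm (a n) \<le> real C ^ (n + 1)"
    "\<And>n k. k \<le> n \<Longrightarrow> of_nat (D n) * a k \<in> \<int>" using assms(1) unfolding arith_geom_def by blast
  obtain C' D' where C': "C' \<ge> 1" "\<And>n. D' n > 0" "\<And>n. D' n \<le> C' ^ (n + 1)" "\<And>n. norm (b n) \<le> real C' ^ (n + 1)"
    "\<And>n k. k \<le> n \<Longrightarrow> of_nat (D' n) * b k \<in> \<int>" using assms(2) unfolding arith_geom_def by blast
  show ?thesis
  proof (rule arith_geomI[where C = "C * C'" and D = "\<lambda>n. D n * D' n" and C' = "4 * (C * C')"])
    fix n
    show "0 < D n * D' n" using C C' by simp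
    show "D n * D' n \<le> (C * C') ^ (n + 1)" using C(3) C'(3) by (simp only: power_mult_distrib mult_mono')
    have "norm (\<Sum>k\<le>n. of_nat (w n k) * a k * b (n - k)) \<le> (\<Sum>k\<le>n. 2 ^ n * (real C * real C') ^ (n + 1))"
    proof (rule sum_norm_le)
      fix k assume "k \<in> {..n}"
      then have k: "k \<le> n" by simp
      have "norm (a k) \<le> real C ^ (n + 1)"
        by (rule order.trans[OF C(4) power_increasing]) (use k C(1) in auto)
      moreover have "norm (b (n - k)) \<le> real C' ^ (n + 1)"
        by (rule order.trans[OF C'(4) power_increasing]) (use k C'(1) in auto)
      moreover have "real (w n k) \<le> 2 ^ n" using assms(3)[OF k] by (metis of_nat_le_iff of_nat_numeral of_nat_power)
      ultimately have "real (w n k) * norm (a k) * norm (b (n - k)) \<le> 2 ^ n * real C ^ (n + 1) * real C' ^ (n + 1)"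
        by (intro mult_mono) auto
      then show "norm (of_nat (w n k) * a k * b (n - k)) \<le> 2 ^ n * (real C * real C') ^ (n + 1)"
        by (simp add: norm_mult power_mult_distrib algebra_simps)
    qed
    also have "\<dots> = (real (n + 1) * 2 ^ n) * (real C * real C') ^ (n + 1)" by simp
    also have "\<dots> \<le> 4 ^ (n + 1) * (real C * real C') ^ (n + 1)"
    proof (rule mult_right_mono)
      have "real (n + 1) \<le> 2 ^ (n + 1)" using of_nat_less_two_power[of "n + 1", where 'a = real] by linarith
      then have "real (n + 1) * 2 ^ n \<le> 2 ^ (n + 1) * 2 ^ (n + 1)" by (intro mult_mono) auto
      then show "real (n + 1) * 2 ^ n \<le> 4 ^ (n + 1)" by (simp only: flip: power_mult_distrib) simp
    qed auto
    finally show "norm (\<Sum>k\<le>n. of_nat (w n k) * a k * b (n - k)) \<le> real (4 * (C * C')) ^ (n + 1)"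
      by (simp add: power_mult_distrib algebra_simps)
  next
    fix n k :: nat assume k: "k \<le> n"
    have "of_nat (D n * D' n) * (\<Sum>i\<le>k. of_nat (w k i) * a i * b (k - i))
        = (\<Sum>i\<le>k. of_nat (w k i) * (of_nat (D n) * a i) * (of_nat (D' n) * b (k - i)))"
      by (simp add: sum_distrib_left algebra_simps)
    also have "\<dots> \<in> \<int>"
      by (intro Ints_sum Ints_mult[OF Ints_mult[OF Ints_of_nat C(5)] C'(5)]) (use k in auto)
    finally show "of_nat (D n * D' n) * (\<Sum>i\<le>k. of_nat (w k i) * a i * b (k - i)) \<in> \<int>" .
  qed
qed

definition egf :: "complex fps \<Rightarrow> nat \<Rightarrow> complex" where
  "egf f n = fact n * fps_nth f n"

lemma fps_nth_egf: "fps_nth f n = egf f n / fact n"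
  by (simp add: egf_def)

lemma egf_mult: "egf (f * g) n = (\<Sum>k\<le>n. of_nat (n choose k) * egf f k * egf g (n - k))"
  unfolding egf_def fps_mult_nth sum_distrib_left atLeast0AtMost
  by (intro sum.cong) (auto simp: binomial_fact)

lemma arith_geom_egf_mult: "arith_geom (egf f) \<Longrightarrow> arith_geom (egf g) \<Longrightarrow> arith_geom (egf (f * g))"
  using arith_geom_convolution[of "egf f" "egf g" "\<lambda>n k. n choose k"] binomial_le_pow2
  by (simp flip: egf_mult)

lemma arith_geom_egf_1: "arith_geom (egf 1)"
  by (rule arith_geomI[where D = "\<lambda>_. 1" and C = 1 and C' = 1]) (auto simp: egf_def)

lemma arith_geom_egf_power: "arith_geom (egf f) \<Longrightarrow> arith_geom (egf (f ^ n))"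
  by (induction n) (simp_all add: arith_geom_egf_mult arith_geom_egf_1)

lemma arith_geom_egf_prod:
  "(\<And>i. i \<in> S \<Longrightarrow> arith_geom (egf (f i))) \<Longrightarrow> arith_geom (egf (prod f S))"
  by (induction S rule: infinite_finite_induct) (simp_all add: arith_geom_egf_mult arith_geom_egf_1)

lemma fps_conv_radius_egf:
  assumes "arith_geom (egf f)"
  shows "fps_conv_radius f = \<infinity>"
proof -
  obtain C :: nat where C: "\<And>n. norm (egf f n) \<le> real C ^ (n + 1)"
    using assms unfolding arith_geom_def by blast
  have "conv_radius (fps_nth f) = \<infinity>"
  proof (rule conv_radius_inftyI'')
    fix z :: complex
    show "summable (\<lambda>n. fps_nth f n * z ^ n)"
    proof (rule summable_comparison_test')
      show "summable (\<lambda>n. real C * (inverse (fact n) * (real C * norm z) ^ n))"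
        by (intro summable_mult summable_exp)
      show "norm (fps_nth f n * z ^ n) \<le> real C * (inverse (fact n) * (real C * norm z) ^ n)" for n
      proof -
        have "norm (fps_nth f n * z ^ n) = norm (egf f n) / fact n * norm z ^ n"
          by (simp add: fps_nth_egf norm_mult norm_power norm_divide)
        also have "\<dots> \<le> real C ^ (n + 1) / fact n * norm z ^ n"
          by (intro mult_right_mono divide_right_mono C) auto
        finally show ?thesis by (simp add: field_simps)
      qed
    qed
  qed
  then show ?thesis by (simp add: fps_conv_radius_def)
qed

section \<open>Siegel's lemma on small integer solutions of linear equations\<close>

text \<open>Pigeonhole: the box of vectors with entries from 0 to \<open>Y\<close> has more points
  than the \<open>E\<close> forms have value vectors, and the difference of two points with equal
  values is a solution. The condition \<open>big\<close> is the raw count, so that it serves the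
  approximations and also, with \<open>Y\<close> huge, plain solvability over the rationals.\<close>

lemma siegel_lemma:
  fixes a :: "nat \<Rightarrow> nat \<Rightarrow> int" and V E H Y :: nat
  assumes a: "\<And>e k. e < E \<Longrightarrow> k < V \<Longrightarrow> \<bar>a e k\<bar> \<le> int H"
    and big: "(V * H * Y + 1) ^ E < (Y + 1) ^ V"
  obtains b where "\<exists>k<V. b k \<noteq> 0" "\<And>k. \<bar>b k\<bar> \<le> int Y" "\<And>e. e < E \<Longrightarrow> (\<Sum>k<V. a e k * b k) = 0"
proof -
  define X where "X = PiE {..<V} (\<lambda>_. {0..int Y})"
  \<comment> \<open>\<open>lo e\<close> is the least value of the form \<open>e\<close> on the box;
    its values then lie among \<open>V * H * Y + 1\<close> consecutive integers.\<close>
  define lo where "lo e = (\<Sum>k<V. min (a e k) 0 * int Y)" for e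
  define \<phi> where "\<phi> x = restrict (\<lambda>e. \<Sum>k<V. a e k * x k) {..<E}" for x :: "nat \<Rightarrow> int"
  define Z where "Z = PiE {..<E} (\<lambda>e. {lo e..lo e + int (V * H * Y)})"
  have "\<phi> ` X \<subseteq> Z"
  proof
    fix y assume "y \<in> \<phi> ` X"
    then obtain x where x: "x \<in> X" "y = \<phi> x" by blast
    have xk: "0 \<le> x k" "x k \<le> int Y" if "k < V" for k using x(1) that by (auto simp: X_def PiE_iff)
    have "lo e \<le> (\<Sum>k<V. a e k * x k) \<and> (\<Sum>k<V. a e k * x k) \<le> lo e + int (V * H * Y)" if e: "e < E" for e
    proof
      show "lo e \<le> (\<Sum>k<V. a e k * x k)"
        unfolding lo_def
      proof (rule sum_mono)
        fix k assume "k \<in> {..<V}"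
        then have k: "0 \<le> x k" "x k \<le> int Y" using xk by auto
        have "min (a e k) 0 * int Y \<le> min (a e k) 0 * x k" using k by (intro mult_left_mono_neg) auto
        also have "\<dots> \<le> a e k * x k" using k by (intro mult_right_mono) auto
        finally show "min (a e k) 0 * int Y \<le> a e k * x k" .
      qed
      have "(\<Sum>k<V. a e k * x k) - lo e = (\<Sum>k<V. a e k * x k - min (a e k) 0 * int Y)"
        by (simp add: lo_def sum_subtractf)
      also have "\<dots> \<le> (\<Sum>k<V. int H * int Y)"
      proof (rule sum_mono)
        fix k assume k': "k \<in> {..<V}"
        then have k: "0 \<le> x k" "x k \<le> int Y" "\<bar>a e k\<bar> \<le> int H" using xk a e by auto
        show "a e k * x k - min (a e k) 0 * int Y \<le> int H * int Y"
        proof (cases "0 \<le> a e k")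
          case True
          then have "a e k * x k \<le> int H * int Y" using k by (intro mult_mono) auto
          then show ?thesis using True by simp
        next
          case False
          then have "a e k * x k \<le> 0" using k by (simp add: mult_nonpos_nonneg)
          moreover have "(- a e k) * int Y \<le> int H * int Y" using k by (intro mult_right_mono) auto
          ultimately show ?thesis using False by simp
        qed
      qed
      also have "\<dots> = int (V * H * Y)" by simp
      finally show "(\<Sum>k<V. a e k * x k) \<le> lo e + int (V * H * Y)" by simp
    qed
    then show "y \<in> Z" unfolding x(2) Z_def \<phi>_def by auto
  qed
  moreover have "finite Z" unfolding Z_def by (intro finite_PiE) auto
  ultimately have "card (\<phi> ` X) \<le> card Z" by (rule card_mono[rotated])
  also have "card Z = (V * H * Y + 1) ^ E" 
    by (simp add: Z_def card_PiE nat_add_distrib nat_mult_distrib)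
  also have "\<dots> < card X" using big by (simp add: X_def card_PiE nat_add_distrib)
  finally have "\<not> inj_on \<phi> X" by (rule pigeonhole)
  then obtain x y where xy: "x \<in> X" "y \<in> X" "x \<noteq> y" "\<phi> x = \<phi> y" by (auto simp: inj_on_def)
  define b where "b k = (if k < V then x k - y k else 0)" for k
  show thesis
  proof (rule that[of b])
    show "\<exists>k<V. b k \<noteq> 0"
    proof (rule ccontr)
      assume "\<not> ?thesis"
      then have "x k = y k" for k
        using xy(1,2) by (cases "k < V") (auto simp: b_def X_def PiE_iff extensional_def)
      then show False using xy(3) by auto
    qed
    show "\<bar>b k\<bar> \<le> int Y" for k
    proof (cases "k < V")
      case True
      then have "0 \<le> x k" "x k \<le> int Y" "0 \<le> y k" "y k \<le> int Y" using xy(1,2) by (auto simp: X_def PiE_iff)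
      then show ?thesis using True by (auto simp: b_def)
    qed (simp add: b_def)
    fix e assume "e < E"
    then have "(\<Sum>k<V. a e k * x k) = (\<Sum>k<V. a e k * y k)" using fun_cong[OF xy(4), of e] by (simp add: \<phi>_def)
    then show "(\<Sum>k<V. a e k * b k) = 0" by (simp add: b_def right_diff_distrib sum_subtractf)
  qed
qed

lemma power_le_fact_exp: "x \<ge> 0 \<Longrightarrow> x ^ k \<le> fact k * exp (x::real)"
proof -
  assume x: "x \<ge> 0"
  have "(\<Sum>i\<in>{k}. inverse (fact i) * x ^ i) \<le> (\<Sum>i. inverse (fact i) * x ^ i)"
    by (rule sum_le_suminf[OF summable_exp]) (use x in auto)
  then have "inverse (fact k) * x ^ k \<le> exp x" by (simp add: exp_def scaleR_conv_of_real)
  then show ?thesis by (simp add: field_simps)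
qed

section \<open>Differential modules over the polynomials\<close>

lemma nonzero_vec_index:
  assumes "v \<in> carrier_vec m" "v \<noteq> 0\<^sub>v m"
  shows "\<exists>i<m. v $ i \<noteq> 0"
proof (rule ccontr)
  assume "\<not> (\<exists>i<m. v $ i \<noteq> 0)"
  then have "v = 0\<^sub>v m" using assms(1) by (intro eq_vecI) auto
  then show False using assms(2) by simp
qed

text \<open>The operator x d/dx does not raise degrees and respects divisibility by powers of x. It
  also makes the matrix of a tower polynomial, where d/dx would introduce the denominator x.\<close>

definition euler :: "'a::idom poly \<Rightarrow> 'a poly" where
  "euler p = [:0, 1:] * pderiv p"

lemma euler_0 [simp]: "euler 0 = 0"
  by (simp add: euler_def)

lemma euler_add: "euler (p + q) = euler p + euler q"
  by (simp add: euler_def pderiv_add distrib_left)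

lemma euler_diff: "euler (p - q) = euler p - euler q"
  by (simp add: euler_def pderiv_diff right_diff_distrib)

lemma euler_mult: "euler (p * q) = euler p * q + p * euler q"
  by (simp add: euler_def pderiv_mult algebra_simps)

lemma euler_sum: "euler (sum f S) = (\<Sum>i\<in>S. euler (f i))"
  by (induction S rule: infinite_finite_induct) (simp_all add: euler_add)

lemma coeff_euler: "coeff (euler p) k = of_nat k * coeff p k"
  by (cases k) (simp_all add: euler_def coeff_pCons coeff_pderiv)

lemma degree_euler_le: "degree (euler p) \<le> degree p"
  by (rule degree_le) (simp add: coeff_euler coeff_eq_0)

lemma X_power_dvd_euler: "[:0, 1:] ^ T dvd p \<Longrightarrow> [:0, 1:] ^ T dvd euler p"
proof -
  assume "[:0, 1:] ^ T dvd p"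
  then obtain q where q: "p = [:0, 1:] ^ T * q" by (auto elim: dvdE)
  have "euler ([:0, 1:] ^ T :: 'a poly) = of_nat T * [:0, 1:] ^ T"
    by (induction T) (simp_all add: euler_mult, simp_all add: euler_def pderiv_pCons algebra_simps)
  then show ?thesis
    unfolding q euler_mult by (intro dvd_add) (auto intro: dvd_mult dvd_mult2)
qed

lemma linear_power_dvd_of_pderiv:
  fixes S :: "'a::field_char_0 poly"
  assumes "poly S a = 0" "[:- a, 1:] ^ e dvd pderiv S"
  shows "[:- a, 1:] ^ Suc e dvd S"
proof (cases "pderiv S = 0")
  case True
  then obtain c where "S = [:c:]" using pderiv_iszero by blast
  with assms(1) have "S = 0" by simp
  then show ?thesis by simp
next
  case False
  then have S: "S \<noteq> 0" by auto
  have "order a S \<noteq> 0" using S assms(1) order_root by blast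
  then have "order a S = Suc (order a (pderiv S))" by (intro order_pderiv S assms(1))
  moreover have "e \<le> order a (pderiv S)" using assms(2) False by (simp add: order_divides)
  ultimately have "Suc e \<le> order a S" by simp
  then show ?thesis unfolding order_divides by (rule disjI2)
qed

locale euler_system =
  fixes m :: nat and A :: "nat \<Rightarrow> nat \<Rightarrow> 'a::{field_char_0,field_gcd} poly"
begin

text \<open>The system is \<open>euler p = A p\<close>. \<open>nab\<close> measures how far
  \<open>p\<close> is from solving it, and \<open>nabf\<close> is the dual derivation on linear
  forms, with the sign that turns \<open>euler_pairing\<close> into the Leibniz rule.\<close>

definition nab :: "(nat \<Rightarrow> 'a poly) \<Rightarrow> nat \<Rightarrow> 'a poly" where
  "nab p i = euler (p i) - (\<Sum>j<m. A i j * p j)"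

definition nabf :: "(nat \<Rightarrow> 'a poly) \<Rightarrow> nat \<Rightarrow> 'a poly" where
  "nabf G j = euler (G j) + (\<Sum>i<m. G i * A i j)"

lemma euler_pairing:
  "euler (\<Sum>i<m. G i * p i) = (\<Sum>i<m. nabf G i * p i) + (\<Sum>i<m. G i * nab p i)"
proof -
  have "(\<Sum>j<m. (\<Sum>i<m. G i * A i j) * p j) = (\<Sum>i<m. G i * (\<Sum>j<m. A i j * p j))"
    unfolding sum_distrib_left sum_distrib_right by (subst sum.swap) (simp add: mult.assoc)
  then show ?thesis
    by (simp add: euler_sum euler_mult nab_def nabf_def sum.distrib sum_subtractf algebra_simps)
qed

definition iter_mat :: "(nat \<Rightarrow> 'a poly) \<Rightarrow> 'a poly mat" where
  "iter_mat p = mat m m (\<lambda>(j, i). (nab ^^ j) p i)"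

lemma iter_mat_carrier [simp]: "iter_mat p \<in> carrier_mat m m"
  by (simp add: iter_mat_def)

text \<open>The first \<open>l\<close> iterates of \<open>p\<close> span the module generated by \<open>p\<close>, where \<open>l\<close> is the position
  of the first linear dependence; \<open>S\<close> is the annihilator of that module.\<close>

lemma stable_annihilator:
  assumes "det (iter_mat p) = 0"
  obtains S where
    "\<exists>G\<in>S. \<exists>i<m. G i \<noteq> 0"
    "\<And>G H a b. G \<in> S \<Longrightarrow> H \<in> S \<Longrightarrow> (\<lambda>i. a * G i + b * H i) \<in> S"
    "\<And>G. G \<in> S \<Longrightarrow> nabf G \<in> S"
    "\<And>G. G \<in> S \<Longrightarrow> (\<Sum>i<m. G i * p i) = 0"
proof -
  have "det (iter_mat p)\<^sup>T = 0" using assms det_transpose iter_mat_carrier by metis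
  then obtain v where v: "v \<in> carrier_vec m" "v \<noteq> 0\<^sub>v m" "(iter_mat p)\<^sup>T *\<^sub>v v = 0\<^sub>v m"
    using det_0_iff_vec_prod_zero[of "(iter_mat p)\<^sup>T" m] by auto
  define b where "b j = v $ j" for j
  have dep: "(\<Sum>j<m. b j * (nab ^^ j) p i) = 0" if "i < m" for i
  proof -
    have "((iter_mat p)\<^sup>T *\<^sub>v v) $ i = 0" using v that by simp
    also have "((iter_mat p)\<^sup>T *\<^sub>v v) $ i = (\<Sum>j<m. (nab ^^ j) p i * b j)"
      using that v(1) by (simp add: iter_mat_def scalar_prod_def b_def atLeast0LessThan)
    finally show ?thesis by (simp add: mult.commute)
  qed
  have ex: "\<exists>j<m. b j \<noteq> 0" using nonzero_vec_index[OF v(1,2)] by (simp add: b_def)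
  \<comment> \<open>\<open>l\<close> is the last index that occurs in the relation. A form that
    kills the iterates before \<open>l\<close> therefore kills iterate \<open>l\<close> too, since
    \<open>b l\<close> is nonzero and polynomials have no zero divisors.\<close>
  define l where "l = Max {j. j < m \<and> b j \<noteq> 0}"
  have l: "l < m" "b l \<noteq> 0"
    using Max_in[of "{j. j < m \<and> b j \<noteq> 0}"] ex unfolding l_def by auto
  have bl: "b j = 0" if "l < j" "j < m" for j
    using Max_ge[of "{j. j < m \<and> b j \<noteq> 0}" j] that unfolding l_def[symmetric] by fastforce
  have dep': "(\<Sum>j\<le>l. b j * (nab ^^ j) p i) = 0" if "i < m" for i
  proof -
    have "(\<Sum>j\<le>l. b j * (nab ^^ j) p i) = (\<Sum>j<m. b j * (nab ^^ j) p i)"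
      using l bl by (intro sum.mono_neutral_left) auto
    then show ?thesis using dep that by simp
  qed
  define S where "S = {G. \<forall>j<l. (\<Sum>i<m. G i * (nab ^^ j) p i) = 0}"
  have kill: "(\<Sum>i<m. G i * (nab ^^ l) p i) = 0" if "G \<in> S" for G
  proof -
    have "0 = (\<Sum>i<m. G i * (\<Sum>j\<le>l. b j * (nab ^^ j) p i))" using dep' by simp
    also have "\<dots> = (\<Sum>j\<le>l. b j * (\<Sum>i<m. G i * (nab ^^ j) p i))"
      unfolding sum_distrib_left by (subst sum.swap) (simp add: algebra_simps)
    also have "\<dots> = b l * (\<Sum>i<m. G i * (nab ^^ l) p i)"
      using that by (subst sum.remove[of _ l]) (auto simp: S_def intro!: sum.neutral)
    finally show ?thesis using l by simp
  qed
  show ?thesis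
  proof (rule that[of S])
    \<comment> \<open>Row \<open>l\<close> of this matrix is zero because \<open>l < m\<close>, so
      it is singular; a kernel vector is a nonzero form in the annihilator.\<close>
    define B where "B = mat m m (\<lambda>(j, i). if j < l then (nab ^^ j) p i else 0)"
    have "det B = 0"
    proof -
      have "B\<^sup>T *\<^sub>v unit_vec m l = 0\<^sub>v m"
        using l by (intro eq_vecI) (auto simp: B_def)
      moreover have "unit_vec m l \<noteq> 0\<^sub>v m" using l by simp
      moreover have "B\<^sup>T \<in> carrier_mat m m" by (simp add: B_def)
      ultimately have "det B\<^sup>T = 0"
        using det_0_iff_vec_prod_zero[of "B\<^sup>T" m] unit_vec_carrier by blast
      then show ?thesis using det_transpose[of B m] by (simp add: B_def)
    qed
    then obtain w where w: "w \<in> carrier_vec m" "w \<noteq> 0\<^sub>v m" "B *\<^sub>v w = 0\<^sub>v m"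
      using det_0_iff_vec_prod_zero[of B m] by (auto simp: B_def)
    have "(\<lambda>i. w $ i) \<in> S"
      unfolding S_def
    proof (intro CollectI allI impI)
      fix j assume j: "j < l"
      have "(B *\<^sub>v w) $ j = 0" using w l j by simp
      also have "(B *\<^sub>v w) $ j = (\<Sum>i<m. (nab ^^ j) p i * w $ i)"
        using j l w(1) by (simp add: B_def scalar_prod_def atLeast0LessThan)
      finally show "(\<Sum>i<m. w $ i * (nab ^^ j) p i) = 0" by (simp add: mult.commute)
    qed
    moreover have "\<exists>i<m. w $ i \<noteq> 0" using nonzero_vec_index[OF w(1,2)] .
    ultimately show "\<exists>G\<in>S. \<exists>i<m. G i \<noteq> 0" by blast
  next
    fix G H a b assume "G \<in> S" "H \<in> S"
    then show "(\<lambda>i. a * G i + b * H i) \<in> S"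
      by (auto simp: S_def algebra_simps sum.distrib simp flip: sum_distrib_left)
  next
    fix G assume G: "G \<in> S"
    show "nabf G \<in> S"
      unfolding S_def
    proof (intro CollectI allI impI)
      fix j assume j: "j < l"
      have "(\<Sum>i<m. G i * (nab ^^ j) p i) = 0" using G j by (simp add: S_def)
      moreover have "(\<Sum>i<m. G i * nab ((nab ^^ j) p) i) = 0"
      proof (cases "Suc j = l")
        case True
        then show ?thesis using kill[OF G] by auto
      next
        case False
        then have "(\<Sum>i<m. G i * (nab ^^ Suc j) p i) = 0" using G j unfolding S_def mem_Collect_eq by (metis Suc_lessI)
        then show ?thesis by simp
      qed
      ultimately show "(\<Sum>i<m. nabf G i * (nab ^^ j) p i) = 0"
        using euler_pairing[of G "(nab ^^ j) p"] by simp
    qed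
  next
    fix G assume G: "G \<in> S"
    show "(\<Sum>i<m. G i * p i) = 0"
      using G kill[OF G] by (cases "l = 0") (auto simp: S_def)
  qed
qed

section \<open>Zeros of the determinant of the iterates at 0 and at 1, and its degree\<close>

lemma X_power_dvd_nab:
  assumes "\<And>i. i < m \<Longrightarrow> [:0, 1:] ^ T dvd v i" "i < m"
  shows "[:0, 1:] ^ T dvd nab v i"
  unfolding nab_def using assms by (intro dvd_diff X_power_dvd_euler dvd_sum) auto

lemma nab_diff: "nab (\<lambda>i. p i - q i) i = nab p i - nab q i"
  by (simp add: nab_def euler_diff sum_subtractf right_diff_distrib)

lemma nab_scale: "nab (\<lambda>i. Q * u i) i = euler Q * u i + Q * nab u i"
  by (simp add: nab_def euler_mult algebra_simps sum_distrib_left)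

text \<open>Modulo the power of x, \<open>u\<close> solves the system, so \<open>nab\<close> applied
  to \<open>Q * u\<close> differentiates only the scalar factor.\<close>

lemma X_power_dvd_iterate:
  assumes "\<And>i. i < m \<Longrightarrow> [:0, 1:] ^ T dvd nab u i"
    and "\<And>i. i < m \<Longrightarrow> [:0, 1:] ^ T dvd p i - Q * u i" and "i < m"
  shows "[:0, 1:] ^ T dvd (nab ^^ j) p i - (euler ^^ j) Q * u i"
  using assms(3)
proof (induction j arbitrary: i)
  case 0
  then show ?case using assms(2) by simp
next
  case (Suc j)
  let ?p = "(nab ^^ j) p" and ?Q = "(euler ^^ j) Q"
  have "nab ?p i - euler ?Q * u i = nab (\<lambda>i. ?p i - ?Q * u i) i + ?Q * nab u i"
    by (simp add: nab_diff nab_scale)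
  then show ?case
    using X_power_dvd_nab[OF Suc.IH Suc.prems] assms(1)[OF Suc.prems] by (simp del: mult_pCons_left)
qed

text \<open>Modulo the power of x every row of the matrix is a multiple of \<open>u\<close>, so the
  matrix has rank at most 1 there. As \<open>u 0 = 1\<close>, subtracting multiples of column 0
  makes each of the other m - 1 columns divisible.\<close>

lemma X_power_dvd_det:
  assumes "\<And>i. i < m \<Longrightarrow> [:0, 1:] ^ T dvd nab u i"
    and "\<And>i. i < m \<Longrightarrow> [:0, 1:] ^ T dvd p i - Q * u i" and u0: "u 0 = 1"
  shows "[:0, 1:] ^ (T * (m - 1)) dvd det (iter_mat p)"
proof -
  \<comment> \<open>\<open>E\<close> performs these column operations and has determinant 1;
    \<open>Dg\<close> collects the factors that come out of the columns.\<close>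
  define E where "E = mat m m (\<lambda>(k, i). if k = i then 1 else if k = 0 then - u i else 0)"
  define d where "d i = (if i = 0 then 1 else [:0, 1:] ^ T :: 'a poly)" for i :: nat
  define Dg where "Dg = mat m m (\<lambda>(k, i). if k = i then d i else 0)"
  have "\<exists>q. i < m \<longrightarrow> (iter_mat p * E) $$ (j, i) = q * d i" if "j < m" for i j
  proof (cases "i = 0 \<or> \<not> i < m")
    case True then show ?thesis by (auto simp: d_def)
  next
    case False
    have "(iter_mat p * E) $$ (j, i) = (\<Sum>k<m. (nab ^^ j) p k * (if k = i then 1 else if k = 0 then - u i else 0))"
      using that False by (simp add: iter_mat_def E_def scalar_prod_def atLeast0LessThan)
    also have "\<dots> = (\<Sum>k\<in>{0, i}. (nab ^^ j) p k * (if k = i then 1 else if k = 0 then - u i else 0))"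
      using that False by (intro sum.mono_neutral_right) auto
    also have "\<dots> = (nab ^^ j) p i - u i * (nab ^^ j) p 0" using False by simp
    also have "\<dots> = ((nab ^^ j) p i - (euler ^^ j) Q * u i) - u i * ((nab ^^ j) p 0 - (euler ^^ j) Q * u 0)"
      by (simp add: u0 algebra_simps)
    finally have eq: "(iter_mat p * E) $$ (j, i) = \<dots>" .
    have "[:0, 1:] ^ T dvd (iter_mat p * E) $$ (j, i)"
      unfolding eq
      by (rule dvd_diff[OF X_power_dvd_iterate[OF assms(1,2)] dvd_mult[OF X_power_dvd_iterate[OF assms(1,2)]]])
        (use False in auto)
    then show ?thesis using False by (auto simp: d_def elim!: dvdE intro: mult.commute)
  qed
  then obtain q where q: "\<And>i j. j < m \<Longrightarrow> i < m \<Longrightarrow> (iter_mat p * E) $$ (j, i) = q j i * d i" by metis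
  define N where "N = mat m m (\<lambda>(j, i). q j i)"
  have "iter_mat p * E = N * Dg"
  proof (rule eq_matI)
    fix j i assume ji: "j < dim_row (N * Dg)" "i < dim_col (N * Dg)"
    then have ji': "j < m" "i < m" by (auto simp: N_def Dg_def)
    have "(N * Dg) $$ (j, i) = (\<Sum>k<m. q j k * (if k = i then d i else 0))"
      using ji' by (simp add: N_def Dg_def scalar_prod_def atLeast0LessThan)
    also have "\<dots> = q j i * d i" using ji' by (simp add: if_distrib cong: if_cong)
    finally show "(iter_mat p * E) $$ (j, i) = (N * Dg) $$ (j, i)" using q ji' by simp
  qed (auto simp: iter_mat_def E_def N_def Dg_def)
  moreover have "det E = 1"
  proof -
    have "det E = prod_list (diag_mat E)"
      by (rule det_upper_triangular[of _ m]) (auto simp: E_def upper_triangular_def)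
    also have "diag_mat E = map (\<lambda>_. 1) [0..<m]" by (auto simp: diag_mat_def E_def)
    finally show ?thesis by (simp add: prod.distinct_set_conv_list[symmetric])
  qed
  moreover have "det Dg = [:0, 1:] ^ (T * (m - 1))"
  proof -
    have "det Dg = prod_list (diag_mat Dg)"
      by (rule det_upper_triangular[of _ m]) (auto simp: Dg_def upper_triangular_def)
    also have "diag_mat Dg = map d [0..<m]" by (auto simp: diag_mat_def Dg_def)
    also have "prod_list \<dots> = (\<Prod>i\<in>{0..<m}. d i)" by (simp add: prod.distinct_set_conv_list[symmetric])
    also have "\<dots> = (\<Prod>i\<in>{1..<m}. [:0, 1:] ^ T)"
      by (rule prod.mono_neutral_cong_right) (auto simp: d_def)
    finally show ?thesis by (simp add: power_mult)
  qed
  ultimately have "det (iter_mat p) = det N * [:0, 1:] ^ (T * (m - 1))"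
    using det_mult[of "iter_mat p" m E] det_mult[of N m Dg] by (simp add: E_def N_def Dg_def)
  then show ?thesis by simp
qed

text \<open>The point 1 is an ordinary point, since the factor x in \<open>euler\<close> does not
  vanish there. Hence the dual system has a power series solution in x - 1 with any prescribed
  value; the polynomials are its truncations.\<close>

lemma ex_approx_solution:
  "\<exists>c'. (\<forall>i. poly (c' i) 1 = c i) \<and> (\<forall>j<m. [:-1, 1:] ^ K dvd nabf c' j)"
proof (induction K)
  case 0
  then show ?case by (intro exI[of _ "\<lambda>i. [:c i:]"]) auto
next
  case (Suc K)
  then obtain c' where c': "\<And>i. poly (c' i) 1 = c i" "\<And>j. j < m \<Longrightarrow> [:-1, 1:] ^ K dvd nabf c' j"
    by blast
  let ?Y = "[:-1, 1:] :: 'a poly"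
  from c'(2) obtain e where e: "\<And>j. j < m \<Longrightarrow> nabf c' j = ?Y ^ K * e j"
    unfolding dvd_def by metis
  \<comment> \<open>The Euler derivative of (x - 1)^(K + 1) is (K + 1) x (x - 1)^K, so this choice
    cancels the coefficient of (x - 1)^K in \<open>nabf c' j\<close>.\<close>
  define d where "d j = - poly (e j) 1 / of_nat (Suc K)" for j
  define c2 where "c2 j = c' j + [:d j:] * ?Y ^ Suc K" for j
  have eY: "euler (?Y ^ Suc K) = of_nat (Suc K) * ([:0, 1:] * ?Y ^ K)"
    unfolding euler_def pderiv_power_Suc by (simp add: pderiv_pCons of_nat_poly)
  have "?Y ^ Suc K dvd nabf c2 j" if j: "j < m" for j
  proof -
    have "euler [:d j:] = 0" by (simp add: euler_def pderiv_pCons)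
    then have "nabf c2 j = nabf c' j + [:d j:] * euler (?Y ^ Suc K) + (\<Sum>i<m. [:d i:] * ?Y ^ Suc K * A i j)"
      unfolding nabf_def c2_def euler_add distrib_right sum.distrib
      by (subst euler_mult) (simp add: algebra_simps)
    also have "\<dots> = ?Y ^ K * (e j + [:d j * of_nat (Suc K):] * [:0, 1:]) + ?Y ^ Suc K * (\<Sum>i<m. [:d i:] * A i j)"
      unfolding e[OF j] eY sum_distrib_left by (simp add: of_nat_poly algebra_simps)
    finally have eq: "nabf c2 j = \<dots>" .
    have "poly (e j + [:d j * of_nat (Suc K):] * [:0, 1:]) 1 = 0"
      by (simp add: d_def del: of_nat_Suc)
    then have "?Y dvd e j + [:d j * of_nat (Suc K):] * [:0, 1:]" by (simp only: poly_eq_0_iff_dvd)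
    then have "?Y ^ K * ?Y dvd ?Y ^ K * (e j + [:d j * of_nat (Suc K):] * [:0, 1:])"
      by (rule mult_dvd_mono[OF dvd_refl])
    then show ?thesis unfolding eq power_Suc2[of ?Y] by (rule dvd_add[OF _ dvd_triv_left])
  qed
  moreover have "poly (c2 i) 1 = c i" for i by (simp add: c2_def c')
  ultimately show ?case by blast
qed

text \<open>The constants \<open>c\<close> are extended to an approximate solution \<open>c'\<close>
  of the dual system. Then the Euler derivative of \<open>S j\<close> is \<open>S (Suc j)\<close> up
  to high order at 1, so vanishing values of consecutive \<open>S j\<close> add up to a zero of high
  order. Cramer's rule transfers it to the determinant times \<open>c' i0\<close>, and
  \<open>c' i0\<close> does not vanish at 1.\<close>

lemma linear_power_dvd_det:
  assumes K: "\<And>k. k \<le> K \<Longrightarrow> (\<Sum>i<m. c i * poly ((nab ^^ k) p i) 1) = 0" and c: "i0 < m" "c i0 \<noteq> 0"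
  shows "[:-1, 1:] ^ (K - m) dvd det (iter_mat p)"
proof -
  let ?Y = "[:-1, 1:] :: 'a poly"
  obtain c' where c': "\<And>i. poly (c' i) 1 = c i" "\<And>j. j < m \<Longrightarrow> ?Y ^ K dvd nabf c' j"
    using ex_approx_solution[of c K] by blast
  define S where "S j = (\<Sum>i<m. c' i * (nab ^^ j) p i)" for j
  have S1: "poly (S j) 1 = 0" if "j \<le> K" for j
    using K[OF that] by (simp add: S_def poly_sum c')
  have Y: "?Y ^ e dvd S j" if "j + e \<le> Suc K" "e \<le> K" for j e
    using that
  proof (induction e arbitrary: j)
    case (Suc e)
    have "euler (S j) = (\<Sum>i<m. nabf c' i * (nab ^^ j) p i) + S (Suc j)"
      unfolding S_def euler_pairing by simp
    moreover have "?Y ^ e dvd (\<Sum>i<m. nabf c' i * (nab ^^ j) p i)"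
    proof (rule dvd_sum)
      fix i assume "i \<in> {..<m}"
      then have "?Y ^ K dvd nabf c' i" using c'(2) by simp
      moreover have "?Y ^ e dvd ?Y ^ K" by (rule le_imp_power_dvd) (use Suc.prems in simp)
      ultimately show "?Y ^ e dvd nabf c' i * (nab ^^ j) p i" by (metis dvd_mult2 dvd_trans)
    qed
    moreover have "?Y ^ e dvd S (Suc j)" by (rule Suc.IH) (use Suc.prems in simp_all)
    ultimately have "?Y ^ e dvd euler (S j)" by (simp only: dvd_add)
    \<comment> \<open>The factor x of the Euler operator is invertible modulo powers of x - 1, so
      divisibility passes to the ordinary derivative.\<close>
    moreover have "coprime (?Y ^ e) [:0, 1:]"
    proof -
      have "coprime ?Y [:0, 1:]"
      proof (rule coprimeI)
        fix d :: "'a poly" assume "d dvd ?Y" "d dvd [:0, 1:]"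
        then have "d dvd [:0, 1:] - ?Y" by (rule dvd_diff[rotated])
        then show "is_unit d" by (simp add: one_pCons)
      qed
      then show ?thesis by (simp only: coprime_power_left_iff simp_thms)
    qed
    ultimately have "?Y ^ e dvd pderiv (S j)"
      unfolding euler_def by (simp only: coprime_dvd_mult_right_iff)
    moreover have "poly (S j) 1 = 0" by (rule S1) (use Suc.prems in simp)
    ultimately show ?case by (intro linear_power_dvd_of_pderiv)
  qed auto
  define cv where "cv = vec m c'"
  have "iter_mat p *\<^sub>v cv = vec m S"
    by (intro eq_vecI) (auto simp: iter_mat_def cv_def S_def scalar_prod_def atLeast0LessThan mult.commute)
  then have "adj_mat (iter_mat p) *\<^sub>v vec m S = adj_mat (iter_mat p) *\<^sub>v (iter_mat p *\<^sub>v cv)" by simp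
  also have "\<dots> = (adj_mat (iter_mat p) * iter_mat p) *\<^sub>v cv"
    by (subst assoc_mult_mat_vec[of _ m m _ m]) (auto simp: adj_mat(1) cv_def)
  also have "\<dots> = det (iter_mat p) \<cdot>\<^sub>v cv"
    by (subst adj_mat(3)[of _ m]) (auto simp: cv_def intro!: eq_vecI)
  finally have "(adj_mat (iter_mat p) *\<^sub>v vec m S) $ i0 = det (iter_mat p) * c' i0"
    using c by (simp add: cv_def)
  moreover have "(adj_mat (iter_mat p) *\<^sub>v vec m S) $ i0 = (\<Sum>j<m. adj_mat (iter_mat p) $$ (i0, j) * S j)"
    using c adj_mat(1)[OF iter_mat_carrier[of p]] by (auto simp: scalar_prod_def atLeast0LessThan)
  moreover have "?Y ^ (K - m) dvd (\<Sum>j<m. adj_mat (iter_mat p) $$ (i0, j) * S j)"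
  proof (cases "m \<le> K")
    case True
    then show ?thesis by (intro dvd_sum dvd_mult Y) auto
  qed simp
  ultimately have "?Y ^ (K - m) dvd det (iter_mat p) * c' i0" by simp
  moreover have "coprime (?Y ^ (K - m)) (c' i0)"
  proof -
    have "\<not> ?Y dvd c' i0" using c c'(1)[of i0] poly_eq_0_iff_dvd[of "c' i0" 1] by auto
    moreover have "prime_elem ?Y" by (rule prime_elem_linear_field_poly) simp
    ultimately have "coprime ?Y (c' i0)" by (rule prime_elem_imp_coprime[rotated])
    then show ?thesis by (simp add: coprime_power_left_iff)
  qed
  ultimately show ?thesis by (simp add: coprime_dvd_mult_left_iff)
qed

lemma degree_iterate:
  assumes "\<And>i j. i < m \<Longrightarrow> j < m \<Longrightarrow> degree (A i j) \<le> b" "\<And>i. i < m \<Longrightarrow> degree (p i) \<le> n" "i < m"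
  shows "degree ((nab ^^ j) p i) \<le> n + b * j"
  using assms(3)
proof (induction j arbitrary: i)
  case (Suc j)
  let ?p = "(nab ^^ j) p"
  have "degree (\<Sum>k<m. A i k * ?p k) \<le> n + b * Suc j"
  proof (intro degree_sum_le)
    fix k assume "k \<in> {..<m}"
    then show "degree (A i k * ?p k) \<le> n + b * Suc j"
      using degree_mult_le[of "A i k" "?p k"] assms(1)[of i k] Suc.IH[of k] Suc.prems by auto
  qed auto
  moreover have "degree (euler (?p i)) \<le> n + b * Suc j"
    using degree_euler_le[of "?p i"] Suc.IH[OF Suc.prems] by simp
  ultimately show ?case by (simp add: nab_def[of "(nab ^^ j) p"] degree_diff_le)
qed (use assms(2) in auto)

lemma degree_det_iter_mat:
  assumes "\<And>i j. i < m \<Longrightarrow> j < m \<Longrightarrow> degree (A i j) \<le> b" "\<And>i. i < m \<Longrightarrow> degree (p i) \<le> n"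
  shows "degree (det (iter_mat p)) \<le> m * (n + b * m)"
proof -
  have "degree (signof \<pi> * (\<Prod>i = 0..<m. iter_mat p $$ (i, \<pi> i))) \<le> m * (n + b * m)"
    if pi: "\<pi> permutes {0..<m}" for \<pi>
  proof -
    have "degree (\<Prod>i = 0..<m. iter_mat p $$ (i, \<pi> i)) \<le> (\<Sum>i = 0..<m. degree (iter_mat p $$ (i, \<pi> i)))"
      using degree_prod_sum_le[of "{0..<m}" "\<lambda>i. iter_mat p $$ (i, \<pi> i)"] by (simp add: o_def)
    also have "\<dots> \<le> (\<Sum>i = 0..<m. n + b * m)"
    proof (rule sum_mono)
      fix i assume i: "i \<in> {0..<m}"
      then have "\<pi> i < m" using pi permutes_in_image by fastforce
      then have "degree (iter_mat p $$ (i, \<pi> i)) \<le> n + b * i"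
        using i degree_iterate[OF assms] by (simp add: iter_mat_def)
      also have "\<dots> \<le> n + b * m" using i by simp
      finally show "degree (iter_mat p $$ (i, \<pi> i)) \<le> n + b * m" .
    qed
    finally show ?thesis by (simp add: sign_def)
  qed
  then show ?thesis
    unfolding det_def'[OF iter_mat_carrier] by (intro degree_sum_le) (auto simp: finite_permutations)
qed

end

section \<open>Towers over the exponential function\<close>

text \<open>For y = a / b the equation is \<open>euler y\<close> = (t + s x) y. If s were nonzero,
  the right side would have the larger degree.\<close>

lemma no_rational_exponential:
  fixes a b :: "'a::field_char_0 poly"
  assumes "a \<noteq> 0" "b \<noteq> 0" and eq: "b * euler a - a * euler b = [:t, s:] * a * b"
  shows "s = 0"
proof (rule ccontr)
  assume "s \<noteq> 0"
  then have "degree ([:t, s:] * a * b) = Suc (degree a + degree b)"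
    using assms(1,2) by (simp add: degree_mult_eq del: mult_pCons_left)
  moreover have "degree (b * euler a - a * euler b) \<le> degree a + degree b"
    using degree_mult_le[of b "euler a"] degree_mult_le[of a "euler b"] degree_euler_le[of a] degree_euler_le[of b]
    by (intro degree_diff_le) linarith+
  ultimately show False using eq by simp
qed

text \<open>The equation is \<open>euler y\<close> = c for y = a / b, solved by c log x. The top
  coefficient on the left carries the factor \<open>degree a - degree b\<close>: it vanishes for
  equal degrees, and unequal degrees contradict the degree of the right side.\<close>

lemma no_rational_log:
  fixes a b :: "'a::field_char_0 poly"
  assumes b: "b \<noteq> 0" and eq: "b * euler a - a * euler b = [:c:] * b * b"
  shows "c = 0"
proof (rule ccontr)
  assume c: "c \<noteq> 0"
  let ?e = "degree a" and ?f = "degree b"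
  have lead: "coeff (b * euler a - a * euler b) (?e + ?f) = (of_nat ?e - of_nat ?f) * coeff a ?e * coeff b ?f"
  proof -
    have "coeff (p * q) (e + f) = coeff p e * coeff q f"
      if "degree p \<le> e" "degree q \<le> f" for p q :: "'a poly" and e f
      using that
    proof -
      have "coeff (p * q) (e + f) = (\<Sum>i\<le>e + f. if i = e then coeff p e * coeff q f else 0)"
        unfolding coeff_mult
      proof (rule sum.cong[OF refl])
        fix i assume "i \<in> {..e + f}"
        then show "coeff p i * coeff q (e + f - i) = (if i = e then coeff p e * coeff q f else 0)"
          using that by (cases "i < e"; cases "i = e") (auto simp: coeff_eq_0)
      qed
      then show ?thesis by simp
    qed
    note * = this
    show ?thesis
      using *[of b ?f "euler a" ?e] *[of a ?e "euler b" ?f]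
      by (simp add: degree_euler_le coeff_euler algebra_simps)
  qed
  have "degree ([:c:] * b * b) = ?f + ?f" using c b by (simp add: degree_mult_eq)
  then have deg: "degree (b * euler a - a * euler b) = ?f + ?f" unfolding eq .
  have a: "a \<noteq> 0" using eq b c by auto
  have "degree (b * euler a - a * euler b) \<le> ?e + ?f"
    using degree_mult_le[of b "euler a"] degree_mult_le[of a "euler b"] degree_euler_le[of a] degree_euler_le[of b]
    by (intro degree_diff_le) linarith+
  then have "?f \<le> ?e" using deg by simp
  show False
  proof (cases "?e = ?f")
    case True
    have "coeff ([:c:] * b * b) (?f + ?f) \<noteq> 0"
      using c b coeff_mult_degree_sum[of b b] by simp
    then show False using lead True eq by simp
  next
    case False
    then have "coeff (b * euler a - a * euler b) (?e + ?f) \<noteq> 0" unfolding lead using a b by simp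
    then have "?e + ?f \<le> ?f + ?f" using deg le_degree by metis
    then show False using \<open>?f \<le> ?e\<close> False by simp
  qed
qed

text \<open>The equation is \<open>euler y\<close> + (kap - x) y = B for y = a / b. In lowest terms
  the denominator is a power of x, and a pole of order i at 0 would force kap = i. So y is a
  polynomial; it is excluded by the value at 0 if kap = 0, and otherwise by degree, as -x y has
  positive degree.\<close>

lemma no_rational_inhomogeneous:
  fixes a b B :: "'a::{field_char_0,field_gcd} poly"
  assumes b: "b \<noteq> 0" and eq: "b * euler a - a * euler b + [:kap, -1:] * a * b = B * b * b"
    and B: "kap = 0 \<and> poly B 0 \<noteq> 0 \<or> kap \<notin> \<int> \<and> degree B = 0 \<and> B \<noteq> 0"
  shows False
proof -
  define g where "g = gcd a b"
  have g: "g \<noteq> 0" using b by (simp add: g_def)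
  obtain a' b' where ab: "a = a' * g" "b = b' * g" and cop: "coprime a' b'"
    using gcd_coprime_exists[of a b] g unfolding g_def by blast
  have "(b' * euler a' - a' * euler b' + [:kap, -1:] * a' * b') * (g * g) = (B * b' * b') * (g * g)"
    using eq unfolding ab euler_mult by (simp add: algebra_simps)
  then have eq': "b' * euler a' - a' * euler b' + [:kap, -1:] * a' * b' = B * b' * b'" using g by simp
  have b': "b' \<noteq> 0" using b ab by auto
  have "a' * euler b' = b' * (euler a' + [:kap, -1:] * a' - B * b')"
    using eq' by (simp add: algebra_simps)
  then have "b' dvd a' * euler b'" by (metis dvd_triv_left)
  then have "b' dvd euler b'" using cop by (metis coprime_commute coprime_dvd_mult_right_iff)
  then obtain r where r: "euler b' = b' * r" by (auto elim: dvdE)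
  have "degree r = 0"
  proof (cases "r = 0")
    case False
    then show ?thesis using r b' degree_euler_le[of b'] by (simp add: degree_mult_eq)
  qed simp
  then obtain c where c: "r = [:c:]" using degree_eq_zeroE by blast
  \<comment> \<open>Since \<open>b'\<close> divides its Euler derivative with constant quotient
    \<open>c\<close>, a coefficient of index k can be nonzero only if k = c. Hence \<open>b'\<close>
    is a monomial.\<close>
  have coef: "of_nat k * coeff b' k = c * coeff b' k" for k
    using r c coeff_euler[of b' k] by (auto simp: mult.commute)
  define i where "i = degree b'"
  have ci: "c = of_nat i" using coef[of i] b' by (simp add: i_def)
  have low: "coeff b' k = 0" if "k \<noteq> i" for k using coef[of k] ci that by auto
  have eq2: "euler a' + [:kap - c, -1:] * a' = B * b'"
  proof -
    have "b' * (euler a' + [:kap - c, -1:] * a') = b' * (B * b')"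
      using eq' unfolding r c by (simp add: algebra_simps smult_diff_left)
    then show ?thesis using b' by simp
  qed
  from arg_cong[OF this, of "\<lambda>p. poly p 0"]
  have at0: "(kap - c) * poly a' 0 = poly B 0 * poly b' 0" by (simp add: euler_def)
  show False
  proof (cases "i = 0")
    case False
    then have "poly b' 0 = 0" using low[of 0] by (simp add: poly_0_coeff_0)
    moreover from this have "poly a' 0 \<noteq> 0"
      using cop coprime_poly_0 by blast
    ultimately have "kap = of_nat i" using at0 ci by simp
    then show False using B False by auto
  next
    case True
    show False
    proof (cases "kap = 0")
      case True
      have "poly b' 0 \<noteq> 0"
        using b' \<open>i = 0\<close> leading_coeff_neq_0[of b'] unfolding i_def poly_0_coeff_0 by simp
      then show False using at0 B True ci \<open>i = 0\<close> by auto
    next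
      case False
      then have B': "degree B = 0" "B \<noteq> 0" using B by auto
      have "a' \<noteq> 0" using eq2 B' b' by auto
      then have "coeff (euler a' + [:kap - c, -1:] * a') (Suc (degree a')) \<noteq> 0"
        by (simp add: coeff_euler coeff_eq_0)
      moreover have "degree (B * b') = 0" using B' b' True by (simp add: degree_mult_eq i_def)
      then have "coeff (B * b') (Suc (degree a')) = 0" by (simp add: coeff_eq_0)
      ultimately show False unfolding eq2 by blast
    qed
  qed
qed

context euler_system
begin

text \<open>\<open>G\<close> is taken with the least possible leading index \<mu>. Triangularity
  keeps \<open>nabf G\<close> below that index, and the combination of \<open>nabf G\<close> and
  \<open>G\<close> that cancels the component \<mu> lies in \<open>S\<close> with a smaller leading
  index, so it is zero.\<close>

lemma stable_eigenform:
  assumes tri: "\<And>i j. i < j \<Longrightarrow> j < m \<Longrightarrow> A i j = 0"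
    and S: "\<exists>G\<in>S. \<exists>i<m. G i \<noteq> 0"
      "\<And>G H a b. G \<in> S \<Longrightarrow> H \<in> S \<Longrightarrow> (\<lambda>i. a * G i + b * H i) \<in> S"
      "\<And>G. G \<in> S \<Longrightarrow> nabf G \<in> S"
  obtains G \<mu> where "G \<in> S" "\<mu> < m" "G \<mu> \<noteq> 0" "\<And>i. \<mu> < i \<Longrightarrow> i < m \<Longrightarrow> G i = 0"
    "\<And>j. j < m \<Longrightarrow> G \<mu> * nabf G j = (euler (G \<mu>) + G \<mu> * A \<mu> \<mu>) * G j"
proof -
  define Q where "Q \<mu> \<longleftrightarrow> (\<exists>G\<in>S. \<mu> < m \<and> G \<mu> \<noteq> 0 \<and> (\<forall>i. \<mu> < i \<longrightarrow> i < m \<longrightarrow> G i = 0))" for \<mu>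
  have exQ: "\<exists>\<mu>\<le>l. Q \<mu>" if G: "G \<in> S" "i < m" "G i \<noteq> 0" "\<And>j. l < j \<Longrightarrow> j < m \<Longrightarrow> G j = 0" for G i l
  proof -
    define t where "t = Max {i. i < m \<and> G i \<noteq> 0}"
    have "t \<in> {i. i < m \<and> G i \<noteq> 0}" unfolding t_def using G by (intro Max_in) auto
    then have t: "t < m" "G t \<noteq> 0" by simp_all
    have "j \<le> t" if "j < m" "G j \<noteq> 0" for j
      unfolding t_def using that by (intro Max_ge) auto
    then have "\<forall>i. t < i \<longrightarrow> i < m \<longrightarrow> G i = 0" by force
    then have "Q t" using G(1) t unfolding Q_def by blast
    moreover have "t \<le> l" using t G(4) by (metis not_le)
    ultimately show ?thesis by blast
  qed
  from S(1) obtain G0 i0 where "G0 \<in> S" "i0 < m" "G0 i0 \<noteq> 0" by blast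
  then have "\<exists>\<mu>. Q \<mu>" using exQ[of G0 i0 m] by force
  define \<mu> where "\<mu> = (LEAST \<mu>. Q \<mu>)"
  have "Q \<mu>" unfolding \<mu>_def by (rule LeastI_ex) fact
  then obtain G where G: "G \<in> S" "\<mu> < m" "G \<mu> \<noteq> 0" "\<And>i. \<mu> < i \<Longrightarrow> i < m \<Longrightarrow> G i = 0"
    unfolding Q_def by blast
  have top: "(\<Sum>i<m. G i * A i j) = (if j = \<mu> then G \<mu> * A \<mu> \<mu> else 0)" if "\<mu> \<le> j" "j < m" for j
  proof -
    have "G i * A i j = 0" if "i < m" "i \<noteq> j" for i
      using G(4)[of i] tri[of i j] that \<open>\<mu> \<le> j\<close> \<open>j < m\<close> by (cases "i < j") auto
    then have "(\<Sum>i<m. G i * A i j) = (\<Sum>i\<in>{j}. G i * A i j)"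
      using that by (intro sum.mono_neutral_right) auto
    then show ?thesis using G(4)[of j] that by auto
  qed
  let ?H = "\<lambda>j. G \<mu> * nabf G j + (- (euler (G \<mu>) + G \<mu> * A \<mu> \<mu>)) * G j"
  have HS: "?H \<in> S" by (intro S(2) S(3) G(1))
  have Htop: "?H j = 0" if "\<mu> \<le> j" "j < m" for j
    using top[OF that] G(4)[of j] that by (cases "j = \<mu>") (auto simp: nabf_def algebra_simps)
  have "?H j = 0" if j: "j < m" for j
  proof (rule ccontr)
    assume ne: "?H j \<noteq> 0"
    then have "\<mu> \<noteq> 0" using Htop[OF _ j] by (metis le0)
    then have "\<exists>\<nu>\<le>\<mu> - 1. Q \<nu>"
      by (intro exQ[of ?H j]) (use HS j ne Htop in auto)
    then obtain \<nu> where "\<nu> \<le> \<mu> - 1" "Q \<nu>" by blast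
    moreover from this have "\<mu> \<le> \<nu>" unfolding \<mu>_def by (intro Least_le)
    ultimately show False using \<open>\<mu> \<noteq> 0\<close> by simp
  qed
  then show thesis using that[of G \<mu>] G by (simp add: algebra_simps)
qed

end

text \<open>The two alternatives of \<open>nonelementary\<close> are the cases in which
  \<open>no_rational_inhomogeneous\<close> applies to y 1 / y 0. The first serves integral
  \<open>a\<close>, the second nonintegral \<open>a\<close>.\<close>

locale exp_tower =
  fixes q d :: nat and kap :: "'a::{field_char_0,field_gcd}" and B0 B1 :: "'a poly"
  assumes q: "1 \<le> q"
    and nonelementary: "kap = 0 \<and> poly B1 0 \<noteq> 0 \<or> kap \<notin> \<int> \<and> degree B1 = 0 \<and> B1 \<noteq> 0"
begin

definition mons :: "(nat \<Rightarrow> nat) set" where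
  "mons = {k. (\<forall>j>q. k j = 0) \<and> (\<Sum>j\<le>q. k j) \<le> d}"

text \<open>One evaluation lemma per move then covers all linear functions of the exponents: weight,
  total degree, number of factors of positive index, and the tie-breaking order.\<close>

definition lin :: "(nat \<Rightarrow> nat) \<Rightarrow> (nat \<Rightarrow> nat) \<Rightarrow> nat" where
  "lin w k = (\<Sum>j\<le>q. w j * k j)"

text \<open>The effect on exponents of replacing one factor y j by y (j - 1), as the derivation
  does; \<open>drop1\<close> belongs to the term \<open>B0\<close>, which replaces a factor y 1 by
  1.\<close>

definition shift :: "(nat \<Rightarrow> nat) \<Rightarrow> nat \<Rightarrow> nat \<Rightarrow> nat" where
  "shift k j = k(j := k j - 1, j - 1 := Suc (k (j - 1)))"

definition drop1 :: "(nat \<Rightarrow> nat) \<Rightarrow> nat \<Rightarrow> nat" where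
  "drop1 k = k(1 := k 1 - 1)"

definition lam :: "(nat \<Rightarrow> nat) \<Rightarrow> 'a poly" where
  "lam k = [:- kap * of_nat (lin (\<lambda>j. if j = 0 then 0 else 1) k), - of_nat (k 0):]"

text \<open>The coefficient of the monomial \<open>k'\<close> in the Euler derivative of the monomial \<open>k\<close>, where
  the variables satisfy \<open>\<delta> y\<^sub>0 = - x y\<^sub>0\<close>, \<open>\<delta> y\<^sub>1 = - kap y\<^sub>1 + B0 + B1 y\<^sub>0\<close> and
  \<open>\<delta> y\<^sub>j = - kap y\<^sub>j + y\<^sub>j\<^sub>-\<^sub>1\<close>.\<close>

definition dmat :: "(nat \<Rightarrow> nat) \<Rightarrow> (nat \<Rightarrow> nat) \<Rightarrow> 'a poly" where
  "dmat k k' = (if k' = k then lam k else 0)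
     + (\<Sum>j\<in>{2..q}. if 0 < k j \<and> k' = shift k j then of_nat (k j) else 0)
     + (if 0 < k 1 \<and> k' = drop1 k then of_nat (k 1) * B0 else 0)
     + (if 0 < k 1 \<and> k' = shift k 1 then of_nat (k 1) * B1 else 0)"

text \<open>Every off-diagonal entry of \<open>dmat\<close> lowers this weight by exactly 1; this is
  the source of triangularity.\<close>

definition wt :: "(nat \<Rightarrow> nat) \<Rightarrow> nat" where "wt = lin id"
text \<open>Moving a factor from index j \<ge> 2 to j - 1 raises this number by
  \<open>2 ^ (q + 1 - j)\<close>, more for smaller j. Moving a factor from index 1 to 0, or dropping
  it, lowers it. This separates monomials that have a common descendant.\<close>

definition lex :: "(nat \<Rightarrow> nat) \<Rightarrow> nat" where "lex = lin (\<lambda>j. if j = 0 then 1 else 2 ^ (q + 1 - j))"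

text \<open>A monomial order: by weight first; among monomials of equal weight, those involving
  variables of small positive index are larger.\<close>

definition rk :: "(nat \<Rightarrow> nat) \<Rightarrow> nat" where "rk k = wt k * ((d + 1) * 2 ^ (q + 1)) + lex k"

lemma lin_upd: "j \<le> q \<Longrightarrow> lin w (k(j := v)) + w j * k j = lin w k + w j * v"
  unfolding lin_def by (simp add: sum.remove[of "{..q}" j])

lemma lin_shift: "1 \<le> j \<Longrightarrow> j \<le> q \<Longrightarrow> 0 < k j \<Longrightarrow> lin w (shift k j) + w j = lin w k + w (j - 1)"
proof -
  assume j: "1 \<le> j" "j \<le> q" "0 < k j"
  have "lin w (k(j := k j - 1)) + w j * k j = lin w k + w j * (k j - 1)" using lin_upd j by simp
  then have 1: "lin w (k(j := k j - 1)) + w j = lin w k" using j by (cases "k j") auto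
  have "lin w (shift k j) + w (j - 1) * k (j - 1) = lin w (k(j := k j - 1)) + w (j - 1) * Suc (k (j - 1))"
  proof -
    have "(k(j := k j - 1)) (j - 1) = k (j - 1)" using j by auto
    then show ?thesis
      using lin_upd[of "j - 1" w "k(j := k j - 1)" "Suc (k (j - 1))"] j unfolding shift_def by auto
  qed
  then show ?thesis using 1 by simp
qed

lemma lin_drop1: "0 < k 1 \<Longrightarrow> lin w (drop1 k) + w 1 = lin w k"
proof -
  assume k: "0 < k 1"
  have "lin w (drop1 k) + w 1 * k 1 = lin w k + w 1 * (k 1 - 1)"
    unfolding drop1_def using lin_upd q by simp
  then show ?thesis using k by (cases "k 1") auto
qed

lemma wt_shift: "1 \<le> j \<Longrightarrow> j \<le> q \<Longrightarrow> 0 < k j \<Longrightarrow> Suc (wt (shift k j)) = wt k"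
  using lin_shift[of j k id] by (simp add: wt_def)

lemma wt_drop1: "0 < k 1 \<Longrightarrow> Suc (wt (drop1 k)) = wt k"
  using lin_drop1[of k id] by (simp add: wt_def)

lemma shift_in_mons: "k \<in> mons \<Longrightarrow> 1 \<le> j \<Longrightarrow> j \<le> q \<Longrightarrow> 0 < k j \<Longrightarrow> shift k j \<in> mons"
  using lin_shift[of j k "\<lambda>_. 1"] by (auto simp: mons_def lin_def shift_def)

lemma drop1_in_mons: "k \<in> mons \<Longrightarrow> 0 < k 1 \<Longrightarrow> drop1 k \<in> mons"
  using lin_drop1[of k "\<lambda>_. 1"] by (auto simp: mons_def lin_def drop1_def)

lemma mons_le: "k \<in> mons \<Longrightarrow> k j \<le> d"
proof (cases "j \<le> q")
  case True
  assume "k \<in> mons"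
  then show ?thesis using member_le_sum[of j "{..q}" k] True by (auto simp: mons_def)
qed (auto simp: mons_def)

lemma finite_mons: "finite mons"
proof -
  have "mons \<subseteq> {k. \<forall>j. (j \<in> {..q} \<longrightarrow> k j \<in> {..d}) \<and> (j \<notin> {..q} \<longrightarrow> k j = 0)}"
    using mons_le by (auto simp: mons_def)
  moreover have "finite \<dots>" by (rule finite_set_of_finite_funs) auto
  ultimately show ?thesis by (rule finite_subset)
qed

lemma lex_less: "k \<in> mons \<Longrightarrow> lex k < (d + 1) * 2 ^ (q + 1)"
proof -
  assume k: "k \<in> mons"
  have "lex k \<le> (\<Sum>j\<le>q. 2 ^ (q + 1) * k j)"
    unfolding lex_def lin_def by (intro sum_mono mult_right_mono) (auto intro: power_increasing simp del: power_Suc)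
  also have "\<dots> \<le> 2 ^ (q + 1) * d" using k by (simp add: mons_def flip: sum_distrib_left)
  also have "\<dots> < (d + 1) * 2 ^ (q + 1)" by simp
  finally show ?thesis .
qed

lemma rk_less_of_wt: "k \<in> mons \<Longrightarrow> wt k < wt k' \<Longrightarrow> rk k < rk k'"
proof -
  assume k: "k \<in> mons" "wt k < wt k'"
  let ?B = "(d + 1) * 2 ^ (q + 1)"
  have "rk k < Suc (wt k) * ?B" using lex_less[OF k(1)] by (simp add: rk_def)
  also have "\<dots> \<le> wt k' * ?B" using k(2) by (intro mult_right_mono) auto
  also have "\<dots> \<le> rk k'" by (simp add: rk_def)
  finally show ?thesis .
qed

definition mon_list :: "(nat \<Rightarrow> nat) list" where
  "mon_list = sort_key rk (SOME ks. set ks = mons \<and> distinct ks)"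

lemma mon_list: "set mon_list = mons" "distinct mon_list" "sorted (map rk mon_list)"
proof -
  have "\<exists>ks. set ks = mons \<and> distinct ks" using finite_distinct_list[OF finite_mons] by blast
  from someI_ex[OF this] show "set mon_list = mons" "distinct mon_list" "sorted (map rk mon_list)"
    by (auto simp: mon_list_def)
qed

abbreviation "mm \<equiv> length mon_list"
abbreviation "MA i j \<equiv> dmat (mon_list ! i) (mon_list ! j)"

lemma mon_nth: "i < mm \<Longrightarrow> mon_list ! i \<in> mons"
  using mon_list(1) nth_mem by blast

lemma rk_mono: "i \<le> j \<Longrightarrow> j < mm \<Longrightarrow> rk (mon_list ! i) \<le> rk (mon_list ! j)"
  using mon_list(3) by (auto simp: sorted_iff_nth_mono)

lemma dmat_nonzero:
  assumes "dmat k k' \<noteq> 0" "k' \<noteq> k"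
  obtains j where "2 \<le> j" "j \<le> q" "0 < k j" "k' = shift k j"
  | "0 < k 1" "k' = drop1 k" | "0 < k 1" "k' = shift k 1"
proof -
  have "\<not> (\<forall>j\<in>{2..q}. \<not> (0 < k j \<and> k' = shift k j)) \<or> 0 < k 1 \<and> k' = drop1 k \<or> 0 < k 1 \<and> k' = shift k 1"
  proof (rule ccontr)
    assume "\<not> ?thesis"
    then have "dmat k k' = 0" using assms(2) unfolding dmat_def by (auto intro: sum.neutral)
    then show False using assms(1) by simp
  qed
  then show thesis using that by auto
qed

lemma dmat_wt: "dmat k k' \<noteq> 0 \<Longrightarrow> k' \<noteq> k \<Longrightarrow> wt k = Suc (wt k')"
proof (erule dmat_nonzero)
  show "\<And>j. 2 \<le> j \<Longrightarrow> j \<le> q \<Longrightarrow> 0 < k j \<Longrightarrow> k' = shift k j \<Longrightarrow> wt k = Suc (wt k')"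
    using wt_shift by simp
qed (use wt_drop1 wt_shift[of 1 k] q in auto)

sublocale euler_system mm MA .

lemma MA_triangular: "i < j \<Longrightarrow> j < mm \<Longrightarrow> MA i j = 0"
proof (rule ccontr)
  assume ij: "i < j" "j < mm" and ne: "MA i j \<noteq> 0"
  have "mon_list ! j \<noteq> mon_list ! i" using ij mon_list(2) by (simp add: nth_eq_iff_index_eq)
  then have "wt (mon_list ! i) = Suc (wt (mon_list ! j))" by (rule dmat_wt[OF ne])
  then have "rk (mon_list ! j) < rk (mon_list ! i)" using mon_nth ij by (intro rk_less_of_wt) auto
  then show False using rk_mono[of i j] ij by simp
qed

lemma dmat_self: "dmat k k = lam k"
proof -
  have n: "\<not> (0 < k j \<and> k = shift k j)" if "1 \<le> j" "j \<le> q" for j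
    using wt_shift[of j k] that by auto
  have n1: "\<not> (0 < k 1 \<and> k = drop1 k)" using wt_drop1[of k] by auto
  have n0: "(\<Sum>j\<in>{2..q}. if 0 < k j \<and> k = shift k j then of_nat (k j) else 0) = (0 :: 'a poly)"
    by (rule sum.neutral) (use n in auto)
  show ?thesis
    unfolding dmat_def if_not_P[OF n1] if_not_P[OF n[OF order.refl q]] n0 by simp
qed

lemma shift_0: "2 \<le> j \<Longrightarrow> shift k j 0 = k 0"
  by (simp add: shift_def)

lemma shift_1_0: "shift k 1 0 = Suc (k 0)"
  by (simp add: shift_def)

lemma drop1_0: "drop1 k 0 = k 0"
  by (simp add: drop1_def)

lemma lam_shift:
  assumes "2 \<le> j" "j \<le> q" "0 < k j"
  shows "lam (shift k j) = lam k"
  using lin_shift[of j k "\<lambda>j. if j = 0 then 0 else 1"] assms by (simp add: lam_def shift_0)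

lemma lam_shift_1: "0 < k 1 \<Longrightarrow> lam (shift k 1) = lam k + [:kap, -1:]"
proof -
  assume "0 < k 1"
  then have eq: "lin (\<lambda>j. if j = 0 then 0 else 1) k = Suc (lin (\<lambda>j. if j = 0 then 0 else 1) (shift k 1))"
    using lin_shift[of 1 k "\<lambda>j. if j = 0 then 0 else 1"] q by simp
  show ?thesis unfolding lam_def shift_1_0 eq by (simp add: algebra_simps)
qed

lemma shift_inj:
  assumes "1 \<le> j" "0 < k j" "0 < k' j" "shift k j = shift k' j"
  shows "k = k'"
proof
  fix i
  have "shift k j i = shift k' j i" using assms by simp
  moreover have "j - 1 \<noteq> j" using assms by simp
  ultimately show "k i = k' i" using assms(2,3) by (auto simp: shift_def split: if_splits)
qed

lemma shift_index_inj:
  assumes "1 \<le> i" "1 \<le> j" "0 < k i" "0 < k j" "i \<le> q" "j \<le> q" "shift k i = shift k j"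
  shows "i = j"
proof (rule ccontr)
  assume "i \<noteq> j"
  then have "shift k i (max i j) = k (max i j) - 1 \<or> shift k j (max i j) = k (max i j) - 1"
    by (auto simp: shift_def max_def)
  moreover have "shift k (min i j) (max i j) = k (max i j)"
    using assms(1,2) \<open>i \<noteq> j\<close> by (auto simp: shift_def max_def min_def)
  moreover have "shift k i = shift k (max i j)" "shift k j = shift k (max i j)"
    "shift k (min i j) = shift k (max i j)"
    using assms(7) by (auto simp: max_def min_def)
  moreover have "0 < k (max i j)" using assms(3,4) by (auto simp: max_def)
  ultimately show False by auto
qed

text \<open>An eigenform with a leading monomial of positive weight would yield a rational solution of an
  equation without rational solutions.\<close>

lemma stable_contains_exponential:
  assumes S: "\<exists>G\<in>S. \<exists>i<mm. G i \<noteq> 0"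
      "\<And>G H a b. G \<in> S \<Longrightarrow> H \<in> S \<Longrightarrow> (\<lambda>i. a * G i + b * H i) \<in> S"
      "\<And>G. G \<in> S \<Longrightarrow> nabf G \<in> S"
  obtains G \<mu> where "G \<in> S" "\<mu> < mm" "G \<mu> \<noteq> 0" "\<And>i. i < mm \<Longrightarrow> i \<noteq> \<mu> \<Longrightarrow> G i = 0"
    "\<And>j. 1 \<le> j \<Longrightarrow> (mon_list ! \<mu>) j = 0"
proof -
  obtain G \<mu> where G: "G \<in> S" "\<mu> < mm" "G \<mu> \<noteq> 0" "\<And>i. \<mu> < i \<Longrightarrow> i < mm \<Longrightarrow> G i = 0"
    and eig: "\<And>j. j < mm \<Longrightarrow> G \<mu> * nabf G j = (euler (G \<mu>) + G \<mu> * MA \<mu> \<mu>) * G j"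
    using stable_eigenform[OF MA_triangular S] by blast
  define k where "k = mon_list ! \<mu>"
  have k: "k \<in> mons" using G mon_nth by (simp add: k_def)
  have zero_wt: "G i = 0" if "i < mm" "wt k < wt (mon_list ! i)" for i
  proof (rule G(4)[OF _ that(1)])
    show "\<mu> < i" using rk_less_of_wt[OF k that(2)] rk_mono[of i \<mu>] G(2) unfolding k_def by force
  qed
  have zero_lex: "G i = 0" if "i < mm" "wt (mon_list ! i) = wt k" "lex k < lex (mon_list ! i)" for i
  proof (rule G(4)[OF _ that(1)])
    have "rk k < rk (mon_list ! i)" using that by (simp add: rk_def)
    then show "\<mu> < i" using rk_mono[of i \<mu>] G(2) unfolding k_def by force
  qed
  have eq: "G \<mu> * euler (G j) - G j * euler (G \<mu>)
      = (lam k - lam (mon_list ! j)) * G j * G \<mu> - G \<mu> * (\<Sum>i\<in>{..<mm} - {j}. G i * MA i j)" if "j < mm" for j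
  proof -
    have "nabf G j = euler (G j) + (G j * lam (mon_list ! j) + (\<Sum>i\<in>{..<mm} - {j}. G i * MA i j))"
      unfolding nabf_def using that by (subst sum.remove[of _ j]) (auto simp: dmat_self)
    then show ?thesis using eig[OF that] by (simp add: dmat_self k_def algebra_simps)
  qed
  \<comment> \<open>Off-diagonal entries lower the weight, so at the weight of \<open>k\<close> the
    quotient G j / G \<mu> satisfies a homogeneous equation. Its coefficient of x is the difference
    of the exponents of y 0, which must vanish.\<close>
  have top: "(mon_list ! j) 0 = k 0" if j: "j < mm" "wt (mon_list ! j) = wt k" "G j \<noteq> 0" for j
  proof -
    have "(\<Sum>i\<in>{..<mm} - {j}. G i * MA i j) = 0"
    proof (rule sum.neutral, rule ballI, rule ccontr)
      fix i assume i: "i \<in> {..<mm} - {j}" and ne: "G i * MA i j \<noteq> 0"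
      then have "mon_list ! j \<noteq> mon_list ! i" using j mon_list(2) by (auto simp: nth_eq_iff_index_eq)
      then have "wt (mon_list ! i) = Suc (wt k)" using dmat_wt ne j by force
      then show False using zero_wt[of i] i ne by auto
    qed
    then have "G \<mu> * euler (G j) - G j * euler (G \<mu>) = (lam k - lam (mon_list ! j)) * G j * G \<mu>"
      using eq[OF j(1)] by simp
    moreover obtain t where "lam k - lam (mon_list ! j) = [:t, of_nat ((mon_list ! j) 0) - of_nat (k 0):]"
      by (simp add: lam_def)
    ultimately have
      "G \<mu> * euler (G j) - G j * euler (G \<mu>) = [:t, of_nat ((mon_list ! j) 0) - of_nat (k 0):] * G j * G \<mu>"
      by (simp only:)
    from no_rational_exponential[OF j(3) G(3) this] show ?thesis by simp
  qed
  have wt0: "wt k = 0"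
  proof (rule ccontr)
    assume "wt k \<noteq> 0"
    then have "\<exists>j. 1 \<le> j \<and> j \<le> q \<and> 0 < k j"
      unfolding wt_def lin_def by (auto simp: Suc_le_eq)
    \<comment> \<open>Taking the smallest index makes every competing monomial in
      \<open>contrib\<close> larger than \<open>k\<close>.\<close>
    define j0 where "j0 = (LEAST j. 1 \<le> j \<and> j \<le> q \<and> 0 < k j)"
    have j0: "1 \<le> j0" "j0 \<le> q" "0 < k j0"
      using LeastI_ex[OF \<open>\<exists>j. _ j\<close>] unfolding j0_def by auto
    have min: "k j = 0" if "1 \<le> j" "j < j0" for j
      using not_less_Least[of j "\<lambda>j. 1 \<le> j \<and> j \<le> q \<and> 0 < k j"] that j0(2) unfolding j0_def by auto
    obtain j where j: "j < mm" "mon_list ! j = shift k j0"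
      using shift_in_mons[OF k j0] mon_list(1) by (metis in_set_conv_nth)
    have wtj: "Suc (wt (shift k j0)) = wt k" using wt_shift j0 by blast
    have "\<mu> \<noteq> j" using j wtj unfolding k_def by auto
    \<comment> \<open>Another monomial k' leading to \<open>shift k j0\<close> has the weight of
      \<open>k\<close> and the same exponent of y 0. In the first two cases below \<open>lex\<close>
      makes it larger than \<open>k\<close>, where \<open>G\<close> vanishes; in the third the
      exponent of y 0 forces j0 = 1, and then k' = k.\<close>
    have contrib: "G i * MA i j = 0" if i: "i < mm" "i \<noteq> j" "i \<noteq> \<mu>" for i
    proof (rule ccontr)
      assume ne: "G i * MA i j \<noteq> 0"
      define k' where "k' = mon_list ! i"
      have ne': "dmat k' (shift k j0) \<noteq> 0" "G i \<noteq> 0" using ne j by (auto simp: k'_def)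
      have neq: "shift k j0 \<noteq> k'" "k' \<noteq> k"
        using i j G(2) mon_list(2) unfolding k'_def k_def by (metis nth_eq_iff_index_eq)+
      have wt': "wt k' = wt k" using dmat_wt[OF ne'(1) neq(1)] wtj by simp
      have k0: "k' 0 = k 0" using top[OF i(1) _ ne'(2)] wt' by (simp add: k'_def)
      have lex': "\<not> lex k < lex k'" using zero_lex[OF i(1)] wt' ne'(2) by (auto simp: k'_def)
      let ?w = "\<lambda>j. if j = 0 then 1 else 2 ^ (q + 1 - j) :: nat"
      have lexk: "lex (shift k j0) + 2 ^ (q + 1 - j0) = lex k + ?w (j0 - 1)"
        using lin_shift[of j0 k ?w] j0 by (simp add: lex_def)
      from ne'(1) neq(1) show False
      proof (cases rule: dmat_nonzero)
        case (1 j')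
        then have "shift k j0 0 = k 0" using k0 shift_0[of j' k'] by simp
        then have "2 \<le> j0" using shift_1_0[of k] j0(1) by (cases "j0 = 1") auto
        have "j' \<noteq> j0" using shift_inj[of j0 k k'] 1 j0 neq(2) by auto
        \<comment> \<open>The shift of k' has put a factor of index j' - 1 into the common monomial.
          Since \<open>k\<close> has no factor of positive index below j0, this leaves only j0 <
          j'.\<close>
        have "0 < shift k j0 (j' - 1)" using 1(1) unfolding 1(4) by (simp add: shift_def)
        moreover have "shift k j0 (j' - 1) = 0" if "\<not> j0 < j'"
        proof -
          have "j' - 1 \<noteq> j0 - 1" "j' - 1 \<noteq> j0" "k (j' - 1) = 0"
            using that 1(1) \<open>j' \<noteq> j0\<close> by (auto intro: min)
          then show ?thesis by (simp add: shift_def)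
        qed
        ultimately have "j0 < j'" by (cases "j0 < j'") auto
        have "lex (shift k' j') + 2 ^ (q + 1 - j') = lex k' + 2 ^ (q + 2 - j')"
          using lin_shift[of j' k' ?w] 1 by (simp add: lex_def Suc_diff_le numeral_2_eq_2 le_diff_conv2 split: if_splits)
        moreover have "lex (shift k j0) = lex k + 2 ^ (q + 1 - j0)"
          using \<open>2 \<le> j0\<close> j0(2) lexk by (simp add: Suc_diff_le)
        moreover have "(2::nat) ^ (q + 2 - j') \<le> 2 ^ (q + 1 - j0)"
          using \<open>j0 < j'\<close> by (intro power_increasing) auto
        moreover have "(0::nat) < 2 ^ (q + 1 - j')" by simp
        ultimately have "lex k < lex k'" unfolding 1(4) by linarith
        then show False using lex' by simp
      next
        case 2
        then have "shift k j0 0 = k 0" using k0 drop1_0[of k'] by simp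
        then have "2 \<le> j0" using shift_1_0[of k] j0(1) by (cases "j0 = 1") auto
        have "lex (drop1 k') + 2 ^ q = lex k'"
          using lin_drop1[of k' ?w] 2 by (simp add: lex_def)
        moreover have "lex (shift k j0) = lex k + 2 ^ (q + 1 - j0)"
          using \<open>2 \<le> j0\<close> j0(2) lexk by (simp add: Suc_diff_le)
        moreover have "(0::nat) < 2 ^ q" "(0::nat) < 2 ^ (q + 1 - j0)" by simp_all
        ultimately have "lex k < lex k'" unfolding 2(2) by linarith
        then show False using lex' by simp
      next
        case 3
        then have "j0 = 1" using k0 shift_1_0[of k'] shift_0[of j0 k] j0(1) by (cases "j0 = 1") auto
        then show False using shift_inj[of 1 k k'] 3 j0 neq(2) by auto
      qed
    qed
    have "(\<Sum>i\<in>{..<mm} - {j}. G i * MA i j) = (\<Sum>i\<in>{\<mu>}. G i * MA i j)"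
      using contrib G(2) \<open>\<mu> \<noteq> j\<close> by (intro sum.mono_neutral_right) auto
    then have sum: "(\<Sum>i\<in>{..<mm} - {j}. G i * MA i j) = G \<mu> * dmat k (shift k j0)"
      using j by (simp add: k_def)
    have eqj: "G \<mu> * euler (G j) - G j * euler (G \<mu>)
        = (lam k - lam (shift k j0)) * G j * G \<mu> - G \<mu> * (G \<mu> * dmat k (shift k j0))"
      using eq[OF j(1), unfolded sum] by (simp only: j(2))
    have "shift k j0 \<noteq> k" using wtj by auto
    show False
    \<comment> \<open>For y = G j / G \<mu> the equation now reads \<open>euler y\<close> + (kap -
      x) y = - k 1 * B1 if j0 = 1, and \<open>euler y\<close> = - k j0 otherwise.\<close>
    proof (cases "j0 = 1")
      case True
      have n: "(\<Sum>j\<in>{2..q}. if 0 < k j \<and> shift k 1 = shift k j then of_nat (k j) else 0) = (0 :: 'a poly)"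
      proof (rule sum.neutral, rule ballI)
        fix j assume "j \<in> {2..q}"
        then have "\<not> (0 < k j \<and> shift k 1 = shift k j)"
          using shift_index_inj[of 1 j k] j0 True by force
        then show "(if 0 < k j \<and> shift k 1 = shift k j then of_nat (k j) else 0) = (0 :: 'a poly)"
          by (rule if_not_P)
      qed
      have "shift k 1 \<noteq> drop1 k" using shift_1_0[of k] drop1_0[of k] by (metis n_not_Suc_n)
      then have "dmat k (shift k 1) = of_nat (k 1) * B1"
        using \<open>shift k j0 \<noteq> k\<close> j0 True unfolding dmat_def n by simp
      then have "G \<mu> * euler (G j) - G j * euler (G \<mu>)
          = - [:kap, -1:] * G j * G \<mu> - G \<mu> * (G \<mu> * (of_nat (k 1) * B1))"
        using eqj lam_shift_1[of k] j0(3) unfolding True by simp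
      then have E: "G \<mu> * euler (G j) - G j * euler (G \<mu>) + [:kap, -1:] * G j * G \<mu>
          = (- of_nat (k 1) * B1) * G \<mu> * G \<mu>"
      proof -
        have "x + L * g * h = (- c * b) * h * h" if "x = - L * g * h - h * (h * (c * b))" for x L g h b c :: "'a poly"
          unfolding that by (simp add: algebra_simps)
        then show ?thesis using \<open>G \<mu> * euler (G j) - G j * euler (G \<mu>) = - [:kap, -1:] * G j * G \<mu> - _\<close> .
      qed
      have B: "- of_nat (k 1) * B1 = Polynomial.smult (- of_nat (k 1)) B1" by (simp add: of_nat_poly)
      have "- of_nat (k 1) \<noteq> (0 :: 'a)" using j0 True by simp
      then have "kap = 0 \<and> poly (- of_nat (k 1) * B1) 0 \<noteq> 0
          \<or> kap \<notin> \<int> \<and> degree (- of_nat (k 1) * B1) = 0 \<and> - of_nat (k 1) * B1 \<noteq> 0"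
        unfolding B using nonelementary by auto
      then show False by (rule no_rational_inhomogeneous[OF G(3) E])
    next
      case False
      then have j2: "2 \<le> j0" using j0 by simp
      have "shift k j0 0 = k 0" using shift_0 j2 by simp
      then have n1: "shift k j0 \<noteq> shift k 1" using shift_1_0[of k] by (metis n_not_Suc_n)
      have n2: "k 1 = 0" using min[of 1] j2 by simp
      have "(\<Sum>j\<in>{2..q}. if 0 < k j \<and> shift k j0 = shift k j then of_nat (k j) else 0)
          = (\<Sum>j\<in>{2..q}. if j = j0 then of_nat (k j0) else (0 :: 'a poly))"
      proof (rule sum.cong[OF refl])
        fix j assume "j \<in> {2..q}"
        then have "0 < k j \<and> shift k j0 = shift k j \<longleftrightarrow> j = j0"
          using shift_index_inj[of j0 j k] j0 by auto
        then show "(if 0 < k j \<and> shift k j0 = shift k j then of_nat (k j) else 0)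
            = (if j = j0 then of_nat (k j0) else (0 :: 'a poly))" by (simp only: split: if_splits) simp
      qed
      then have n: "(\<Sum>j\<in>{2..q}. if 0 < k j \<and> shift k j0 = shift k j then of_nat (k j) else 0)
          = (of_nat (k j0) :: 'a poly)" using j0 j2 by simp
      have "dmat k (shift k j0) = of_nat (k j0)"
        using \<open>shift k j0 \<noteq> k\<close> n1 n2 unfolding dmat_def n by simp
      then have "G \<mu> * euler (G j) - G j * euler (G \<mu>) = - (G \<mu> * (G \<mu> * of_nat (k j0)))"
        using eqj lam_shift[of j0 k] j0 j2 by simp
      then have "G \<mu> * euler (G j) - G j * euler (G \<mu>) = [:- of_nat (k j0):] * G \<mu> * G \<mu>"
        by (simp add: of_nat_poly algebra_simps)
      from no_rational_log[OF G(3) this] show False using j0 by simp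
    qed
  qed
  \<comment> \<open>Monomials of weight 0 are powers of y 0, and \<open>top\<close> fixes the
    exponent; so \<open>G\<close> has a single component.\<close>
  have kz: "k' j = 0" if "k' \<in> mons" "wt k' = 0" "1 \<le> j" for k' j
    using that unfolding wt_def lin_def mons_def by (cases "j \<le> q") (auto simp: Ball_def)
  show thesis
  proof (rule that[OF G(1-3)])
    fix i assume i: "i < mm" "i \<noteq> \<mu>"
    show "G i = 0"
    proof (rule ccontr)
      assume ne: "G i \<noteq> 0"
      then have w: "wt (mon_list ! i) = wt k" using zero_wt[OF i(1)] wt0 by auto
      have "mon_list ! i = k"
      proof
        fix j show "(mon_list ! i) j = k j"
          using top[OF i(1) w ne] kz[OF mon_nth[OF i(1)]] kz[OF k] w wt0 by (cases "j = 0") auto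
      qed
      then show False using i G(2) mon_list(2) unfolding k_def by (metis nth_eq_iff_index_eq)
    qed
  next
    fix j :: nat assume "1 \<le> j"
    then show "(mon_list ! \<mu>) j = 0" using kz[OF k wt0] by (simp add: k_def)
  qed
qed

end

section \<open>Simultaneous approximation and linear independence of values\<close>

lemma fps_nth_X_deriv: "fps_nth (fps_X * fps_deriv v) t = of_nat t * fps_nth (v :: complex fps) t"
  by (cases t) simp_all

lemma fps_of_poly_euler: "fps_of_poly (euler p) = fps_X * fps_deriv (fps_of_poly (p :: complex poly))"
  by (rule fps_ext) (simp add: fps_nth_X_deriv coeff_euler)

lemma X_power_dvd_iff: "[:0, 1:] ^ T dvd p \<longleftrightarrow> (\<forall>t<T. coeff p t = 0)" for p :: "'a::idom poly"
  using monom_1_dvd_iff'[of T p] by (simp add: monom_altdef)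

context euler_system
begin

definition nabF :: "(nat \<Rightarrow> 'a fps) \<Rightarrow> nat \<Rightarrow> 'a fps" where
  "nabF v i = fps_X * fps_deriv (v i) - (\<Sum>j<m. fps_of_poly (A i j) * v j)"

end

text \<open>\<open>u\<close> is a vector of entire solutions, in the application all monomials of a
  tower. One application of \<open>nab\<close> multiplies denominators by at most \<open>da\<close>
  and raises degrees by at most \<open>bd\<close>.\<close>

locale siegel_system = euler_system m A for m :: nat and A :: "nat \<Rightarrow> nat \<Rightarrow> complex poly" +
  fixes u :: "nat \<Rightarrow> complex fps" and C da bd :: nat and D :: "nat \<Rightarrow> nat"
  assumes m2: "2 \<le> m" and u0: "u 0 = 1"
    and ode: "\<And>i. i < m \<Longrightarrow> fps_X * fps_deriv (u i) = (\<Sum>j<m. fps_of_poly (A i j) * u j)"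
    and A_int: "\<And>i j l. i < m \<Longrightarrow> j < m \<Longrightarrow> of_nat da * coeff (A i j) l \<in> \<int>" and da: "0 < da"
    and A_deg: "\<And>i j. i < m \<Longrightarrow> j < m \<Longrightarrow> degree (A i j) \<le> bd"
    and C1: "1 \<le> C" and D_pos: "\<And>n. 0 < D n" and D_le: "\<And>n. D n \<le> C ^ (n + 1)"
    and u_le: "\<And>i n. i < m \<Longrightarrow> norm (egf (u i) n) \<le> real C ^ (n + 1)"
    and u_int: "\<And>i n k. i < m \<Longrightarrow> k \<le> n \<Longrightarrow> of_nat (D n) * egf (u i) k \<in> \<int>"
    and u_radius: "\<And>i. i < m \<Longrightarrow> fps_conv_radius (u i) = \<infinity>"
begin

lemma nabF_poly: "fps_of_poly (nab p i) = nabF (\<lambda>i. fps_of_poly (p i)) i"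
  by (simp add: nab_def nabF_def fps_of_poly_diff fps_of_poly_euler fps_of_poly_sum fps_of_poly_mult)

lemma nabF_poly_iter: "fps_of_poly ((nab ^^ k) p i) = (nabF ^^ k) (\<lambda>i. fps_of_poly (p i)) i"
proof (induction k arbitrary: i)
  case (Suc k)
  have "(\<lambda>i. fps_of_poly ((nab ^^ k) p i)) = (nabF ^^ k) (\<lambda>i. fps_of_poly (p i))"
    using Suc.IH by blast
  then show ?case using nabF_poly[of "(nab ^^ k) p" i] by simp
qed simp

text \<open>Because \<open>u\<close> solves the system, the derivative of an approximation is again
  one, with denominator \<open>euler Q\<close> and remainder \<open>nabF r\<close>.\<close>

lemma nabF_remainder:
  assumes "\<And>i. i < m \<Longrightarrow> v i = fps_of_poly Q * u i - r i" "i < m"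
  shows "nabF v i = fps_of_poly (euler Q) * u i - nabF r i"
proof -
  have "(\<Sum>j<m. fps_of_poly (A i j) * v j)
      = (\<Sum>j<m. fps_of_poly Q * (fps_of_poly (A i j) * u j) - fps_of_poly (A i j) * r j)"
    by (intro sum.cong) (simp_all add: assms(1) right_diff_distrib mult.left_commute)
  also have "\<dots> = fps_of_poly Q * (fps_X * fps_deriv (u i)) - (\<Sum>j<m. fps_of_poly (A i j) * r j)"
    using ode[OF assms(2)] by (simp add: sum_subtractf flip: sum_distrib_left)
  finally show ?thesis
    unfolding nabF_def assms(1)[OF assms(2)] fps_of_poly_euler by (simp add: algebra_simps)
qed

lemma nabF_remainder_iter:
  assumes "\<And>i. i < m \<Longrightarrow> v i = fps_of_poly Q * u i - r i" "i < m"
  shows "(nabF ^^ k) v i = fps_of_poly ((euler ^^ k) Q) * u i - (nabF ^^ k) r i"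
  using assms(2)
proof (induction k arbitrary: i)
  case (Suc k)
  then show ?case using nabF_remainder[OF Suc.IH Suc.prems] by simp
qed (use assms in simp)

text \<open>The weight \<open>4 ^ l\<close> is the price of a shift by x^l for coefficients that
  decay like \<open>1 / 4 ^ t\<close>.\<close>

definition Asize :: real where
  "Asize = (\<Sum>i<m. \<Sum>j<m. \<Sum>l\<le>bd. norm (coeff (A i j) l) * 4 ^ l)"

lemma Asize_nonneg: "0 \<le> Asize"
  unfolding Asize_def by (intro sum_nonneg) auto

text \<open>At coefficient t the Euler operator costs a factor t and the matrix a factor of at most
  \<open>Asize\<close>.\<close>

lemma nabF_bound:
  assumes r: "\<And>i t. i < m \<Longrightarrow> norm (fps_nth (r i) t) \<le> R * (real t + Asize) ^ k / 4 ^ t" and R: "0 \<le> R"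
    and i: "i < m"
  shows "norm (fps_nth (nabF r i) t) \<le> R * (real t + Asize) ^ Suc k / 4 ^ t"
proof -
  let ?B = "R * (real t + Asize) ^ k / 4 ^ t"
  have B: "0 \<le> ?B" using R Asize_nonneg by simp
  have "norm (fps_nth (fps_of_poly (A i j) * r j) t) \<le> (\<Sum>l\<le>bd. norm (coeff (A i j) l) * 4 ^ l) * ?B"
    if j: "j < m" for j
  proof -
    have "norm (fps_nth (fps_of_poly (A i j) * r j) t) \<le> (\<Sum>l\<le>t. norm (coeff (A i j) l) * 4 ^ l * ?B)"
      unfolding fps_mult_nth atLeast0AtMost
    proof (rule sum_norm_le)
      fix l assume "l \<in> {..t}"
      then have l: "l \<le> t" by simp
      have "norm (fps_nth (r j) (t - l)) \<le> R * (real (t - l) + Asize) ^ k / 4 ^ (t - l)" using r[OF j] .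
      also have "\<dots> \<le> R * (real t + Asize) ^ k / 4 ^ (t - l)"
        using R Asize_nonneg l by (intro divide_right_mono mult_left_mono power_mono) auto
      also have "\<dots> = 4 ^ l * ?B" using l by (simp add: power_diff)
      finally have "norm (coeff (A i j) l) * norm (fps_nth (r j) (t - l)) \<le> norm (coeff (A i j) l) * (4 ^ l * ?B)"
        by (intro mult_left_mono) auto
      then show "norm (fps_nth (fps_of_poly (A i j)) l * fps_nth (r j) (t - l)) \<le> norm (coeff (A i j) l) * 4 ^ l * ?B"
        by (simp only: norm_mult fps_of_poly_nth mult.assoc)
    qed
    also have "\<dots> \<le> (\<Sum>l\<in>{..t} \<union> {..bd}. norm (coeff (A i j) l) * 4 ^ l * ?B)"
      by (intro sum_mono2 mult_nonneg_nonneg[OF _ B]) auto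
    also have "\<dots> = (\<Sum>l\<le>bd. norm (coeff (A i j) l) * 4 ^ l * ?B)"
    proof (rule sum.mono_neutral_right)
      show "\<forall>l\<in>{..t} \<union> {..bd} - {..bd}. norm (coeff (A i j) l) * 4 ^ l * ?B = 0"
      proof
        fix l assume "l \<in> {..t} \<union> {..bd} - {..bd}"
        then have "coeff (A i j) l = 0" using A_deg[OF i j] by (intro coeff_eq_0) auto
        then show "norm (coeff (A i j) l) * 4 ^ l * ?B = 0" by simp
      qed
    qed auto
    finally show ?thesis by (simp only: sum_distrib_right)
  qed
  then have "norm (fps_nth (\<Sum>j<m. fps_of_poly (A i j) * r j) t)
      \<le> (\<Sum>j<m. (\<Sum>l\<le>bd. norm (coeff (A i j) l) * 4 ^ l) * ?B)"
    unfolding fps_sum_nth by (intro sum_norm_le) auto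
  also have "\<dots> = (\<Sum>j<m. \<Sum>l\<le>bd. norm (coeff (A i j) l) * 4 ^ l) * ?B" by (simp only: sum_distrib_right)
  also have "\<dots> \<le> Asize * ?B"
    using i B unfolding Asize_def
    by (intro mult_right_mono member_le_sum[of i "{..<m}"]) (auto intro!: sum_nonneg)
  finally have 1: "norm (fps_nth (\<Sum>j<m. fps_of_poly (A i j) * r j) t) \<le> Asize * ?B" .
  have 2: "norm (fps_nth (fps_X * fps_deriv (r i)) t) \<le> real t * ?B"
    unfolding fps_nth_X_deriv norm_mult norm_of_nat by (intro mult_left_mono r i) auto
  have "norm (fps_nth (nabF r i) t) \<le> real t * ?B + Asize * ?B"
    unfolding nabF_def fps_sub_nth using norm_triangle_ineq4 1 2 by (meson add_mono order_trans)
  also have "\<dots> = R * (real t + Asize) ^ Suc k / 4 ^ t" by (simp add: field_simps)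
  finally show ?thesis .
qed

lemma nabF_bound_iter:
  assumes "\<And>i t. i < m \<Longrightarrow> norm (fps_nth (r i) t) \<le> R / 4 ^ t" "0 \<le> R" "i < m"
  shows "norm (fps_nth ((nabF ^^ k) r i) t) \<le> R * (real t + Asize) ^ k / 4 ^ t"
  using assms(3)
proof (induction k arbitrary: i t)
  case (Suc k)
  then show ?case using nabF_bound[OF Suc.IH assms(2)] by simp
qed (use assms(1) in simp)

text \<open>The polynomial growth (t + Asize)^k is at most k! exp (t + Asize). Since exp 1 \<le> 3 <
  4, the decay \<open>1 / 4 ^ t\<close> survives as (3/4)^t, whose sum is 4. This is why remainders
  are measured against \<open>4 ^ t\<close>.\<close>

lemma eval_nabF_bound:
  assumes "\<And>i t. i < m \<Longrightarrow> norm (fps_nth (r i) t) \<le> R / 4 ^ t" "0 \<le> R" "i < m"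
  shows "norm (eval_fps ((nabF ^^ k) r i) 1) \<le> 4 * R * fact k * exp Asize"
proof -
  let ?f = "fps_nth ((nabF ^^ k) r i)"
  have le: "norm (?f t) \<le> R * fact k * exp Asize * (3 / 4) ^ t" for t
  proof -
    have "(real t + Asize) ^ k \<le> fact k * exp (real t + Asize)"
      using Asize_nonneg by (intro power_le_fact_exp) auto
    also have "exp (real t + Asize) = exp Asize * exp 1 ^ t" by (simp add: exp_add flip: exp_of_nat_mult)
    also have "\<dots> \<le> exp Asize * 3 ^ t"
      using exp_le by (intro mult_left_mono power_mono) auto
    finally have "(real t + Asize) ^ k \<le> fact k * exp Asize * 3 ^ t" by simp
    then have "R * (real t + Asize) ^ k / 4 ^ t \<le> R * (fact k * exp Asize * 3 ^ t) / 4 ^ t"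
      using assms(2) by (intro divide_right_mono mult_left_mono) auto
    moreover have "norm (?f t) \<le> R * (real t + Asize) ^ k / 4 ^ t"
      by (rule nabF_bound_iter[of r]) (use assms in auto)
    ultimately show ?thesis by (simp add: power_divide field_simps)
  qed
  have s: "(\<lambda>t. R * fact k * exp Asize * (3 / 4) ^ t) sums (R * fact k * exp Asize * (1 / (1 - 3 / 4)))"
    by (intro sums_mult geometric_sums) auto
  have "norm (eval_fps ((nabF ^^ k) r i) 1) = norm (\<Sum>t. ?f t)" by (simp add: eval_fps_def)
  also have "\<dots> \<le> (\<Sum>t. R * fact k * exp Asize * (3 / 4) ^ t)"
    by (rule norm_suminf_le[OF le sums_summable[OF s]])
  also have "\<dots> = 4 * R * fact k * exp Asize" using sums_unique[OF s] by simp
  finally show ?thesis .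
qed

lemma coeff_iterate_int:
  assumes "\<And>i l. i < m \<Longrightarrow> of_nat E * coeff (p i) l \<in> \<int>" "i < m"
  shows "of_nat (E * da ^ k) * coeff ((nab ^^ k) p i) l \<in> \<int>"
  using assms(2)
proof (induction k arbitrary: i l)
  case (Suc k)
  let ?p = "(nab ^^ k) p" and ?E = "of_nat (E * da ^ k) :: complex"
  have "of_nat (E * da ^ Suc k) * coeff (nab ?p i) l
      = of_nat da * of_nat l * (?E * coeff (?p i) l)
        - (\<Sum>j<m. \<Sum>x\<le>l. (of_nat da * coeff (A i j) x) * (?E * coeff (?p j) (l - x)))"
    by (simp add: nab_def coeff_euler coeff_sum coeff_mult sum_distrib_left algebra_simps)
  also have "\<dots> \<in> \<int>"
    using Suc.prems by (intro Ints_diff Ints_sum Ints_mult[OF A_int Suc.IH] Ints_mult[OF _ Suc.IH]) auto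
  finally show ?case by simp
qed (use assms(1) in simp)

lemma poly_1_int:
  assumes "\<And>l. of_nat E * coeff p l \<in> \<int>"
  shows "of_nat E * poly p (1::complex) \<in> \<int>"
proof -
  have "of_nat E * poly p 1 = (\<Sum>l\<le>degree p. of_nat E * coeff p l)" by (simp add: poly_altdef sum_distrib_left)
  also have "\<dots> \<in> \<int>" using assms by (intro Ints_sum) auto
  finally show ?thesis .
qed

text \<open>Under a linear relation between the values at 1, the iterates of a simultaneous
  approximation yield integers that are too small to be nonzero.\<close>

lemma relation_transfers:
  fixes c :: "nat \<Rightarrow> int"
  assumes rel: "(\<Sum>i<m. of_int (c i) * eval_fps (u i) 1) = 0"
    and p: "\<And>i. i < m \<Longrightarrow> fps_of_poly (p i) = fps_of_poly Q * u i - r i"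
    and r: "\<And>i t. i < m \<Longrightarrow> norm (fps_nth (r i) t) \<le> R / 4 ^ t" "0 \<le> R"
    and p_int: "\<And>i l. i < m \<Longrightarrow> of_nat E * coeff (p i) l \<in> \<int>" and E: "0 < E"
    and small: "real E * real da ^ K * (\<Sum>i<m. \<bar>real_of_int (c i)\<bar>) * (4 * R * fact K * exp Asize) < 1"
    and k: "k \<le> K"
  shows "(\<Sum>i<m. of_int (c i) * poly ((nab ^^ k) p i) 1) = 0"
proof -
  let ?Z = "\<Sum>i<m. of_int (c i) * poly ((nab ^^ k) p i) 1"
  have val: "poly ((nab ^^ k) p i) 1 = poly ((euler ^^ k) Q) 1 * eval_fps (u i) 1 - eval_fps ((nabF ^^ k) r i) 1"
    if i: "i < m" for i
  proof -
    let ?W = "(nabF ^^ k) r i"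
    have eq: "fps_of_poly ((nab ^^ k) p i) = fps_of_poly ((euler ^^ k) Q) * u i - ?W"
      unfolding nabF_poly_iter by (rule nabF_remainder_iter[OF p i])
    then have W: "?W = fps_of_poly ((euler ^^ k) Q) * u i - fps_of_poly ((nab ^^ k) p i)" by simp
    have rad: "fps_conv_radius (fps_of_poly ((euler ^^ k) Q) * u i) = \<infinity>"
      using fps_conv_radius_mult[of "fps_of_poly ((euler ^^ k) Q)" "u i"] u_radius[OF i] by simp
    have "eval_fps ?W 1 = eval_fps (fps_of_poly ((euler ^^ k) Q) * u i) 1 - eval_fps (fps_of_poly ((nab ^^ k) p i)) 1"
      unfolding W by (rule eval_fps_diff) (simp_all add: rad)
    also have "eval_fps (fps_of_poly ((euler ^^ k) Q) * u i) 1 = poly ((euler ^^ k) Q) 1 * eval_fps (u i) 1"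
      by (subst eval_fps_mult) (simp_all add: u_radius[OF i])
    finally show ?thesis by simp
  qed
  have "?Z = poly ((euler ^^ k) Q) 1 * (\<Sum>i<m. of_int (c i) * eval_fps (u i) 1)
      - (\<Sum>i<m. of_int (c i) * eval_fps ((nabF ^^ k) r i) 1)"
    by (simp add: val sum_distrib_left sum_subtractf algebra_simps)
  then have Z: "?Z = - (\<Sum>i<m. of_int (c i) * eval_fps ((nabF ^^ k) r i) 1)" using rel by simp
  have "norm ?Z \<le> (\<Sum>i<m. \<bar>real_of_int (c i)\<bar> * (4 * R * fact K * exp Asize))"
    unfolding Z norm_minus_cancel
  proof (rule sum_norm_le)
    fix i assume "i \<in> {..<m}"
    then have "norm (eval_fps ((nabF ^^ k) r i) 1) \<le> 4 * R * fact k * exp Asize"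
      using eval_nabF_bound[OF r] by simp
    also have "\<dots> \<le> 4 * R * fact K * exp Asize"
      using r(2) k by (intro mult_right_mono mult_left_mono fact_mono) auto
    finally show "norm (of_int (c i) * eval_fps ((nabF ^^ k) r i) 1) \<le> \<bar>real_of_int (c i)\<bar> * (4 * R * fact K * exp Asize)"
      unfolding norm_mult norm_of_int by (intro mult_left_mono) auto
  qed
  also have "\<dots> = (\<Sum>i<m. \<bar>real_of_int (c i)\<bar>) * (4 * R * fact K * exp Asize)" by (simp only: sum_distrib_right)
  finally have nZ: "norm ?Z \<le> (\<Sum>i<m. \<bar>real_of_int (c i)\<bar>) * (4 * R * fact K * exp Asize)" .
  have "norm (of_nat (E * da ^ k) * ?Z) = real E * real da ^ k * norm ?Z" by (simp add: norm_mult norm_power)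
  also have "\<dots> \<le> real E * real da ^ K * ((\<Sum>i<m. \<bar>real_of_int (c i)\<bar>) * (4 * R * fact K * exp Asize))"
    using da k by (intro mult_mono nZ mult_left_mono power_increasing mult_nonneg_nonneg) (auto intro!: sum_nonneg)
  also have "\<dots> < 1" using small by (simp only: mult.assoc)
  finally have lt: "norm (of_nat (E * da ^ k) * ?Z) < 1" .
  have "of_nat (E * da ^ k) * ?Z = (\<Sum>i<m. of_int (c i) * (of_nat (E * da ^ k) * poly ((nab ^^ k) p i) 1))"
    by (simp add: sum_distrib_left algebra_simps)
  also have "\<dots> \<in> \<int>" by (intro Ints_sum Ints_mult poly_1_int coeff_iterate_int p_int) auto
  finally have "of_nat (E * da ^ k) * ?Z \<in> \<int>" .
  then obtain z where z: "of_nat (E * da ^ k) * ?Z = of_int z" by (auto elim: Ints_cases)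
  have "\<bar>real_of_int z\<bar> < 1" using lt unfolding z by simp
  then have "z = 0" by linarith
  then show ?thesis using z E da by simp
qed

end

section \<open>Choice of parameters and existence of the approximations\<close>

context siegel_system
begin

text \<open>The choice of parameters: \<open>nn\<close> bounds the degrees, \<open>gg\<close> is the number of vanishing
  coefficients imposed on each remainder, \<open>KK\<close> the number of derivatives taken at 1.\<close>

definition nn :: "nat \<Rightarrow> nat" where "nn N = 4 * m * (m - 1) * N"
definition gg :: "nat \<Rightarrow> nat" where "gg N = (4 * m - 1) * N"
definition TT :: "nat \<Rightarrow> nat" where "TT N = nn N + gg N + 1"
definition KK :: "nat \<Rightarrow> nat" where "KK N = 2 * (m - 1) * N"
text \<open>\<open>HH\<close> bounds the integer coefficients of the linear equations imposed on
  \<open>Q\<close>, \<open>YY\<close> the coefficients of \<open>Q\<close> before their factorial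
  weights, and \<open>RR N / 4 ^ t\<close> the remainders.\<close>

definition HH :: "nat \<Rightarrow> nat" where "HH N = C ^ (TT N + 1) * 2 ^ TT N * C ^ (TT N + 1)"
definition YY :: "nat \<Rightarrow> nat" where "YY N = ((nn N + 1) * HH N) ^ (4 * m - 1)"
definition RR :: "nat \<Rightarrow> real" where
  "RR N = real (YY N) * real C * ((8 * real C) ^ TT N * exp (8 * real C)) * (fact (nn N) / fact (TT N))"

text \<open>Of the \<open>nn N + 1\<close> unknowns about (m - 1) N stay free, and the ratio 4 m - 1
  of equations to free unknowns does not depend on N; so \<open>YY\<close> is only geometric in N.
  \<open>KK\<close> is squeezed between two demands: it must exceed the (m - 1) N by which the zero
  at 0 falls short of the degree of the determinant, and KK N + N \<le> gg N + 1 is needed for the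
  factorials to win.\<close>

lemma nn_gg: "nn N = (m - 1) * gg N + (m - 1) * N"
proof -
  have "4 * m = (4 * m - 1) + 1" using m2 by simp
  then have "nn N = (m - 1) * ((4 * m - 1) + 1) * N" unfolding nn_def by (metis mult.commute)
  then show ?thesis unfolding gg_def by (simp only: algebra_simps)
qed

lemma HH_pos: "0 < HH N" using C1 by (simp add: HH_def)

lemma siegel_condition: "((nn N + 1) * HH N * YY N + 1) ^ ((m - 1) * gg N) < (YY N + 1) ^ (nn N + 1)"
proof -
  let ?E = "(m - 1) * gg N" and ?W = "(nn N + 1) * HH N"
  have W: "1 \<le> ?W" using HH_pos[of N] by (simp add: Suc_le_eq)
  have "?W * YY N + 1 \<le> ?W * (YY N + 1)" using W by (simp add: algebra_simps)
  then have "(?W * YY N + 1) ^ ?E \<le> ?W ^ ?E * (YY N + 1) ^ ?E"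
    by (metis power_mono power_mult_distrib zero_le)
  also have "?W ^ ?E = YY N ^ ((m - 1) * N)"
    unfolding YY_def gg_def by (simp only: power_mult[symmetric]) (simp only: mult.assoc mult.commute mult.left_commute)
  also have "\<dots> \<le> (YY N + 1) ^ ((m - 1) * N)" by (intro power_mono) auto
  also have "\<dots> * (YY N + 1) ^ ?E = (YY N + 1) ^ nn N" by (simp add: nn_gg power_add mult.commute)
  also have "\<dots> < (YY N + 1) ^ (nn N + 1)"
    using W by (intro power_strict_increasing) (auto simp: YY_def)
  finally show ?thesis by simp
qed

text \<open>Simultaneous Pade approximation. The coefficient of \<open>Q\<close> at k is an integer
  times n! / k!; as the u i are exponential series, \<open>Q * u i\<close> has the coefficients n! /
  t! times \<open>s i t\<close>, where \<open>s i t\<close> has a controlled denominator. For t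
  \<le> n the quotient n! / t! is an integer, and these terms form \<open>p i\<close>; for t \<ge> T
  it is the small factor in \<open>RR\<close>.\<close>

lemma approximation_exists:
  obtains Q p r where "Q \<noteq> 0" "degree Q \<le> nn N" "\<And>i. degree (p i) \<le> nn N"
    "\<And>i l. i < m \<Longrightarrow> of_nat (D (nn N)) * coeff (p i) l \<in> \<int>"
    "\<And>i. i < m \<Longrightarrow> fps_of_poly (p i) = fps_of_poly Q * u i - r i"
    "\<And>i t. i < m \<Longrightarrow> t < TT N \<Longrightarrow> fps_nth (r i) t = 0"
    "\<And>i t. i < m \<Longrightarrow> norm (fps_nth (r i) t) \<le> RR N / 4 ^ t"
proof -
  define n g T where "n = nn N" and "g = gg N" and "T = TT N"
  have T: "T = n + g + 1" by (simp add: T_def n_def g_def TT_def)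
  define co where "co i t k = (if k \<le> t then of_nat (D T) * of_nat (t choose k) * egf (u i) (t - k) else 0)" for i t k
  have co_int: "co i t k \<in> \<int>" if "i < m" "t \<le> T" for i t k
  proof (cases "k \<le> t")
    case True
    have "co i t k = of_nat (t choose k) * (of_nat (D T) * egf (u i) (t - k))" using True by (simp add: co_def)
    also have "\<dots> \<in> \<int>" using that by (intro Ints_mult u_int) auto
    finally show ?thesis .
  qed (simp add: co_def)
  have co_le: "norm (co i t k) \<le> real (HH N)" if "i < m" "t \<le> T" for i t k
  proof (cases "k \<le> t")
    case True
    have "norm (egf (u i) (t - k)) \<le> real C ^ (T + 1)"
      by (rule order.trans[OF u_le power_increasing]) (use that C1 in auto)
    moreover have "real (D T) \<le> real C ^ (T + 1)" using D_le[of T] by (metis of_nat_le_iff of_nat_power)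
    moreover have "real (t choose k) \<le> 2 ^ T"
    proof -
      have "t choose k \<le> 2 ^ t" by (rule binomial_le_pow2)
      also have "\<dots> \<le> 2 ^ T" using that by (intro power_increasing) auto
      finally show ?thesis by (metis of_nat_le_iff of_nat_numeral of_nat_power)
    qed
    ultimately have "real (D T) * real (t choose k) * norm (egf (u i) (t - k)) \<le> real C ^ (T + 1) * 2 ^ T * real C ^ (T + 1)"
      by (intro mult_mono) auto
    then show ?thesis using True by (simp add: co_def norm_mult HH_def T_def)
  qed (simp add: co_def)
  \<comment> \<open>The number \<open>e\<close> encodes the equation for component e div g + 1 at
    coefficient n + 1 + e mod g. For component 0 the required vanishing is automatic, as u 0 =
    1.\<close>
  define a where "a e k = (let i = e div g + 1; t = n + 1 + e mod g in \<lfloor>Re (co i t k)\<rfloor>)" for e k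
  have a: "of_int (a e k) = co (e div g + 1) (n + 1 + e mod g) k" "e div g + 1 < m" "n + 1 + e mod g \<le> T"
    if e: "e < (m - 1) * g" for e k
  proof -
    have "e div g < m - 1" using e by (simp add: less_mult_imp_div_less)
    then show 1: "e div g + 1 < m" by simp
    have "0 < g" using e by (cases g) auto
    then have "e mod g < g" by simp
    then show 2: "n + 1 + e mod g \<le> T" by (simp add: T)
    from co_int[OF 1 2, of k] show "of_int (a e k) = co (e div g + 1) (n + 1 + e mod g) k"
      by (auto simp: a_def elim!: Ints_cases)
  qed
  obtain b where b: "\<exists>k<n + 1. b k \<noteq> 0" "\<And>k. \<bar>b k\<bar> \<le> int (YY N)"
    "\<And>e. e < (m - 1) * g \<Longrightarrow> (\<Sum>k<n + 1. a e k * b k) = 0"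
  proof (rule siegel_lemma[of "(m - 1) * g" "n + 1" a "HH N" "YY N"])
    fix e k assume e: "e < (m - 1) * g"
    have "norm (of_int (a e k) :: complex) \<le> real (HH N)" unfolding a(1)[OF e] by (rule co_le[OF a(2,3)[OF e]])
    then have "\<bar>real_of_int (a e k)\<bar> \<le> real (HH N)" by simp
    then show "\<bar>a e k\<bar> \<le> int (HH N)" by linarith
  qed (use siegel_condition[of N] in \<open>auto simp: n_def g_def\<close>)
  define s where "s i t = (\<Sum>k<n + 1. (if k \<le> t then of_nat (t choose k) * of_int (b k) * egf (u i) (t - k) else 0))" for i t
  define Q where "Q = (\<Sum>k<n + 1. monom (of_int (b k) * (fact n / fact k)) k :: complex poly)"
  define p where "p i = (\<Sum>t\<le>n. monom (fact n / fact t * s i t) t)" for i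
  define r where "r i = fps_of_poly Q * u i - fps_of_poly (p i)" for i
  have coeff_Q: "coeff Q k = (if k \<le> n then of_int (b k) * (fact n / fact k) else 0)" for k
    unfolding Q_def coeff_sum by (simp add: coeff_monom less_Suc_eq_le)
  have coeff_p: "coeff (p i) t = (if t \<le> n then fact n / fact t * s i t else 0)" for i t
    unfolding p_def coeff_sum by (simp add: coeff_monom)
  have Qu: "fps_nth (fps_of_poly Q * u i) t = fact n / fact t * s i t" for i t
  proof -
    have "fps_nth (fps_of_poly Q * u i) t = (\<Sum>k\<le>t. coeff Q k * (egf (u i) (t - k) / fact (t - k)))"
      unfolding fps_mult_nth atLeast0AtMost by (simp add: fps_nth_egf[of "u i"])
    also have "\<dots> = (\<Sum>k\<in>{..t} \<inter> {..n}. of_int (b k) * (fact n / fact k) * (egf (u i) (t - k) / fact (t - k)))"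
      by (rule sum.mono_neutral_cong_right) (auto simp: coeff_Q)
    also have "\<dots> = (\<Sum>k\<in>{..t} \<inter> {..n}. fact n / fact t * (of_nat (t choose k) * of_int (b k) * egf (u i) (t - k)))"
      by (intro sum.cong) (auto simp: binomial_fact)
    also have "\<dots> = (\<Sum>k<n + 1. fact n / fact t * (if k \<le> t then of_nat (t choose k) * of_int (b k) * egf (u i) (t - k) else 0))"
      by (rule sum.mono_neutral_cong_left) auto
    also have "\<dots> = fact n / fact t * s i t" by (simp only: s_def sum_distrib_left)
    finally show ?thesis .
  qed
  have s_zero: "s i t = 0" if i: "i < m" and t: "n < t" "t < T" for i t
  proof (cases "i = 0")
    case True
    have "egf (u i) (t - k) = 0" if "k < n + 1" for k using True u0 t that by (simp add: egf_def)
    then show ?thesis unfolding s_def by (intro sum.neutral) auto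
  next
    case False
    define z where "z = t - n - 1"
    define e where "e = (i - 1) * g + z"
    have lt: "z < g" using t T by (simp add: z_def)
    have "e < (i - 1) * g + g" using lt by (simp add: e_def)
    also have "\<dots> = i * g" using False by (cases i) auto
    also have "\<dots> \<le> (m - 1) * g" using i by (intro mult_right_mono) auto
    finally have e: "e < (m - 1) * g" .
    have "e div g + 1 = i" "n + 1 + e mod g = t"
      using lt False t unfolding e_def by (simp_all, simp add: z_def)
    then have "(\<Sum>k<n + 1. co i t k * of_int (b k)) = of_int (\<Sum>k<n + 1. a e k * b k)"
      using a(1)[OF e] by simp
    then have "0 = (\<Sum>k<n + 1. co i t k * of_int (b k))" unfolding b(3)[OF e] of_int_0 by (rule sym)
    also have "\<dots> = of_nat (D T) * s i t"
      unfolding s_def sum_distrib_left by (intro sum.cong) (auto simp: co_def)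
    finally show ?thesis using D_pos[of T] by simp
  qed
  have s_le: "norm (s i t) \<le> 2 ^ t * real (YY N) * real C ^ (t + 1)" if "i < m" for i t
  proof -
    have "norm (s i t) \<le> (\<Sum>k<n + 1. (if k \<le> t then real (t choose k) * (real (YY N) * real C ^ (t + 1)) else 0))"
      unfolding s_def
    proof (rule sum_norm_le)
      fix k
      have "norm (egf (u i) (t - k)) \<le> real C ^ (t + 1)"
        by (rule order.trans[OF u_le power_increasing]) (use that C1 in auto)
      moreover have "\<bar>real_of_int (b k)\<bar> \<le> real (YY N)" using b(2)[of k] by linarith
      ultimately have "real (t choose k) * (\<bar>real_of_int (b k)\<bar> * norm (egf (u i) (t - k))) \<le> real (t choose k) * (real (YY N) * real C ^ (t + 1))"
        by (intro mult_left_mono mult_mono) auto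
      then show "norm (if k \<le> t then of_nat (t choose k) * of_int (b k) * egf (u i) (t - k) else 0)
          \<le> (if k \<le> t then real (t choose k) * (real (YY N) * real C ^ (t + 1)) else 0)"
        by (simp add: norm_mult mult.assoc)
    qed
    also have "\<dots> = (\<Sum>k\<in>{..<n + 1} \<inter> {..t}. real (t choose k) * (real (YY N) * real C ^ (t + 1)))"
      by (rule sum.mono_neutral_cong_right) auto
    also have "\<dots> \<le> (\<Sum>k\<le>t. real (t choose k) * (real (YY N) * real C ^ (t + 1)))"
      by (intro sum_mono2) auto
    also have "\<dots> = real (\<Sum>k\<le>t. t choose k) * (real (YY N) * real C ^ (t + 1))"
      by (simp only: sum_distrib_right of_nat_sum)
    also have "\<dots> = 2 ^ t * real (YY N) * real C ^ (t + 1)" by (simp add: choose_row_sum)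
    finally show ?thesis .
  qed
  have r_nth: "fps_nth (r i) t = (if t \<le> n then 0 else fact n / fact t * s i t)" for i t
    by (simp add: r_def Qu coeff_p)
  show thesis
  proof (rule that[of Q p r])
    show "Q \<noteq> 0"
    proof -
      obtain k where "k < n + 1" "b k \<noteq> 0" using b(1) by blast
      then have "coeff Q k \<noteq> 0" by (simp add: coeff_Q)
      then show ?thesis by auto
    qed
    show "degree Q \<le> nn N" by (rule degree_le) (simp add: coeff_Q n_def)
    show "degree (p i) \<le> nn N" for i by (rule degree_le) (simp add: coeff_p n_def)
    show "of_nat (D (nn N)) * coeff (p i) l \<in> \<int>" if i: "i < m" for i l
    proof (cases "l \<le> n")
      case True
      have "of_nat (D n) * s i l = (\<Sum>k<n + 1. if k \<le> l then of_nat (l choose k) * of_int (b k) * (of_nat (D n) * egf (u i) (l - k)) else 0)"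
        unfolding s_def sum_distrib_left by (intro sum.cong) auto
      also have "\<dots> \<in> \<int>"
        using True i by (intro Ints_sum) (auto intro!: Ints_mult u_int)
      finally have "of_nat (D n) * s i l \<in> \<int>" .
      moreover have "fact n / fact l = (of_nat (fact n div fact l) :: complex)"
        using fact_dvd[OF True, where 'a = nat] of_nat_of_nat_div[of "fact l" "fact n", where 'a = complex] by simp
      ultimately have "of_nat (fact n div fact l) * (of_nat (D n) * s i l) \<in> \<int>"
        by (simp only: Ints_mult[OF Ints_of_nat])
      then show ?thesis
        using True \<open>fact n / fact l = _\<close> by (simp add: coeff_p n_def[symmetric] algebra_simps)
    qed (simp add: coeff_p)
    show "fps_of_poly (p i) = fps_of_poly Q * u i - r i" for i by (simp add: r_def)
    show "fps_nth (r i) t = 0" if "i < m" "t < TT N" for i t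
      using s_zero[of i t] that by (auto simp: r_nth T_def)
    fix i t assume i: "i < m"
    show "norm (fps_nth (r i) t) \<le> RR N / 4 ^ t"
    proof (cases "t < T")
      case True
      then have "fps_nth (r i) t = 0" using s_zero[of i t] i by (auto simp: r_nth)
      then show ?thesis by (simp add: RR_def)
    next
      case False
      \<comment> \<open>The 8 is a 2 from the binomial coefficients in \<open>s\<close> times a 4
        for the decay \<open>4 ^ t\<close>. Splitting off T! from t! leaves a term of the
        exponential series at \<open>x\<close>.\<close>
      define x where "x = 8 * real C"
      have x: "0 \<le> x" by (simp add: x_def)
      have f: "fact T * fact (t - T) \<le> (fact t :: real)"
      proof -
        have "fact T * fact (t - T) dvd (fact t :: nat)"
          using False by (metis binomial_fact_lemma dvd_triv_left not_less)
        then have "fact T * fact (t - T) \<le> (fact t :: nat)" by (intro dvd_imp_le) auto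
        then show ?thesis by (metis of_nat_fact of_nat_le_iff of_nat_mult)
      qed
      have "x ^ t / fact t \<le> x ^ t / (fact T * fact (t - T))"
        using x f by (intro divide_left_mono) auto
      also have "\<dots> = x ^ T / fact T * (x ^ (t - T) / fact (t - T))"
      proof -
        have "x ^ t = x ^ T * x ^ (t - T)" using False by (simp flip: power_add)
        then show ?thesis by simp
      qed
      also have "\<dots> \<le> x ^ T / fact T * exp x"
        using x power_le_fact_exp[OF x, of "t - T"] by (intro mult_left_mono) (auto simp: field_simps)
      finally have e: "x ^ t / fact t \<le> x ^ T / fact T * exp x" .
      have "norm (fps_nth (r i) t) = fact n / fact t * norm (s i t)" using False by (simp add: r_nth T norm_mult norm_divide)
      also have "\<dots> \<le> fact n / fact t * (2 ^ t * real (YY N) * real C ^ (t + 1))"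
        by (intro mult_left_mono s_le i) auto
      also have "\<dots> = real (YY N) * real C * fact n * (x ^ t / fact t) / 4 ^ t"
      proof -
        have "x = 4 * (2 * real C)" by (simp add: x_def)
        then have "x ^ t = 4 ^ t * (2 ^ t * real C ^ t)" by (simp only: power_mult_distrib)
        then show ?thesis by (simp add: field_simps)
      qed
      also have "\<dots> \<le> real (YY N) * real C * fact n * (x ^ T / fact T * exp x) / 4 ^ t"
        by (intro divide_right_mono mult_left_mono e) auto
      also have "\<dots> = RR N / 4 ^ t" by (simp add: RR_def x_def T_def n_def field_simps)
      finally show ?thesis .
    qed
  qed
qed

lemma power_le_power_of_multiple:
  fixes x a b N :: nat
  assumes "1 \<le> x" "a \<le> b * N"
  shows "x ^ a \<le> (x ^ b) ^ N"
  using power_increasing[OF assms(2,1)] by (simp add: power_mult)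

lemma prefactor_bound:
  obtains L :: nat where "1 \<le> L"
    "\<And>N. 1 \<le> N \<Longrightarrow> C ^ (nn N + 1) * da ^ KK N * YY N * (8 * C) ^ TT N \<le> L ^ N"
proof -
  define n1 T1 k1 where "n1 = 4 * m * (m - 1)" and "T1 = n1 + (4 * m - 1) + 1" and "k1 = 2 * (m - 1)"
  define L where "L = C ^ (n1 + 1) * da ^ k1 * (2 ^ (n1 + 1) * (C ^ (T1 + 1) * 2 ^ T1 * C ^ (T1 + 1))) ^ (4 * m - 1) * (8 * C) ^ T1"
  show thesis
  proof (rule that[of L])
    show "1 \<le> L" using C1 da unfolding L_def by (simp add: Suc_le_eq)
    fix N :: nat assume N: "1 \<le> N"
    have n: "nn N + 1 \<le> (n1 + 1) * N" using N by (simp add: nn_def n1_def)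
    have T: "TT N \<le> T1 * N" using N by (simp add: TT_def nn_def gg_def T1_def n1_def algebra_simps)
    have T': "TT N + 1 \<le> (T1 + 1) * N" using N T by simp
    have "HH N \<le> (C ^ (T1 + 1)) ^ N * (2 ^ T1) ^ N * (C ^ (T1 + 1)) ^ N"
      unfolding HH_def using C1 T T' by (intro mult_mono power_le_power_of_multiple) auto
    moreover have "nn N + 1 \<le> (2 ^ (n1 + 1)) ^ N"
    proof -
      have "nn N + 1 \<le> 2 ^ (nn N + 1)" by (metis less_exp less_imp_le)
      also have "\<dots> \<le> (2 ^ (n1 + 1)) ^ N" using n by (intro power_le_power_of_multiple) auto
      finally show ?thesis .
    qed
    ultimately have "(nn N + 1) * HH N \<le> (2 ^ (n1 + 1)) ^ N * ((C ^ (T1 + 1)) ^ N * (2 ^ T1) ^ N * (C ^ (T1 + 1)) ^ N)"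
      by (intro mult_mono) auto
    also have "\<dots> = (2 ^ (n1 + 1) * (C ^ (T1 + 1) * 2 ^ T1 * C ^ (T1 + 1))) ^ N"
      by (simp only: power_mult_distrib)
    finally have "YY N \<le> ((2 ^ (n1 + 1) * (C ^ (T1 + 1) * 2 ^ T1 * C ^ (T1 + 1))) ^ N) ^ (4 * m - 1)"
      unfolding YY_def by (intro power_mono) auto
    also have "\<dots> = ((2 ^ (n1 + 1) * (C ^ (T1 + 1) * 2 ^ T1 * C ^ (T1 + 1))) ^ (4 * m - 1)) ^ N"
      by (simp only: power_mult[symmetric] mult.commute)
    finally have Y: "YY N \<le> \<dots>" .
    have "C ^ (nn N + 1) * da ^ KK N * YY N * (8 * C) ^ TT N
      \<le> (C ^ (n1 + 1)) ^ N * (da ^ k1) ^ N * ((2 ^ (n1 + 1) * (C ^ (T1 + 1) * 2 ^ T1 * C ^ (T1 + 1))) ^ (4 * m - 1)) ^ N * ((8 * C) ^ T1) ^ N"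
      using C1 da n T by (intro mult_mono Y power_le_power_of_multiple) (auto simp: KK_def k1_def)
    also have "\<dots> = L ^ N" unfolding L_def by (simp only: power_mult_distrib)
    finally show "C ^ (nn N + 1) * da ^ KK N * YY N * (8 * C) ^ TT N \<le> L ^ N" .
  qed
qed

text \<open>With n = nn N, the factors \<open>fact (KK N)\<close> and \<open>N ^ N\<close> are at
  most n^KK and n^N, while T! exceeds n! by the factor n^(gg + 1) at least. The surplus
  \<open>N ^ N\<close> outgrows every geometric factor.\<close>

lemma factorial_gain:
  assumes "1 \<le> N"
  shows "fact (nn N) * fact (KK N) * N ^ N \<le> (fact (TT N) :: nat)"
proof -
  have ge: "fact n * n ^ j \<le> (fact (n + j) :: nat)" for n j
  proof (induction j)
    case (Suc j)
    have "fact n * n ^ Suc j = n * (fact n * n ^ j)" by simp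
    also have "\<dots> \<le> Suc (n + j) * fact (n + j)" using Suc by (intro mult_mono) auto
    finally show ?case by simp
  qed simp
  have m: "1 \<le> m - 1" using m2 by simp
  have "N \<le> 4 * m * (m - 1) * N" using m2 m by (simp add: Suc_le_eq)
  then have Nn: "N \<le> nn N" by (simp add: nn_def)
  have "2 * (m - 1) * N \<le> 4 * m * (m - 1) * N" using m2 by (intro mult_right_mono) auto
  then have Kn: "KK N \<le> nn N" by (simp add: KK_def nn_def)
  have "2 * (m - 1) + 1 \<le> 4 * m - 1" using m2 by simp
  then have "(2 * (m - 1) + 1) * N \<le> (4 * m - 1) * N" by (rule mult_right_mono) simp
  then have gK: "KK N + N \<le> gg N + 1" by (simp add: KK_def gg_def algebra_simps)
  have "fact (KK N) \<le> (nn N ^ KK N :: nat)"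
    by (rule order.trans[OF _ power_mono[OF Kn]]) (use fact_le_power[of "KK N", where 'a = nat] in simp_all)
  moreover have "N ^ N \<le> nn N ^ N" using Nn by (intro power_mono) auto
  ultimately have "fact (nn N) * fact (KK N) * N ^ N \<le> fact (nn N) * nn N ^ KK N * nn N ^ N"
    by (intro mult_mono) auto
  also have "\<dots> = fact (nn N) * nn N ^ (KK N + N)" by (simp add: power_add)
  also have "\<dots> \<le> fact (nn N) * nn N ^ (gg N + 1)"
    using gK Nn assms by (intro mult_left_mono power_increasing) auto
  also have "\<dots> \<le> fact (nn N + (gg N + 1))" by (rule ge)
  finally show ?thesis by (simp add: TT_def)
qed

lemma small_parameter:
  fixes S :: real and N0 :: nat
  assumes S: "0 \<le> S"
  obtains N where "N0 \<le> N" "1 \<le> N"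
    "real (D (nn N)) * real da ^ KK N * S * (4 * RR N * fact (KK N) * exp Asize) < 1"
proof -
  obtain L where L: "1 \<le> L"
    "\<And>N. 1 \<le> N \<Longrightarrow> C ^ (nn N + 1) * da ^ KK N * YY N * (8 * C) ^ TT N \<le> L ^ N"
    using prefactor_bound by blast
  define M where "M = S * 4 * real C * exp (8 * real C) * exp Asize"
  have M: "0 \<le> M" using S by (simp add: M_def)
  define k where "k = nat \<lceil>M\<rceil>"
  \<comment> \<open>As k + 1 > M, this gives N^N \<ge> L^N (k + 1)^N > M L^N.\<close>
  define N where "N = max N0 (L * (k + 1))"
  have N1: "1 \<le> N" using L(1) by (simp add: N_def le_max_iff_disj)
  have bigN: "M * real (L ^ N) < real (N ^ N)"
  proof -
    have "M < real (k + 1)" unfolding k_def using M by linarith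
    also have "\<dots> \<le> real ((k + 1) ^ N)" 
      using N1 by (intro of_nat_mono self_le_power) auto
    finally have "M * real (L ^ N) < real ((k + 1) ^ N) * real (L ^ N)" using L(1) by (intro mult_strict_right_mono) auto
    also have "\<dots> = real ((L * (k + 1)) ^ N)"
      by (simp only: power_mult_distrib of_nat_mult mult.commute)
    also have "\<dots> \<le> real (N ^ N)" by (intro of_nat_mono power_mono) (auto simp: N_def)
    finally show ?thesis .
  qed
  have "real (D (nn N)) * real da ^ KK N * S * (4 * RR N * fact (KK N) * exp Asize)
      = M * (real (D (nn N)) * real da ^ KK N * real (YY N) * (8 * real C) ^ TT N) * (fact (nn N) * fact (KK N) / fact (TT N))"
    by (simp add: M_def RR_def)
  also have "\<dots> \<le> M * real (L ^ N) * (1 / real (N ^ N))"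
  proof (intro mult_mono)
    have "D (nn N) * da ^ KK N * YY N * (8 * C) ^ TT N \<le> L ^ N"
      by (rule order.trans[OF _ L(2)[OF N1]]) (intro mult_mono D_le, auto)
    then have "real (D (nn N) * da ^ KK N * YY N * (8 * C) ^ TT N) \<le> real (L ^ N)" by (simp only: of_nat_le_iff)
    then show "real (D (nn N)) * real da ^ KK N * real (YY N) * (8 * real C) ^ TT N \<le> real (L ^ N)" by simp
    have "real (fact (nn N) * fact (KK N) * N ^ N) \<le> real (fact (TT N))"
      using factorial_gain[OF N1] by (simp only: of_nat_le_iff)
    then show "fact (nn N) * fact (KK N) / fact (TT N) \<le> 1 / real (N ^ N)"
      using N1 by (simp add: field_simps)
  qed (use M in auto)
  also have "\<dots> < 1" using bigN N1 by (simp add: field_simps)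
  finally show thesis using that[of N] N1 by (simp add: N_def)
qed

text \<open>The hypothesis on \<open>S\<close> excludes a vanishing determinant: a form in the
  single coordinate \<mu> that annihilates \<open>p\<close> gives \<open>p \<mu> = 0\<close>, so
  \<open>Q * u \<mu>\<close> equals its own remainder although \<open>u \<mu>\<close> is a unit. A
  nonvanishing determinant has more zeros at 0 and 1 than its degree allows.\<close>

theorem values_independent:
  fixes c :: "nat \<Rightarrow> int"
  assumes nd: "\<And>S. \<lbrakk>\<exists>G\<in>S. \<exists>i<m. G i \<noteq> 0;
      \<And>G H a b. G \<in> S \<Longrightarrow> H \<in> S \<Longrightarrow> (\<lambda>i. a * G i + b * H i) \<in> S;
      \<And>G. G \<in> S \<Longrightarrow> nabf G \<in> S\<rbrakk>
      \<Longrightarrow> \<exists>G\<in>S. \<exists>\<mu><m. G \<mu> \<noteq> 0 \<and> (\<forall>i<m. i \<noteq> \<mu> \<longrightarrow> G i = 0) \<and> fps_nth (u \<mu>) 0 \<noteq> 0"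
    and rel: "(\<Sum>i<m. of_int (c i) * eval_fps (u i) 1) = 0" and i0: "i0 < m"
  shows "c i0 = 0"
proof (rule ccontr)
  assume c0: "c i0 \<noteq> 0"
  \<comment> \<open>This lower bound for \<open>N\<close> beats the terms
    \<open>bd * m * m + m\<close> of the degree count, which do not grow with
    \<open>N\<close>.\<close>
  obtain N where N: "bd * m * m + m + 2 \<le> N" "1 \<le> N"
    "real (D (nn N)) * real da ^ KK N * (\<Sum>i<m. \<bar>real_of_int (c i)\<bar>) * (4 * RR N * fact (KK N) * exp Asize) < 1"
    using small_parameter[of "\<Sum>i<m. \<bar>real_of_int (c i)\<bar>" "bd * m * m + m + 2"] by (auto intro: sum_nonneg)
  obtain Q p r where Q: "Q \<noteq> 0" "degree Q \<le> nn N" and p: "\<And>i. degree (p i) \<le> nn N"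
    "\<And>i l. i < m \<Longrightarrow> of_nat (D (nn N)) * coeff (p i) l \<in> \<int>"
    "\<And>i. i < m \<Longrightarrow> fps_of_poly (p i) = fps_of_poly Q * u i - r i"
    and r: "\<And>i t. i < m \<Longrightarrow> t < TT N \<Longrightarrow> fps_nth (r i) t = 0"
    "\<And>i t. i < m \<Longrightarrow> norm (fps_nth (r i) t) \<le> RR N / 4 ^ t"
    using approximation_exists[of N] by blast
  have van: "(\<Sum>i<m. of_int (c i) * poly ((nab ^^ k) p i) 1) = 0" if "k \<le> KK N" for k
    by (rule relation_transfers[OF rel p(3) r(2) _ p(2) D_pos N(3) that]) (simp_all add: RR_def)
  \<comment> \<open>Truncation makes \<open>u\<close> a vector of polynomials that solves the system
    modulo the power \<open>TT N\<close> of x, as \<open>X_power_dvd_det\<close> requires.\<close>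
  define ut where "ut i = (\<Sum>t<TT N. monom (fps_nth (u i) t) t)" for i
  have coeff_ut: "coeff (ut i) t = (if t < TT N then fps_nth (u i) t else 0)" for i t
    unfolding ut_def coeff_sum by (simp add: coeff_monom)
  have ut0: "ut 0 = 1"
    by (rule poly_eqI) (auto simp: coeff_ut u0 TT_def coeff_1)
  have X1: "[:0, 1:] ^ TT N dvd nab ut i" if i: "i < m" for i
    unfolding X_power_dvd_iff
  proof (intro allI impI)
    fix t assume t: "t < TT N"
    have "coeff (nab ut i) t = of_nat t * fps_nth (u i) t - (\<Sum>j<m. \<Sum>l\<le>t. coeff (A i j) l * fps_nth (u j) (t - l))"
      using t by (simp add: nab_def coeff_euler coeff_sum coeff_mult coeff_ut less_imp_diff_less)
    also have "\<dots> = fps_nth (fps_X * fps_deriv (u i) - (\<Sum>j<m. fps_of_poly (A i j) * u j)) t"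
      unfolding fps_sub_nth fps_nth_X_deriv fps_sum_nth by (simp add: fps_mult_nth atLeast0AtMost)
    also have "\<dots> = 0" by (simp add: ode[OF i])
    finally show "coeff (nab ut i) t = 0" .
  qed
  have X2: "[:0, 1:] ^ TT N dvd p i - Q * ut i" if i: "i < m" for i
    unfolding X_power_dvd_iff
  proof (intro allI impI)
    fix t assume t: "t < TT N"
    have "coeff (p i) t = fps_nth (fps_of_poly Q * u i) t"
      using arg_cong[OF p(3)[OF i], of "\<lambda>f. fps_nth f t"] r(1)[OF i t] by simp
    also have "\<dots> = coeff (Q * ut i) t"
      using t by (simp add: fps_mult_nth atLeast0AtMost coeff_mult coeff_ut less_imp_diff_less)
    finally show "coeff (p i - Q * ut i) t = 0" by simp
  qed
  define \<Delta> where "\<Delta> = Determinant.det (iter_mat p)"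
  show False
  proof (cases "\<Delta> = 0")
    case True
    obtain S where S: "\<exists>G\<in>S. \<exists>i<m. G i \<noteq> 0"
      "\<And>G H a b. G \<in> S \<Longrightarrow> H \<in> S \<Longrightarrow> (\<lambda>i. a * G i + b * H i) \<in> S"
      "\<And>G. G \<in> S \<Longrightarrow> nabf G \<in> S" "\<And>G. G \<in> S \<Longrightarrow> (\<Sum>i<m. G i * p i) = 0"
      by (rule stable_annihilator[OF True[unfolded \<Delta>_def]]) blast
    from nd[OF S(1-3)] obtain G \<mu> where G: "G \<in> S" "\<mu> < m" "G \<mu> \<noteq> 0" "\<And>i. i < m \<Longrightarrow> i \<noteq> \<mu> \<Longrightarrow> G i = 0"
      "fps_nth (u \<mu>) 0 \<noteq> 0" by blast
    have "(\<Sum>i<m. G i * p i) = (\<Sum>i\<in>{\<mu>}. G i * p i)"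
      using G by (intro sum.mono_neutral_right) auto
    then have "p \<mu> = 0" using S(4)[OF G(1)] G(3) by simp
    then have eq: "fps_of_poly Q * u \<mu> = r \<mu>" using p(3)[OF G(2)] by simp
    \<comment> \<open>\<open>Q * u \<mu>\<close> has the order of \<open>Q\<close> at 0, which is at
      most \<open>nn N\<close>, whereas the remainder starts at \<open>TT N\<close>.\<close>
    define k where "k = subdegree (fps_of_poly Q)"
    have "fps_of_poly Q \<noteq> 0" using Q(1) by simp
    then have nz: "coeff Q k \<noteq> 0" using nth_subdegree_nonzero[of "fps_of_poly Q"] by (simp add: k_def)
    then have "k \<le> degree Q" by (rule le_degree)
    then have "k < TT N" using Q(2) by (simp add: TT_def)
    then have "fps_nth (fps_of_poly Q * u \<mu>) k = 0" using r(1)[OF G(2)] eq by simp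
    moreover have "fps_nth (fps_of_poly Q * u \<mu>) k = coeff Q k * fps_nth (u \<mu>) 0"
      using nth_subdegree_mult[of "fps_of_poly Q" "u \<mu>"] subdegree_eq_0_iff[of "u \<mu>"] G(5) by (simp add: k_def)
    ultimately show False using nz G(5) by simp
  next
    case False
    let ?X = "[:0, 1:] ^ (TT N * (m - 1)) :: complex poly" and ?Y = "[:-1, 1:] ^ (KK N - m) :: complex poly"
    have "?X dvd \<Delta>" unfolding \<Delta>_def by (rule X_power_dvd_det[OF X1 X2 ut0])
    moreover have "?Y dvd \<Delta>" unfolding \<Delta>_def
      by (rule linear_power_dvd_det[of _ "\<lambda>i. of_int (c i)", OF _ i0]) (use van c0 in auto)
    moreover have "coprime ?X ?Y"
    proof -
      have "coprime [:0, 1:] ([:-1, 1:] :: complex poly)"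
      proof (rule coprimeI)
        fix d :: "complex poly" assume "d dvd [:0, 1:]" "d dvd [:-1, 1:]"
        then have "d dvd [:0, 1:] - [:-1, 1:]" by (rule dvd_diff)
        then show "is_unit d" by (simp add: one_pCons)
      qed
      then show ?thesis by (simp only: coprime_power_left_iff coprime_power_right_iff simp_thms)
    qed
    ultimately have "?X * ?Y dvd \<Delta>" by (rule divides_mult)
    then have "degree (?X * ?Y) \<le> degree \<Delta>" using False by (rule dvd_imp_degree_le)
    moreover have "degree (?X * ?Y) = TT N * (m - 1) + (KK N - m)"
      by (subst degree_mult_eq) (auto simp: degree_power_eq)
    moreover have "degree \<Delta> \<le> m * (nn N + bd * m)"
      unfolding \<Delta>_def by (rule degree_det_iter_mat[OF A_deg p(1)])
    ultimately have le: "TT N * (m - 1) + (KK N - m) \<le> m * (nn N + bd * m)" by simp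
    \<comment> \<open>The zero at 0 leaves a gap of about m' N to the leading part m nn N of the
      degree; the zero at 1 has order 2 m' N - m and overshoots it by about m' N.\<close>
    define m' where "m' = m - 1"
    have m': "1 \<le> m'" "m = m' + 1" using m2 by (auto simp: m'_def)
    have ng: "nn N = m' * gg N + m' * N" using nn_gg[of N] by (simp add: m'_def)
    have "m \<le> N" using N(1) by simp
    also have "N \<le> 2 * m' * N" using m'(1) by simp
    finally have "m \<le> 2 * m' * N" .
    moreover have "KK N = 2 * m' * N" by (simp add: KK_def m'_def)
    moreover have "TT N * (m - 1) = nn N * m' + m' * gg N + m'"
      unfolding m'_def[symmetric] by (simp add: TT_def algebra_simps)
    moreover have "m * (nn N + bd * m) = m * nn N + bd * m * m" by (simp add: algebra_simps)
    moreover have "m * nn N = nn N * m' + nn N"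
      using arg_cong[OF m'(2), of "\<lambda>x. x * nn N"] by (simp add: algebra_simps)
    ultimately have "m' + m' * N \<le> bd * m * m + m" using le ng by linarith
    moreover have "N \<le> m' * N" using m'(1) by simp
    ultimately show False using N(1) by linarith
  qed
qed

end

section \<open>Monomials in the functions of a tower\<close>

lemma fps_of_poly_of_nat: "fps_of_poly (of_nat n) = (of_nat n :: 'a::comm_ring_1 fps)"
  by (induction n) (simp_all add: fps_of_poly_add)

lemma euler_fps_monomial:
  fixes y :: "'i \<Rightarrow> complex fps" and k :: "'i \<Rightarrow> nat"
  assumes "finite S"
  shows "fps_X * fps_deriv (\<Prod>j\<in>S. y j ^ k j)
    = (\<Sum>j\<in>S. of_nat (k j) * (fps_X * fps_deriv (y j)) * (\<Prod>i\<in>S. y i ^ (k(j := k j - 1)) i))"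
  using assms
proof (induction S)
  case (insert a S)
  have pw: "fps_deriv (y a ^ k a) = of_nat (k a) * fps_deriv (y a) * y a ^ (k a - 1)"
    by (simp add: fps_deriv_power' mult.commute mult.left_commute)
  have "(\<Prod>i\<in>insert a S. y i ^ (k(a := k a - 1)) i) = y a ^ (k a - 1) * (\<Prod>i\<in>S. y i ^ k i)"
  proof -
    have "(\<Prod>i\<in>S. y i ^ (k(a := k a - 1)) i) = (\<Prod>i\<in>S. y i ^ k i)"
      using insert.hyps by (intro prod.cong) auto
    then show ?thesis using insert.hyps by simp
  qed
  moreover have "(\<Prod>i\<in>insert a S. y i ^ (k(j := k j - 1)) i) = y a ^ k a * (\<Prod>i\<in>S. y i ^ (k(j := k j - 1)) i)"
    if "j \<in> S" for j using insert.hyps that by (simp, metis)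
  ultimately have "(\<Sum>j\<in>insert a S. of_nat (k j) * (fps_X * fps_deriv (y j)) * (\<Prod>i\<in>insert a S. y i ^ (k(j := k j - 1)) i))
     = of_nat (k a) * (fps_X * fps_deriv (y a)) * (y a ^ (k a - 1) * (\<Prod>i\<in>S. y i ^ k i))
       + (\<Sum>j\<in>S. y a ^ k a * (of_nat (k j) * (fps_X * fps_deriv (y j)) * (\<Prod>i\<in>S. y i ^ (k(j := k j - 1)) i)))"
    unfolding sum.insert[OF insert.hyps] by (simp add: algebra_simps)
  also have "\<dots> = of_nat (k a) * (fps_X * fps_deriv (y a)) * (y a ^ (k a - 1) * (\<Prod>i\<in>S. y i ^ k i))
       + y a ^ k a * (fps_X * fps_deriv (\<Prod>j\<in>S. y j ^ k j))"
    unfolding insert.IH sum_distrib_left ..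
  also have "\<dots> = fps_X * fps_deriv (y a ^ k a * (\<Prod>j\<in>S. y j ^ k j))"
    unfolding fps_deriv_mult pw by (simp add: algebra_simps)
  finally show ?case using insert.hyps by simp
qed simp

lemma eval_fps_monomial:
  fixes y :: "'i \<Rightarrow> complex fps"
  assumes "finite S" "\<And>j. j \<in> S \<Longrightarrow> fps_conv_radius (y j) = \<infinity>"
  shows "eval_fps (\<Prod>j\<in>S. y j ^ k j) z = (\<Prod>j\<in>S. eval_fps (y j) z ^ k j) \<and> fps_conv_radius (\<Prod>j\<in>S. y j ^ k j) = \<infinity>"
  using assms
proof (induction S)
  case (insert a S)
  have pw: "eval_fps (y a ^ l) z = eval_fps (y a) z ^ l \<and> fps_conv_radius (y a ^ l) = \<infinity>" for l
  proof (induction l)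
    case (Suc l)
    then show ?case
      using fps_conv_radius_mult[of "y a" "y a ^ l"] eval_fps_mult[of z "y a" "y a ^ l"] insert.prems[of a] by simp
  qed simp
  then show ?case
    using insert fps_conv_radius_mult[of "y a ^ k a" "\<Prod>j\<in>S. y j ^ k j"]
      eval_fps_mult[of z "y a ^ k a" "\<Prod>j\<in>S. y j ^ k j"] by simp
qed simp

lemma arith_geom_common:
  assumes "finite I" "\<And>i. i \<in> I \<Longrightarrow> arith_geom (a i)"
  shows "\<exists>(C::nat) D. 1 \<le> C \<and> (\<forall>n. 0 < D n \<and> D n \<le> C ^ (n + 1) \<and>
    (\<forall>i\<in>I. norm (a i n) \<le> real C ^ (n + 1) \<and> (\<forall>k\<le>n. of_nat (D n) * a i k \<in> \<int>)))"
  using assms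
proof (induction I)
  case empty
  show ?case by (rule exI[of _ 1], rule exI[of _ "\<lambda>_. 1"]) auto
next
  case (insert x I)
  obtain C D where C: "1 \<le> C" "\<And>n. 0 < D n" "\<And>n. D n \<le> C ^ (n + 1)"
    "\<And>n i. i \<in> I \<Longrightarrow> norm (a i n) \<le> real C ^ (n + 1)" "\<And>n i k. i \<in> I \<Longrightarrow> k \<le> n \<Longrightarrow> of_nat (D n) * a i k \<in> \<int>"
    using insert.IH insert.prems by (metis insertCI)
  obtain C' D' where C': "1 \<le> C'" "\<And>n. 0 < D' n" "\<And>n. D' n \<le> C' ^ (n + 1)"
    "\<And>n. norm (a x n) \<le> real C' ^ (n + 1)" "\<And>n k. k \<le> n \<Longrightarrow> of_nat (D' n) * a x k \<in> \<int>"
    using insert.prems[of x] unfolding arith_geom_def by auto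
  have le: "real C ^ (n + 1) \<le> real (C * C') ^ (n + 1)" "real C' ^ (n + 1) \<le> real (C * C') ^ (n + 1)" for n
    using C(1) C'(1) by (intro power_mono; simp)+
  show ?case
  proof (intro exI conjI allI ballI impI)
    show "1 \<le> C * C'" using C(1) C'(1) by simp
    fix n
    show "0 < D n * D' n" using C(2) C'(2) by simp
    show "D n * D' n \<le> (C * C') ^ (n + 1)"
      unfolding power_mult_distrib by (intro mult_mono C(3) C'(3)) auto
    fix i assume i: "i \<in> insert x I"
    show "norm (a i n) \<le> real (C * C') ^ (n + 1)"
      using i order.trans[OF C(4) le(1)] order.trans[OF C'(4) le(2)] by auto
    fix k assume k: "k \<le> n"
    have "of_nat (D' n) * (of_nat (D n) * a i k) \<in> \<int>" if "i \<in> I" by (rule Ints_mult[OF Ints_of_nat C(5)[OF that k]])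
    moreover have "of_nat (D n) * (of_nat (D' n) * a x k) \<in> \<int>" by (rule Ints_mult[OF Ints_of_nat C'(5)[OF k]])
    ultimately show "of_nat (D n * D' n) * a i k \<in> \<int>" using i by (auto simp: mult_ac)
  qed
qed

text \<open>The conditions on \<open>y 0\<close> force the series of exp (-x). Its constant term 1
  is what makes the coordinate of an eigenform a unit.\<close>

locale exp_tower_functions = exp_tower q d kap B0 B1
  for q d :: nat and kap :: complex and B0 B1 :: "complex poly" +
  fixes y :: "nat \<Rightarrow> complex fps" and da :: nat
  assumes d: "1 \<le> d"
    and y0: "fps_X * fps_deriv (y 0) = - (fps_X * y 0)" "fps_nth (y 0) 0 = 1"
    and y1: "fps_X * fps_deriv (y 1) = - (fps_const kap * y 1) + fps_of_poly B0 + fps_of_poly B1 * y 0"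
    and yj: "\<And>j. 2 \<le> j \<Longrightarrow> j \<le> q \<Longrightarrow> fps_X * fps_deriv (y j) = - (fps_const kap * y j) + y (j - 1)"
    and growth: "\<And>j. j \<le> q \<Longrightarrow> arith_geom (egf (y j))"
    and da: "0 < da" "of_nat da * kap \<in> \<int>" "\<And>l. of_nat da * coeff B0 l \<in> \<int>" "\<And>l. of_nat da * coeff B1 l \<in> \<int>"
begin

definition mono :: "(nat \<Rightarrow> nat) \<Rightarrow> complex fps" where
  "mono k = (\<Prod>j\<le>q. y j ^ k j)"

lemma mono_upd: "i \<le> q \<Longrightarrow> y i * mono k = mono (k(i := Suc (k i)))"
proof -
  assume i: "i \<le> q"
  have "mono (k(i := Suc (k i))) = y i ^ Suc (k i) * (\<Prod>j\<in>{..q} - {i}. y j ^ k j)"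
    unfolding mono_def using i by (subst prod.remove[of _ i]) (auto intro!: prod.cong)
  moreover have "mono k = y i ^ k i * (\<Prod>j\<in>{..q} - {i}. y j ^ k j)"
    unfolding mono_def using i by (subst prod.remove[of _ i]) auto
  ultimately show ?thesis by (simp add: mult_ac)
qed

lemma mono_pred: "i \<le> q \<Longrightarrow> 0 < k i \<Longrightarrow> y i * mono (k(i := k i - 1)) = mono k"
  using mono_upd[of i "k(i := k i - 1)"] by simp

lemma mono_shift: "1 \<le> j \<Longrightarrow> j \<le> q \<Longrightarrow> y (j - 1) * mono (k(j := k j - 1)) = mono (shift k j)"
proof -
  assume j: "1 \<le> j" "j \<le> q"
  then have "(k(j := k j - 1)) (j - 1) = k (j - 1)" by auto
  then show ?thesis using mono_upd[of "j - 1" "k(j := k j - 1)"] j unfolding shift_def by auto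
qed

lemma euler_mono:
  "fps_X * fps_deriv (mono k) = fps_of_poly (lam k) * mono k
     + (\<Sum>j\<in>{2..q}. if 0 < k j then of_nat (k j) * mono (shift k j) else 0)
     + (if 0 < k 1 then of_nat (k 1) * fps_of_poly B0 * mono (drop1 k) else 0)
     + (if 0 < k 1 then of_nat (k 1) * fps_of_poly B1 * mono (shift k 1) else 0)"
proof -
  define t where "t j = of_nat (k j) * (fps_X * fps_deriv (y j)) * mono (k(j := k j - 1))" for j
  have t0: "t 0 = - (of_nat (k 0) * (fps_X * mono k))"
  proof (cases "k 0 = 0")
    case False
    then show ?thesis using mono_pred[of 0 k] unfolding t_def y0 by (simp add: mult_ac)
  qed (simp add: t_def)
  have t1: "t 1 = - (of_nat (k 1) * (fps_const kap * mono k))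
     + (if 0 < k 1 then of_nat (k 1) * fps_of_poly B0 * mono (drop1 k) else 0)
     + (if 0 < k 1 then of_nat (k 1) * fps_of_poly B1 * mono (shift k 1) else 0)"
  proof (cases "k 1 = 0")
    case False
    then have "t 1 = of_nat (k 1) * (- (fps_const kap * (y 1 * mono (k(1 := k 1 - 1))))
        + fps_of_poly B0 * mono (k(1 := k 1 - 1)) + fps_of_poly B1 * (y (1 - 1) * mono (k(1 := k 1 - 1))))"
      unfolding t_def y1 by (simp add: algebra_simps)
    also have "\<dots> = of_nat (k 1) * (- (fps_const kap * mono k) + fps_of_poly B0 * mono (drop1 k) + fps_of_poly B1 * mono (shift k 1))"
      using mono_pred[of 1 k] mono_shift[of 1 k] q False by (simp add: drop1_def)
    finally show ?thesis using False by (simp add: algebra_simps)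
  qed (simp add: t_def)
  have tj: "t j = - (of_nat (k j) * (fps_const kap * mono k)) + (if 0 < k j then of_nat (k j) * mono (shift k j) else 0)"
    if j: "j \<in> {2..q}" for j
  proof (cases "k j = 0")
    case False
    then have "t j = of_nat (k j) * (- (fps_const kap * (y j * mono (k(j := k j - 1)))) + y (j - 1) * mono (k(j := k j - 1)))"
      unfolding t_def using j by (simp add: yj algebra_simps)
    also have "\<dots> = of_nat (k j) * (- (fps_const kap * mono k) + mono (shift k j))"
      using mono_pred[of j k] mono_shift[of j k] j False by simp
    finally show ?thesis using False by (simp add: algebra_simps)
  qed (simp add: t_def)
  have set: "{..q} = insert 0 (insert 1 {2..q})" using q by auto
  have "fps_X * fps_deriv (mono k) = (\<Sum>j\<le>q. t j)"
    unfolding mono_def t_def by (rule euler_fps_monomial) simp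
  also have "\<dots> = t 0 + t 1 + (\<Sum>j\<in>{2..q}. t j)" unfolding set by simp
  also have "(\<Sum>j\<in>{2..q}. t j) = - (\<Sum>j\<in>{2..q}. of_nat (k j) * (fps_const kap * mono k))
      + (\<Sum>j\<in>{2..q}. if 0 < k j then of_nat (k j) * mono (shift k j) else 0)"
    unfolding sum_negf[symmetric] sum.distrib[symmetric] by (rule sum.cong[OF refl tj])
  also have "(\<Sum>j\<in>{2..q}. of_nat (k j) * (fps_const kap * mono k)) = of_nat (\<Sum>j\<in>{2..q}. k j) * (fps_const kap * mono k)"
    by (simp only: of_nat_sum sum_distrib_right)
  finally have eq: "fps_X * fps_deriv (mono k) = t 0 + t 1 + (- (of_nat (\<Sum>j\<in>{2..q}. k j) * (fps_const kap * mono k))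
      + (\<Sum>j\<in>{2..q}. if 0 < k j then of_nat (k j) * mono (shift k j) else 0))" .
  have "lin (\<lambda>j. if j = 0 then 0 else 1) k = k 1 + (\<Sum>j\<in>{2..q}. k j)"
    unfolding lin_def set by (auto intro!: sum.cong)
  then have "fps_of_poly (lam k) = - (fps_const kap * of_nat (k 1 + (\<Sum>j\<in>{2..q}. k j))) - of_nat (k 0) * fps_X"
    by (simp add: lam_def fps_of_poly_pCons fps_of_nat[symmetric] algebra_simps flip: fps_const_neg)
  then have lam: "fps_of_poly (lam k) * mono k
      = - (of_nat (k 0) * (fps_X * mono k)) - of_nat (k 1) * (fps_const kap * mono k)
        - of_nat (\<Sum>j\<in>{2..q}. k j) * (fps_const kap * mono k)"
    by (simp only: of_nat_add) (simp add: algebra_simps)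
  show ?thesis unfolding eq t0 t1 lam by (simp add: algebra_simps)
qed

lemma mon_list_sum: "(\<Sum>j<mm. f (mon_list ! j)) = (\<Sum>k\<in>mons. f k)"
  by (rule sum.reindex_bij_betw) (use bij_betw_nth[OF mon_list(2)] mon_list(1) in auto)

lemma mono_ode:
  assumes "k \<in> mons"
  shows "fps_X * fps_deriv (mono k) = (\<Sum>k'\<in>mons. fps_of_poly (dmat k k') * mono k')"
proof -
  have pick: "(\<Sum>k'\<in>mons. fps_of_poly (if P \<and> k' = a then x else 0) * mono k') = (if P then fps_of_poly x * mono a else 0)"
    if "P \<Longrightarrow> a \<in> mons" for P a x
  proof (cases P)
    case True
    have "(\<Sum>k'\<in>mons. fps_of_poly (if P \<and> k' = a then x else 0) * mono k') = (\<Sum>k'\<in>mons. if k' = a then fps_of_poly x * mono a else 0)"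
      by (intro sum.cong) (auto simp: True)
    then show ?thesis using that True finite_mons by simp
  qed simp
  have "(\<Sum>k'\<in>mons. fps_of_poly (dmat k k') * mono k')
     = (\<Sum>k'\<in>mons. fps_of_poly (if True \<and> k' = k then lam k else 0) * mono k')
     + (\<Sum>j\<in>{2..q}. \<Sum>k'\<in>mons. fps_of_poly (if 0 < k j \<and> k' = shift k j then of_nat (k j) else 0) * mono k')
     + (\<Sum>k'\<in>mons. fps_of_poly (if 0 < k 1 \<and> k' = drop1 k then of_nat (k 1) * B0 else 0) * mono k')
     + (\<Sum>k'\<in>mons. fps_of_poly (if 0 < k 1 \<and> k' = shift k 1 then of_nat (k 1) * B1 else 0) * mono k')"
    unfolding dmat_def fps_of_poly_add distrib_right sum.distrib fps_of_poly_sum sum_distrib_right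
    by (subst (2) sum.swap) (simp only: simp_thms)
  also have "\<dots> = fps_of_poly (lam k) * mono k
     + (\<Sum>j\<in>{2..q}. if 0 < k j then fps_of_poly (of_nat (k j)) * mono (shift k j) else 0)
     + (if 0 < k 1 then fps_of_poly (of_nat (k 1) * B0) * mono (drop1 k) else 0)
     + (if 0 < k 1 then fps_of_poly (of_nat (k 1) * B1) * mono (shift k 1) else 0)"
  proof -
    have "(\<Sum>j\<in>{2..q}. \<Sum>k'\<in>mons. fps_of_poly (if 0 < k j \<and> k' = shift k j then of_nat (k j) else 0) * mono k')
        = (\<Sum>j\<in>{2..q}. if 0 < k j then fps_of_poly (of_nat (k j)) * mono (shift k j) else 0)"
      by (intro sum.cong[OF refl] pick shift_in_mons assms) auto
    moreover have "(\<Sum>k'\<in>mons. fps_of_poly (if True \<and> k' = k then lam k else 0) * mono k') = fps_of_poly (lam k) * mono k"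
      using pick[of True k "lam k"] assms by simp
    moreover note pick[of "0 < k 1" "drop1 k" "of_nat (k 1) * B0", OF drop1_in_mons[OF assms]]
      pick[of "0 < k 1" "shift k 1" "of_nat (k 1) * B1", OF shift_in_mons[OF assms order.refl q]]
    ultimately show ?thesis by (simp only:)
  qed
  also have "\<dots> = fps_X * fps_deriv (mono k)"
    unfolding euler_mono fps_of_poly_mult fps_of_poly_of_nat ..
  finally show ?thesis ..
qed

text \<open>The constant monomial is the only one with rank 0. Having it in first place supplies the
  component equal to 1 on which the column elimination rests.\<close>

lemma mon_list_0: "mon_list ! 0 = (\<lambda>_. 0)"
proof -
  have "(\<lambda>_. 0) \<in> set mon_list" by (simp add: mon_list(1) mons_def)
  then obtain i where i: "i < mm" "mon_list ! i = (\<lambda>_. 0)" by (metis in_set_conv_nth)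
  define k where "k = mon_list ! 0"
  have "rk k \<le> rk (\<lambda>_. 0)" using rk_mono[of 0 i] i by (simp add: k_def)
  then have lex0: "lex k = 0" by (simp add: rk_def wt_def lex_def lin_def)
  have "k j = 0" for j
  proof (cases "j \<le> q")
    case True
    then show ?thesis using lex0 unfolding lex_def lin_def by (auto simp: Ball_def split: if_splits)
  next
    case False
    moreover have "k \<in> mons" using mon_nth[of 0] i(1) unfolding k_def by (metis gr_zeroI not_less0)
    ultimately show ?thesis by (auto simp: mons_def)
  qed
  then show ?thesis by (auto simp: k_def)
qed

lemma mm_ge_2: "2 \<le> mm"
proof -
  have "{(\<lambda>_::nat. 0::nat), (\<lambda>_. 0)(0 := 1)} \<subseteq> mons"
    using d by (auto simp: mons_def sum.remove[of "{..q}" 0])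
  from card_mono[OF finite_mons this]
  have "card {(\<lambda>_::nat. 0::nat), (\<lambda>_. 0)(0 := 1)} \<le> card mons" .
  moreover have "(\<lambda>_. 0) \<noteq> (\<lambda>_::nat. 0::nat)(0 := 1)" by (metis fun_upd_same zero_neq_one)
  moreover have "card mons = mm" using mon_list(1,2) distinct_card by metis
  ultimately show ?thesis by simp
qed

lemma dmat_int: "of_nat da * coeff (dmat k k') l \<in> \<int>"
proof -
  have nat: "of_nat da * coeff (of_nat x) l \<in> (\<int> :: complex set)" for x by (simp add: of_nat_poly coeff_pCons split: nat.split)
  have natB: "of_nat da * coeff (of_nat x * B) l \<in> \<int>" if "\<And>l. of_nat da * coeff B l \<in> \<int>" for x and B :: "complex poly"
  proof -
    have "of_nat da * coeff (of_nat x * B) l = of_nat x * (of_nat da * coeff B l)" by (simp add: of_nat_poly mult.left_commute)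
    then show ?thesis using that by (simp only: Ints_mult[OF Ints_of_nat])
  qed
  have "of_nat da * coeff (lam k) l \<in> \<int>"
  proof -
    have "of_nat da * (- kap * of_nat x) \<in> \<int>" for x
    proof -
      have "of_nat da * (- kap * of_nat x) = - (of_nat da * kap) * of_nat x" by simp
      then show ?thesis using da(2) by (simp only: Ints_mult Ints_minus Ints_of_nat)
    qed
    then show ?thesis unfolding lam_def coeff_pCons by (auto split: nat.split)
  qed
  then show ?thesis
    unfolding dmat_def coeff_add coeff_sum distrib_left sum_distrib_left
    using nat natB[OF da(3)] natB[OF da(4)] by (intro Ints_add Ints_sum) auto
qed

text \<open>Every stable set contains a form supported on a power of y 0, whose constant term is 1;
  this is the condition of \<open>values_independent\<close>.\<close>

theorem tower_values_independent:
  fixes c :: "(nat \<Rightarrow> nat) \<Rightarrow> int"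
  assumes rel: "(\<Sum>k\<in>mons. of_int (c k) * (\<Prod>j\<le>q. eval_fps (y j) 1 ^ k j)) = 0" and k0: "k0 \<in> mons"
  shows "c k0 = 0"
proof -
  define u where "u i = mono (mon_list ! i)" for i
  have u_growth: "arith_geom (egf (u i))" for i
    unfolding u_def mono_def by (intro arith_geom_egf_prod arith_geom_egf_power growth) auto
  obtain C D where C: "1 \<le> C" "\<And>n. 0 < D n" "\<And>n. D n \<le> C ^ (n + 1)"
    "\<And>i n. i < mm \<Longrightarrow> norm (egf (u i) n) \<le> real C ^ (n + 1)"
    "\<And>i n k. i < mm \<Longrightarrow> k \<le> n \<Longrightarrow> of_nat (D n) * egf (u i) k \<in> \<int>"
  proof -
    have "\<exists>C D. 1 \<le> C \<and> (\<forall>n. 0 < D n \<and> D n \<le> C ^ (n + 1) \<and> (\<forall>i\<in>{..<mm}. norm (egf (u i) n) \<le> real C ^ (n + 1)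
        \<and> (\<forall>k\<le>n. of_nat (D n) * egf (u i) k \<in> \<int>)))"
      by (rule arith_geom_common) (use u_growth in auto)
    then show ?thesis using that by (elim exE conjE) (meson lessThan_iff)
  qed
  define bd where "bd = Max ((\<lambda>(i, j). degree (MA i j)) ` ({..<mm} \<times> {..<mm}))"
  have bd: "degree (MA i j) \<le> bd" if "i < mm" "j < mm" for i j
    unfolding bd_def using that by (intro Max_ge) auto
  interpret SS: siegel_system mm MA u C da bd D
  proof
    show "2 \<le> mm" by (rule mm_ge_2)
    show "u 0 = 1" by (simp add: u_def mon_list_0 mono_def)
    show "fps_X * fps_deriv (u i) = (\<Sum>j<mm. fps_of_poly (MA i j) * u j)" if "i < mm" for i
      unfolding u_def mono_ode[OF mon_nth[OF that]]
      using mon_list_sum[of "\<lambda>k'. fps_of_poly (dmat (mon_list ! i) k') * mono k'"] by simp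
    show "fps_conv_radius (u i) = \<infinity>" if "i < mm" for i by (rule fps_conv_radius_egf[OF u_growth])
  qed (use dmat_int da(1) bd C in auto)
  have eval: "eval_fps (u i) 1 = (\<Prod>j\<le>q. eval_fps (y j) 1 ^ (mon_list ! i) j)" for i
    unfolding u_def mono_def
    by (rule eval_fps_monomial[THEN conjunct1]) (auto intro: fps_conv_radius_egf growth)
  obtain i0 where i0: "i0 < mm" "mon_list ! i0 = k0" using k0 mon_list(1) by (metis in_set_conv_nth)
  have "(\<lambda>i. c (mon_list ! i)) i0 = 0"
  proof (rule SS.values_independent[OF _ _ i0(1)])
    fix S :: "(nat \<Rightarrow> complex poly) set"
    assume S: "\<exists>G\<in>S. \<exists>i<mm. G i \<noteq> 0"
      "\<And>G H a b. G \<in> S \<Longrightarrow> H \<in> S \<Longrightarrow> (\<lambda>i. a * G i + b * H i) \<in> S" "\<And>G. G \<in> S \<Longrightarrow> nabf G \<in> S"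
    obtain G \<mu> where G: "G \<in> S" "\<mu> < mm" "G \<mu> \<noteq> 0" "\<And>i. i < mm \<Longrightarrow> i \<noteq> \<mu> \<Longrightarrow> G i = 0"
      and z: "\<And>j. 1 \<le> j \<Longrightarrow> (mon_list ! \<mu>) j = 0" by (rule stable_contains_exponential[OF S]) meson+
    have "u \<mu> = (\<Prod>j\<in>{0}. y j ^ (mon_list ! \<mu>) j)"
      unfolding u_def mono_def using z by (intro prod.mono_neutral_right) auto
    then have "fps_nth (u \<mu>) 0 = 1" using y0(2) by (simp add: fps_power_zeroth)
    then show "\<exists>G\<in>S. \<exists>\<mu><mm. G \<mu> \<noteq> 0 \<and> (\<forall>i<mm. i \<noteq> \<mu> \<longrightarrow> G i = 0) \<and> fps_nth (u \<mu>) 0 \<noteq> 0"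
      using G by (intro bexI[of _ G] exI[of _ \<mu>]) auto
  next
    show "(\<Sum>i<mm. of_int (c (mon_list ! i)) * eval_fps (u i) 1) = 0"
      unfolding eval using rel mon_list_sum[of "\<lambda>k. of_int (c k) * (\<Prod>j\<le>q. eval_fps (y j) 1 ^ k j)"] by simp
  qed
  then show ?thesis using i0(2) by simp
qed

end

section \<open>Arithmetic of binomial and logarithmic series\<close>

lemma prod_primes_dvd:
  fixes N :: nat
  assumes "finite S" "\<And>p. p \<in> S \<Longrightarrow> prime p \<and> p dvd N"
  shows "\<Prod>S dvd N"
  using assms
proof (induction S)
  case (insert p S)
  have "coprime p (\<Prod>S)"
    by (rule prod_coprime_right) (metis insert.hyps(2) insert.prems insertCI primes_coprime)
  then show ?case using insert by (simp add: divides_mult)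
qed simp

definition primorial :: "nat \<Rightarrow> nat" where
  "primorial n = \<Prod>{p. prime p \<and> p \<le> n}"

lemma finite_primes_le: "finite {p. prime p \<and> p \<le> (n::nat)}"
  by (rule finite_subset[of _ "{..n}"]) auto

text \<open>Two equal middle coefficients share a row with sum 2^(2 m + 1).\<close>

lemma binomial_odd_le: "(2 * m + 1) choose m \<le> 4 ^ m"
proof -
  have "2 * ((2 * m + 1) choose m) = (\<Sum>k\<in>{m, m + 1}. (2 * m + 1) choose k)"
    using binomial_symmetric[of m "2 * m + 1"] by simp
  also have "\<dots> \<le> (\<Sum>k\<le>2 * m + 1. (2 * m + 1) choose k)" by (intro sum_mono2) auto
  also have "\<dots> = 2 * 4 ^ m" by (simp only: choose_row_sum) (simp add: power_mult)
  finally show ?thesis by simp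
qed

text \<open>Erdos's induction. An even n > 2 is not prime. For n = 2 m + 1 the primes between m + 2
  and n divide \<open>n choose m\<close>, which is at most 4^m, and the other primes are covered by
  m + 1.\<close>

lemma primorial_le: "primorial n \<le> 4 ^ n"
proof (induction n rule: less_induct)
  case (less n)
  have "n < 2 \<or> n = 2 \<or> n > 2 \<and> even n \<or> n > 2 \<and> odd n" by auto
  moreover have "\<exists>m\<ge>1. n = 2 * m + 1" if "n > 2" "odd n" using that by (auto elim!: oddE)
  ultimately consider "n < 2" | "n = 2" | "n > 2" "even n" | m where "n = 2 * m + 1" "m \<ge> 1" by blast
  then show ?case
  proof cases
    case 1
    have "\<not> (prime p \<and> p \<le> n)" for p using 1 prime_ge_2_nat[of p] by auto
    then have "{p. prime p \<and> p \<le> n} = {}" by blast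
    then have "primorial n = 1" unfolding primorial_def by (simp only: prod.empty)
    then show ?thesis by simp
  next
    case 2
    have "prime p \<and> p \<le> n \<longleftrightarrow> p = 2" for p using 2 prime_ge_2_nat[of p] by auto
    then have "{p. prime p \<and> p \<le> n} = {2}" by blast
    then have "primorial n = 2" unfolding primorial_def by simp
    then show ?thesis by (simp add: 2)
  next
    case 3
    have "{p. prime p \<and> p \<le> n} = {p. prime p \<and> p \<le> n - 1}"
      using 3 prime_odd_nat[of n] by (auto simp: le_eq_less_or_eq)
    then have "primorial n = primorial (n - 1)" by (simp add: primorial_def)
    also have "\<dots> \<le> 4 ^ (n - 1)" using 3 by (intro less) auto
    also have "\<dots> \<le> 4 ^ n" by (intro power_increasing) auto
    finally show ?thesis .
  next
    case (4 m)
    let ?B = "{p. prime p \<and> m + 1 < p \<and> p \<le> n}"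
    have fin: "finite ?B" by (rule finite_subset[of _ "{..n}"]) auto
    have "{p. prime p \<and> p \<le> n} = {p. prime p \<and> p \<le> m + 1} \<union> ?B" using 4 by auto
    then have "primorial n = primorial (m + 1) * \<Prod>?B"
      unfolding primorial_def using fin finite_primes_le by (simp only:) (subst prod.union_disjoint, auto)
    also have "\<Prod>?B \<le> n choose m"
    proof (rule dvd_imp_le)
      show "\<Prod>?B dvd n choose m"
      proof (rule prod_primes_dvd[OF fin])
        fix p assume p: "p \<in> ?B"
        have "fact m * fact (n - m) * (n choose m) = (fact n :: nat)" using 4 by (intro binomial_fact_lemma) auto
        moreover have "p dvd (fact n :: nat)" using p by (auto simp: prime_dvd_fact_iff)
        moreover have "\<not> p dvd (fact m :: nat)" "\<not> p dvd (fact (n - m) :: nat)"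
        proof -
          have "n - m = m + 1" using 4 by simp
          then show "\<not> p dvd (fact m :: nat)" "\<not> p dvd (fact (n - m) :: nat)"
            using p prime_dvd_fact_iff[of p m] prime_dvd_fact_iff[of p "m + 1"] by (auto simp del: fact_Suc)
        qed
        ultimately show "prime p \<and> p dvd n choose m" using p by (metis (mono_tags, lifting) mem_Collect_eq prime_dvd_mult_iff)
      qed
      show "n choose m > 0" using 4 by simp
    qed
    also have "n choose m \<le> 4 ^ m" unfolding 4 by (rule binomial_odd_le)
    also have "primorial (m + 1) \<le> 4 ^ (m + 1)" using 4 by (intro less) auto
    also have "4 ^ (m + 1) * 4 ^ m = (4::nat) ^ n" unfolding 4 by (simp flip: power_add add: mult_2)
    finally show ?thesis by simp
  qed
qed

lemma squarefree_dvd_primorial: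
  assumes "squarefree s" "s \<le> n"
  shows "s dvd primorial n"
proof -
  have s: "s \<noteq> 0" using assms by (intro notI) simp
  have s_eq: "s = \<Prod>(prime_factors s)"
  proof -
    have "s = (\<Prod>p\<in>prime_factors s. p ^ multiplicity p s)" using prime_factorization_nat s by blast
    also have "\<dots> = (\<Prod>p\<in>prime_factors s. p)"
    proof (rule prod.cong[OF refl])
      fix p assume p: "p \<in> prime_factors s"
      have "multiplicity p s \<le> 1" 
        using assms(1) s in_prime_factors_imp_prime[OF p] by (simp add: squarefree_factorial_semiring'')
      moreover have "0 < multiplicity p s" using p by (simp add: prime_factors_multiplicity)
      ultimately have "multiplicity p s = 1" by simp
      then show "p ^ multiplicity p s = p" by simp
    qed
    finally show ?thesis .
  qed
  have "prime_factors s \<subseteq> {p. prime p \<and> p \<le> n}"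
    using assms(2) s by (auto simp: prime_factors_dvd dest!: dvd_imp_le)
  then have "\<Prod>(prime_factors s) dvd primorial n"
    unfolding primorial_def by (intro prod_dvd_prod_subset finite_primes_le)
  then show ?thesis using s_eq by simp
qed

abbreviation lcm_upto :: "nat \<Rightarrow> nat" where "lcm_upto n \<equiv> Lcm {1..n}"

lemma lcm_upto_pos: "0 < lcm_upto n"
  by (simp add: Lcm_0_iff_nat neq0_conv[symmetric] del: neq0_conv)

text \<open>Writing \<open>j \<le> n\<close> as a squarefree number times a square shows that \<open>lcm_upto n\<close> divides
  \<open>primorial n * (lcm_upto (sqrt n))\<^sup>2\<close>.\<close>

lemma lcm_upto_le: "lcm_upto n \<le> 16 ^ n"
proof (induction n rule: less_induct)
  case (less n)
  show ?case
  proof (cases "n < 16")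
    case True
    have "lcm_upto n dvd fact n" by (rule Lcm_least) (auto intro: dvd_fact)
    then have "lcm_upto n \<le> fact n" by (intro dvd_imp_le) auto
    also have "\<dots> \<le> n ^ n" using fact_le_power[of n, where 'a = nat] by simp
    also have "\<dots> \<le> 16 ^ n" using True by (intro power_mono) auto
    finally show ?thesis .
  next
    case False
    define w where "w = floor_sqrt n"
    have w2: "w ^ 2 \<le> n" by (simp add: w_def)
    \<comment> \<open>From n \<ge> 16 onwards 4 w \<le> n, so the inductive bound for the square is
      at most 4^n, matching the 4^n of the primorial.\<close>
    have w4: "4 * w \<le> n"
    proof (cases "4 \<le> w")
      case True
      then have "4 * w \<le> w * w" by (rule mult_right_mono) simp
      then show ?thesis using w2 unfolding power2_eq_square by linarith
    next
      case False
      then show ?thesis using \<open>\<not> n < 16\<close> by simp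
    qed
    have "lcm_upto n dvd primorial n * lcm_upto w ^ 2"
    proof (rule Lcm_least)
      fix j assume j: "j \<in> {1..n}"
      define s t where "s = squarefree_part j" and "t = square_part j"
      have st: "j = s * t ^ 2" unfolding s_def t_def by (rule squarefree_decompose)
      have "s \<noteq> 0" "t \<noteq> 0" using j by (auto simp: s_def t_def)
      then have "s \<le> j" "t ^ 2 \<le> j" using st by auto
      then have "s \<le> n" "t ^ 2 \<le> n" using j by auto
      then have "t \<le> w" unfolding w_def by (simp add: le_floor_sqrt_iff)
      then have "t dvd lcm_upto w" using \<open>t \<noteq> 0\<close> by (intro dvd_Lcm) auto
      moreover have "s dvd primorial n" using \<open>s \<le> n\<close> by (intro squarefree_dvd_primorial) (auto simp: s_def)
      ultimately show "j dvd primorial n * lcm_upto w ^ 2" unfolding st by (intro mult_dvd_mono dvd_power_same)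
    qed
    moreover have "0 < primorial n" unfolding primorial_def by (intro prod_pos) (auto simp: prime_gt_0_nat)
    ultimately have "lcm_upto n \<le> primorial n * lcm_upto w ^ 2" using lcm_upto_pos[of w] by (intro dvd_imp_le) auto
    also have "\<dots> \<le> 4 ^ n * (16 ^ w) ^ 2"
      using w4 False by (intro mult_mono power_mono primorial_le less) auto
    also have "(16 ^ w) ^ 2 = (4::nat) ^ (4 * w)" 
    proof -
      have "(16::nat) = 4 ^ 2" by simp
      then show ?thesis by (simp only: power_mult[symmetric]) (simp add: mult.commute)
    qed
    also have "\<dots> \<le> 4 ^ n" using w4 by (intro power_increasing) auto
    finally show ?thesis by (simp flip: power_mult_distrib)
  qed
qed

section \<open>Denominators of logarithmic, binomial and reciprocal series\<close>

lemma arith_geom_fps_mult: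
  assumes "arith_geom (fps_nth f)" "arith_geom (fps_nth g)"
  shows "arith_geom (fps_nth (f * g))"
proof -
  have "arith_geom (\<lambda>n. \<Sum>k\<le>n. of_nat 1 * fps_nth f k * fps_nth g (n - k))"
    using assms by (rule arith_geom_convolution) simp
  moreover have "fps_nth (f * g) = (\<lambda>n. \<Sum>k\<le>n. of_nat 1 * fps_nth f k * fps_nth g (n - k))"
    by (simp add: fps_mult_nth atLeast0AtMost fun_eq_iff)
  ultimately show ?thesis by (simp only:)
qed

lemma arith_geom_fps_1: "arith_geom (fps_nth 1)"
  by (rule arith_geomI[where D = "\<lambda>_. 1" and C = 1 and C' = 1]) auto

lemma arith_geom_fps_power: "arith_geom (fps_nth f) \<Longrightarrow> arith_geom (fps_nth (f ^ n))"
  by (induction n) (simp_all add: arith_geom_fps_mult arith_geom_fps_1)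

lemma arith_geom_fps_ln: "arith_geom (fps_nth (fps_ln 1))"
proof (rule arith_geomI[where D = lcm_upto and C = 16 and C' = 1])
  show "0 < lcm_upto n" for n by (rule lcm_upto_pos)
  show "lcm_upto n \<le> 16 ^ (n + 1)" for n
    using lcm_upto_le[of n] power_increasing[of n "n + 1" "16::nat"] by linarith
  show "norm (fps_nth (fps_ln (1::complex)) n) \<le> real 1 ^ (n + 1)" for n
    by (auto simp: fps_ln_nth norm_divide norm_power field_simps)
  show "of_nat (lcm_upto n) * fps_nth (fps_ln (1::complex)) k \<in> \<int>" if "k \<le> n" for n k
  proof (cases "k = 0")
    case False
    then have "k dvd lcm_upto n" using that by (intro dvd_Lcm) auto
    then obtain c where "lcm_upto n = k * c" by (auto elim: dvdE)
    then have "of_nat (lcm_upto n) * fps_nth (fps_ln (1::complex)) k = of_nat c * (- 1) ^ (k - 1)"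
      using False by (simp add: fps_ln_nth)
    then show ?thesis by simp
  qed simp
qed

text \<open>Rescaling by \<open>q\<^sup>2\<close> makes the binomial series of exponent \<open>1/q\<close> integral: the rescaled
  series is \<open>1 + q H\<close>, and expanding \<open>(1 + q H) ^ q = 1 + q\<^sup>2 X\<close> expresses the coefficients of
  \<open>H\<close> as integral polynomials in the previous ones.\<close>

lemma binomial_root_int:
  assumes q: "0 < q"
  shows "of_nat q ^ (2 * n) * ((1 / of_nat q :: complex) gchoose n) \<in> \<int>"
proof -
  let ?c = "of_nat q ^ 2 :: complex"
  define G where "G = fps_compose (fps_binomial (1 / of_nat q)) (fps_const ?c * fps_X)"
  have G_nth: "fps_nth G n = of_nat q ^ (2 * n) * ((1 / of_nat q) gchoose n)" for n
    by (simp add: G_def fps_compose_linear power_mult)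
  have "fps_binomial (1 / of_nat q :: complex) ^ q = fps_binomial 1" using q by (simp add: fps_binomial_power)
  moreover have "G ^ q = fps_compose (fps_binomial (1 / of_nat q) ^ q) (fps_const ?c * fps_X)"
    unfolding G_def by (rule fps_compose_power) simp
  ultimately have Gq: "G ^ q = 1 + fps_const ?c * fps_X"
    by (simp add: fps_binomial_1 fps_compose_add_distrib)
  define H where "H = fps_const (1 / of_nat q) * (G - 1)"
  have GH: "G = 1 + fps_const (of_nat q) * H" using q by (simp add: H_def flip: mult.assoc)
  have H0: "fps_nth H 0 = 0" by (simp add: H_def G_nth)
  have "G ^ q = (\<Sum>k\<le>q. of_nat (q choose k) * (fps_const (of_nat q) * H) ^ k)"
    unfolding GH by (subst add.commute) (simp add: binomial_ring)
  also have "{..q} = insert 0 (insert 1 {2..q})" using q by auto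
  also have "(\<Sum>k\<in>insert 0 (insert 1 {2..q}). of_nat (q choose k) * (fps_const (of_nat q) * H) ^ k)
      = 1 + fps_const ?c * H + (\<Sum>k\<in>{2..q}. of_nat (q choose k) * (fps_const (of_nat q) * H) ^ k)"
    by (simp add: power2_eq_square fps_of_nat[symmetric] mult.assoc[symmetric])
  also have "(\<Sum>k\<in>{2..q}. of_nat (q choose k) * (fps_const (of_nat q) * H) ^ k)
      = fps_const ?c * (\<Sum>k\<in>{2..q}. of_nat ((q choose k) * q ^ (k - 2)) * H ^ k)"
    unfolding sum_distrib_left
  proof (rule sum.cong[OF refl])
    fix k assume "k \<in> {2..q}"
    then have "k = 2 + (k - 2)" by (metis atLeastAtMost_iff le_add_diff_inverse)
    then have eq: "(of_nat q :: complex) ^ k = of_nat q ^ 2 * of_nat q ^ (k - 2)" by (metis power_add)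
    have "(fps_const (of_nat q :: complex) * H) ^ k = fps_const (of_nat q ^ k) * H ^ k"
      by (simp only: power_mult_distrib fps_const_power)
    also have "fps_const (of_nat q ^ k) = fps_const ?c * fps_const (of_nat q ^ (k - 2))"
      unfolding eq fps_const_mult ..
    finally have 1: "(fps_const (of_nat q :: complex) * H) ^ k = fps_const ?c * fps_const (of_nat q ^ (k - 2)) * H ^ k" .
    have 2: "(of_nat ((q choose k) * q ^ (k - 2)) :: complex fps) = of_nat (q choose k) * fps_const (of_nat q ^ (k - 2))"
      by (simp only: of_nat_mult of_nat_power fps_of_nat[symmetric] fps_const_power fps_const_mult)
    show "of_nat (q choose k) * (fps_const (of_nat q) * H) ^ k
        = fps_const ?c * (of_nat ((q choose k) * q ^ (k - 2)) * H ^ k)"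
      unfolding 1 2 by (simp only: mult_ac)
  qed
  finally have "1 + fps_const ?c * (H + (\<Sum>k\<in>{2..q}. of_nat ((q choose k) * q ^ (k - 2)) * H ^ k)) = 1 + fps_const ?c * fps_X"
    unfolding Gq distrib_left add.assoc by (rule sym)
  then have "fps_const ?c * (H + (\<Sum>k\<in>{2..q}. of_nat ((q choose k) * q ^ (k - 2)) * H ^ k)) = fps_const ?c * fps_X"
    by (simp only: add_left_cancel)
  moreover have "fps_const ?c \<noteq> 0" using q by simp
  ultimately have H_eq: "H + (\<Sum>k\<in>{2..q}. of_nat ((q choose k) * q ^ (k - 2)) * H ^ k) = fps_X"
    by (simp only: mult_cancel_left simp_thms)
  have pow_int: "fps_nth (H ^ k) j \<in> \<int>" if "\<And>i. i \<le> j \<Longrightarrow> fps_nth H i \<in> \<int>" for k j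
    using that
  proof (induction k arbitrary: j)
    case (Suc k)
    show ?case unfolding power_Suc fps_mult_nth
      by (intro Ints_sum Ints_mult Suc) auto
  qed (auto simp: fps_one_nth)
  have H_int: "fps_nth H n \<in> \<int>" for n
  proof (induction n rule: less_induct)
    case (less n)
    have "fps_nth (H ^ k) n \<in> \<int>" if k: "k \<in> {2..q}" for k
    proof -
      have "2 \<le> k" using k by simp
      then have "k = Suc (Suc (k - 2))" by arith
      then obtain k' where k': "k = Suc (Suc k')" by blast
      have "fps_nth (H ^ k) n = (\<Sum>i=0..n. fps_nth H i * fps_nth (H ^ Suc k') (n - i))"
        unfolding k' power_Suc[of _ "Suc k'"] fps_mult_nth ..
      also have "\<dots> \<in> \<int>"
      proof (rule Ints_sum)
        fix i assume i: "i \<in> {0..n}"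
        have S0: "fps_nth (H ^ Suc k') 0 = 0" using H0 by simp
        \<comment> \<open>Both extreme terms contain the constant coefficient of a positive power of
          \<open>H\<close>, which is 0; only coefficients of index below n remain.\<close>
        consider "i = 0" | "i = n" | "0 < i" "i < n" using i by fastforce
        then show "fps_nth H i * fps_nth (H ^ Suc k') (n - i) \<in> \<int>"
        proof cases
          case 1 then show ?thesis by (simp add: H0)
        next
          case 2
          then have "fps_nth (H ^ Suc k') (n - i) = 0" using S0 by (simp only: diff_self_eq_0)
          then show ?thesis by (simp only: mult_zero_right Ints_0)
        next
          case 3
          then show ?thesis using less by (intro Ints_mult pow_int) auto
        qed
      qed
      finally show ?thesis .
    qed
    then have "fps_nth (\<Sum>k\<in>{2..q}. of_nat ((q choose k) * q ^ (k - 2)) * H ^ k) n \<in> \<int>"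
      unfolding fps_sum_nth fps_of_nat[symmetric] fps_mult_left_const_nth by (intro Ints_sum Ints_mult) auto
    moreover have "fps_nth H n = fps_nth fps_X n - fps_nth (\<Sum>k\<in>{2..q}. of_nat ((q choose k) * q ^ (k - 2)) * H ^ k) n"
      using arg_cong[OF H_eq, of "\<lambda>f. fps_nth f n"] by (simp only: fps_add_nth) (simp only: eq_diff_eq)
    ultimately show ?case by (simp only: Ints_diff fps_X_nth) (auto intro!: Ints_diff split: if_splits)
  qed
  have "fps_nth G n = (if n = 0 then 1 else 0) + of_nat q * fps_nth H n" unfolding GH by (simp add: fps_one_nth)
  also have "\<dots> \<in> \<int>" using H_int by (intro Ints_add Ints_mult) auto
  finally show ?thesis by (simp add: G_nth)
qed

lemma arith_geom_binomial_root:
  assumes q: "0 < q"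
  shows "arith_geom (fps_nth (fps_binomial (1 / of_nat q)))"
proof (rule arith_geomI[where D = "\<lambda>n. q ^ (2 * n)" and C = "q ^ 2" and C' = 1])
  show "0 < q ^ (2 * n)" for n using q by simp
  show "q ^ (2 * n) \<le> (q ^ 2) ^ (n + 1)" for n
    unfolding power_mult[symmetric] using q by (intro power_increasing) auto
  show "norm (fps_nth (fps_binomial (1 / of_nat q :: complex)) n) \<le> real 1 ^ (n + 1)" for n
  proof -
    have "(\<Prod>i = 0..<n. norm (1 / of_nat q - of_nat i :: complex)) \<le> (\<Prod>i = 0..<n. real (i + 1))"
    proof (rule prod_mono)
      fix i assume "i \<in> {0..<n}"
      have "norm (1 / of_nat q - of_nat i :: complex) \<le> norm (1 / of_nat q :: complex) + norm (of_nat i :: complex)"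
        by (rule norm_triangle_ineq4)
      also have "norm (1 / of_nat q :: complex) \<le> 1" using q by (simp add: norm_divide)
      finally show "0 \<le> norm (1 / of_nat q - of_nat i :: complex) \<and> norm (1 / of_nat q - of_nat i :: complex) \<le> real (i + 1)" by simp
    qed
    also have "\<dots> = fact n" unfolding fact_prod_Suc by simp
    finally show ?thesis by (simp add: gbinomial_prod_rev norm_divide flip: prod_norm)
  qed
  show "of_nat (q ^ (2 * n)) * fps_nth (fps_binomial (1 / of_nat q :: complex)) k \<in> \<int>" if "k \<le> n" for n k
  proof -
    have "of_nat (q ^ (2 * n)) * ((1 / of_nat q :: complex) gchoose k)
        = of_nat (q ^ (2 * (n - k))) * (of_nat q ^ (2 * k) * ((1 / of_nat q) gchoose k))"
      using that by (simp add: mult.assoc[symmetric] flip: power_add distrib_left)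
    also have "\<dots> \<in> \<int>" by (rule Ints_mult[OF Ints_of_nat binomial_root_int[OF q]])
    finally show ?thesis by simp
  qed
qed

lemma arith_geom_binomial_minus_one: "arith_geom (fps_nth (fps_binomial (- 1)))"
  unfolding fps_binomial_minus_one fps_inverse_fps_X_plus1
  by (rule arith_geomI[where D = "\<lambda>_. 1" and C = 1 and C' = 1]) (auto simp: norm_power)

lemma positive_rat_as_fraction:
  assumes "a > 0"
  obtains p q :: nat where "0 < p" "0 < q" "of_rat a = (of_nat p / of_nat q :: 'a::field_char_0)"
proof -
  obtain p q where pq: "quotient_of a = (p, q)" by (cases "quotient_of a") auto
  have q: "0 < q" using quotient_of_denom_pos[OF pq] .
  have a: "a = of_int p / of_int q" using quotient_of_div[OF pq] .
  have p: "0 < p" using assms q unfolding a by (simp add: zero_less_divide_iff)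
  show thesis by (rule that[of "nat p" "nat q"]) (use p q in \<open>simp_all add: a of_rat_divide\<close>)
qed

text \<open>For a = p / q the binomial series of exponent a - 1 is the p-th power of that of
  exponent 1 / q times that of exponent -1.\<close>

lemma arith_geom_binomial_log:
  assumes "a > 0"
  shows "arith_geom (fps_nth (fps_binomial (of_rat a - 1) * fps_ln 1 ^ s))"
proof -
  obtain p q :: nat where pq: "0 < p" "0 < q" "of_rat a = (of_nat p / of_nat q :: complex)"
    using positive_rat_as_fraction[OF assms] .
  then have "fps_binomial (of_rat a - 1 :: complex) = fps_binomial (1 / of_nat q) ^ p * fps_binomial (- 1)"
    by (simp add: fps_binomial_power flip: fps_binomial_add_mult)
  then show ?thesis
    using pq(2) by (auto intro!: arith_geom_fps_mult arith_geom_fps_power arith_geom_fps_ln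
        arith_geom_binomial_root arith_geom_binomial_minus_one)
qed

text \<open>With a = p / q, each a + k is (p + q k) / q, and all p + q k with k \<le> n divide the
  least common multiple up to p + q n, which is geometric in n.\<close>

lemma arith_geom_reciprocal_powers:
  assumes a: "a > 0"
  shows "arith_geom (\<lambda>n. (- 1) ^ n / (of_rat a + of_nat n) ^ j)"
proof -
  obtain p q :: nat where pq0: "0 < p" "0 < q" and a': "of_rat a = (of_nat p / of_nat q :: complex)"
    using positive_rat_as_fraction[OF a] .
  have eq: "(- 1) ^ n / (of_rat a + of_nat n :: complex) ^ j = (- 1) ^ n * of_nat (q ^ j) / of_nat ((p + q * n) ^ j)" for n :: nat
  proof -
    have "of_rat a + of_nat n = (of_nat (p + q * n) / of_nat q :: complex)"
      using pq0 unfolding a' by (simp add: add_divide_distrib)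
    then show ?thesis by (simp add: power_divide)
  qed
  show ?thesis
    unfolding eq
  proof (rule arith_geomI[where D = "\<lambda>n. lcm_upto (p + q * n) ^ j" and C = "16 ^ ((p + q) * j)" and C' = "q ^ j"])
    fix n
    show "0 < lcm_upto (p + q * n) ^ j" using lcm_upto_pos by simp
    have "lcm_upto (p + q * n) ^ j \<le> (16 ^ (p + q * n)) ^ j" by (intro power_mono lcm_upto_le) auto
    also have "\<dots> = 16 ^ ((p + q * n) * j)" by (simp add: power_mult)
    also have "\<dots> \<le> 16 ^ ((p + q) * j * (n + 1))" by (intro power_increasing) (auto simp: algebra_simps)
    finally show "lcm_upto (p + q * n) ^ j \<le> (16 ^ ((p + q) * j)) ^ (n + 1)" by (simp only: power_mult)
    have "norm ((- 1) ^ n * of_nat (q ^ j) / of_nat ((p + q * n) ^ j) :: complex) = real (q ^ j) / real ((p + q * n) ^ j)"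
      by (simp only: norm_divide norm_mult norm_power norm_minus_cancel norm_one power_one mult_1 norm_of_nat)
    also have "\<dots> \<le> real (q ^ j)" using pq0 by (simp add: divide_le_eq Suc_le_eq one_le_power mult_le_cancel_left1 del: of_nat_power)
    also have "\<dots> \<le> real (q ^ j) ^ (n + 1)"
      using pq0 by (intro self_le_power) (auto simp: Suc_le_eq simp flip: of_nat_power)
    finally show "norm ((- 1) ^ n * of_nat (q ^ j) / of_nat ((p + q * n) ^ j) :: complex) \<le> real (q ^ j) ^ (n + 1)" .
    fix k assume "k \<le> n"
    then have "p + q * k \<in> {1..p + q * n}" using pq0 by auto
    then have "(p + q * k) dvd lcm_upto (p + q * n)" by (rule dvd_Lcm)
    then have "(p + q * k) ^ j dvd lcm_upto (p + q * n) ^ j" by (rule dvd_power_same)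
    then obtain c where c: "lcm_upto (p + q * n) ^ j = (p + q * k) ^ j * c" by (auto elim: dvdE)
    have "of_nat (lcm_upto (p + q * n) ^ j) * ((- 1) ^ k * of_nat (q ^ j) / of_nat ((p + q * k) ^ j))
        = (- 1) ^ k * of_nat (q ^ j) * (of_nat c :: complex)"
    proof -
      have "(of_nat ((p + q * k) ^ j) :: complex) \<noteq> 0" using pq0 by (simp only: of_nat_eq_0_iff) simp
      moreover have "(x * z) * (y / x) = y * z" if "x \<noteq> 0" for x y z :: complex using that by simp
      ultimately show ?thesis unfolding c of_nat_mult by blast
    qed
    then show "of_nat (lcm_upto (p + q * n) ^ j) * ((- 1) ^ k * of_nat (q ^ j) / of_nat ((p + q * k) ^ j)) \<in> (\<int> :: complex set)"
      by (simp only: Ints_mult Ints_of_nat Ints_power Ints_minus Ints_1)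
  qed
qed

section \<open>Derivatives of the Gamma function\<close>

lemma continuous_bounded_absolutely_integrable:
  fixes f :: "real \<Rightarrow> 'b::euclidean_space"
  assumes "continuous_on S f" "S \<in> sets lebesgue" "g integrable_on S" "\<And>x. x \<in> S \<Longrightarrow> norm (f x) \<le> g x"
  shows "f absolutely_integrable_on S"
  by (rule measurable_bounded_by_integrable_imp_absolutely_integrable[OF
        continuous_imp_measurable_on_sets_lebesgue[OF assms(1,2)] assms(2-4)])

abbreviation gamma_log_integrand :: "real \<Rightarrow> nat \<Rightarrow> real \<Rightarrow> real" where
  "gamma_log_integrand a s t \<equiv> t powr (a - 1) * ln t ^ s * exp (- t)"

text \<open>The factor exp (c |ln t|) dominates all partial sums of t^w in powers of ln t for |w|
  \<le> c, and each single power of ln t up to a constant. It is at most t^c + t^(-c), which only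
  moves \<open>a\<close> within the positive numbers.\<close>

lemma gamma_majorant:
  fixes a c :: real
  assumes "0 < a" "0 < c" "c < a"
  shows "(\<lambda>t. t powr (a - 1) * exp (c * \<bar>ln t\<bar>) * exp (- t)) integrable_on {0<..}"
proof -
  have pw: "(\<lambda>t. t powr (b - 1) * exp (- t)) integrable_on {0<..}" if "0 < b" for b :: real
  proof -
    have "(\<lambda>t. t powr (b - 1) / exp t) integrable_on {0..}" using Gamma_integral_real[OF that] by blast
    then have "(\<lambda>t. t powr (b - 1) / exp t) integrable_on {0<..}"
      by (rule integrable_spike_set) (rule negligible_subset[of "{0}"], simp, force)+
    then show ?thesis by (simp add: exp_minus field_simps)
  qed
  have maj: "(\<lambda>t. t powr (a + c - 1) * exp (- t) + t powr (a - c - 1) * exp (- t)) integrable_on {0<..}"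
    using integrable_add[OF pw[of "a + c"] pw[of "a - c"]] assms by simp
  have "(\<lambda>t. t powr (a - 1) * exp (c * \<bar>ln t\<bar>) * exp (- t)) absolutely_integrable_on {0<..}"
  proof (rule continuous_bounded_absolutely_integrable[OF _ _ maj])
    show "continuous_on {0<..} (\<lambda>t. t powr (a - 1) * exp (c * \<bar>ln t\<bar>) * exp (- t))"
      by (intro continuous_intros) auto
    fix t :: real assume "t \<in> {0<..}"
    then have t: "0 < t" by simp
    have "exp (c * \<bar>ln t\<bar>) \<le> exp (c * ln t) + exp (- c * ln t)"
      by (cases "0 \<le> ln t") (auto simp: abs_if)
    then have "t powr (a - 1) * exp (c * \<bar>ln t\<bar>) * exp (- t) \<le> t powr (a - 1) * (exp (c * ln t) + exp (- c * ln t)) * exp (- t)"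
      by (intro mult_right_mono mult_left_mono) auto
    also have "\<dots> = t powr (a + c - 1) * exp (- t) + t powr (a - c - 1) * exp (- t)"
      using t by (simp add: powr_def algebra_simps flip: exp_add)
    finally show "norm (t powr (a - 1) * exp (c * \<bar>ln t\<bar>) * exp (- t)) \<le> \<dots>" by simp
  qed auto
  then show ?thesis by (rule set_lebesgue_integral_eq_integral)
qed

lemma gamma_log_absolutely_integrable:
  assumes "0 < a"
  shows "gamma_log_integrand a s absolutely_integrable_on {0<..}"
proof -
  define c where "c = a / 2"
  have c: "0 < c" "c < a" using assms by (auto simp: c_def)
  have maj: "(\<lambda>t. fact s / c ^ s * (t powr (a - 1) * exp (c * \<bar>ln t\<bar>) * exp (- t))) integrable_on {0<..}"
    by (intro integrable_on_mult_right gamma_majorant assms c)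
  show ?thesis
  proof (rule continuous_bounded_absolutely_integrable[OF _ _ maj])
    show "continuous_on {0<..} (gamma_log_integrand a s)" by (intro continuous_intros) auto
    fix t :: real assume "t \<in> {0<..}"
    have "(c * \<bar>ln t\<bar>) ^ s \<le> fact s * exp (c * \<bar>ln t\<bar>)"
      using c by (intro power_le_fact_exp) simp
    then have "\<bar>ln t\<bar> ^ s \<le> fact s / c ^ s * exp (c * \<bar>ln t\<bar>)" using c by (simp add: power_mult_distrib field_simps)
    then have "t powr (a - 1) * \<bar>ln t\<bar> ^ s * exp (- t) \<le> t powr (a - 1) * (fact s / c ^ s * exp (c * \<bar>ln t\<bar>)) * exp (- t)"
      by (intro mult_right_mono mult_left_mono) auto
    then show "norm (gamma_log_integrand a s t) \<le> fact s / c ^ s * (t powr (a - 1) * exp (c * \<bar>ln t\<bar>) * exp (- t))"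
      by (simp add: abs_mult power_abs mult_ac)
  qed auto
qed

text \<open>Expanding t^w = exp (w ln t) under Euler's integral exhibits the logarithmic integrals
  as Taylor coefficients, which avoids repeated differentiation under the integral sign.\<close>

lemma gamma_taylor:
  assumes a: "0 < a" and w: "norm w < a"
  shows "(\<lambda>s. of_real (integral {0<..} (gamma_log_integrand a s) / fact s) * w ^ s) sums Gamma (of_real a + w :: complex)"
proof -
  define f where "f N t = (\<Sum>s<N. of_real (gamma_log_integrand a s t) * w ^ s / fact s)" for N :: nat and t
  define g where "g t = of_real t powr (of_real a + w - 1) / of_real (exp t)" for t :: real
  \<comment> \<open>\<open>c\<close> must be positive, at least \<open>norm w\<close> and below
    \<open>a\<close>; the term a / 2 takes care of w = 0.\<close>
  define c where "c = max (norm w) (a / 2)"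
  have c: "0 < c" "c < a" "norm w \<le> c" using a w by (auto simp: c_def)
  have trm: "((\<lambda>t. of_real (gamma_log_integrand a s t) * w ^ s / fact s) has_integral
      of_real (integral {0<..} (gamma_log_integrand a s) / fact s) * w ^ s) {0<..}" for s
  proof -
    have "(gamma_log_integrand a s has_integral integral {0<..} (gamma_log_integrand a s)) {0<..}"
      using gamma_log_absolutely_integrable[OF a] by (intro integrable_integral set_lebesgue_integral_eq_integral)
    then have "((\<lambda>t. complex_of_real (gamma_log_integrand a s t)) has_integral of_real (integral {0<..} (gamma_log_integrand a s))) {0<..}"
      by (rule has_integral_of_real)
    from has_integral_mult_left[OF this, of "w ^ s / fact s"] show ?thesis by (simp add: field_simps)
  qed
  have fI: "(f N has_integral (\<Sum>s<N. of_real (integral {0<..} (gamma_log_integrand a s) / fact s) * w ^ s)) {0<..}" for N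
    unfolding f_def by (intro has_integral_sum trm) auto
  have expand: "of_real (gamma_log_integrand a s t) * w ^ s / fact s
      = of_real (t powr (a - 1) * exp (- t)) * ((of_real (ln t) * w) ^ s / fact s)" for s t
    by (simp add: power_mult_distrib)
  have lim: "(\<lambda>N. integral {0<..} (f N)) \<longlonglongrightarrow> integral {0<..} g"
  proof (rule dominated_convergence(2))
    show "f N integrable_on {0<..}" for N using fI by blast
    show "(\<lambda>t. t powr (a - 1) * exp (c * \<bar>ln t\<bar>) * exp (- t)) integrable_on {0<..}" by (rule gamma_majorant[OF a c(1,2)])
    show "norm (f N t) \<le> t powr (a - 1) * exp (c * \<bar>ln t\<bar>) * exp (- t)" if "t \<in> {0<..}" for N t
    proof -
      have "norm (\<Sum>s<N. (of_real (ln t) * w) ^ s / fact s) \<le> (\<Sum>s<N. inverse (fact s) * (\<bar>ln t\<bar> * norm w) ^ s)"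
        by (rule sum_norm_le) (simp add: norm_divide norm_power norm_mult field_simps)
      also have "\<dots> \<le> (\<Sum>s. inverse (fact s) * (\<bar>ln t\<bar> * norm w) ^ s)"
        by (rule sum_le_suminf[OF summable_exp]) auto
      also have "\<dots> = exp (\<bar>ln t\<bar> * norm w)" by (simp add: exp_def scaleR_conv_of_real)
      also have "\<dots> \<le> exp (c * \<bar>ln t\<bar>)" using c(3) by (simp add: mult.commute mult_right_mono)
      finally have "t powr (a - 1) * exp (- t) * norm (\<Sum>s<N. (of_real (ln t) * w) ^ s / fact s)
          \<le> t powr (a - 1) * exp (- t) * exp (c * \<bar>ln t\<bar>)" by (rule mult_left_mono) simp
      moreover have "norm (f N t) = t powr (a - 1) * exp (- t) * norm (\<Sum>s<N. (of_real (ln t) * w) ^ s / fact s)"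
        unfolding f_def expand sum_distrib_left[symmetric] norm_mult by (simp add: norm_mult)
      ultimately show ?thesis by (simp add: mult_ac)
    qed
    show "(\<lambda>N. f N t) \<longlonglongrightarrow> g t" if "t \<in> {0<..}" for t
    proof -
      have t: "0 < t" using that by simp
      have "(\<lambda>s. (of_real (ln t) * w) ^ s /\<^sub>R fact s) sums exp (of_real (ln t) * w)" by (rule exp_converges)
      then have "(\<lambda>s. (of_real (ln t) * w) ^ s / fact s) sums exp (of_real (ln t) * w)"
        by (simp add: scaleR_conv_of_real field_simps)
      from sums_mult[OF this, of "of_real (t powr (a - 1) * exp (- t))"]
      have "(\<lambda>N. f N t) \<longlonglongrightarrow> of_real (t powr (a - 1) * exp (- t)) * exp (of_real (ln t) * w)"
        unfolding sums_def f_def expand .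
      also have "of_real (t powr (a - 1) * exp (- t)) * exp (of_real (ln t) * w) = g t"
      proof -
        have "t powr (a - 1) * exp (- t) = exp ((a - 1) * ln t - t)"
          using t by (simp add: powr_def exp_diff exp_minus divide_inverse)
        then have 1: "complex_of_real (t powr (a - 1) * exp (- t)) = exp (of_real ((a - 1) * ln t - t))"
          by (simp only: exp_of_real)
        have 2: "g t = exp ((of_real a + w - 1) * of_real (ln t) - of_real t)"
          using t by (simp add: g_def powr_def Ln_of_real exp_diff exp_of_real)
        show ?thesis unfolding 1 2 exp_add[symmetric] by (simp add: algebra_simps)
      qed
      finally show ?thesis .
    qed
  qed
  moreover have "integral {0<..} g = Gamma (of_real a + w)"
  proof -
    have "- cmod w \<le> Re w" using abs_Re_le_cmod[of w] by linarith
    then have "Re (of_real a + w) > 0" using w by simp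
    from Gamma_integral_complex'[OF this] show ?thesis unfolding g_def by (rule integral_unique)
  qed
  moreover have "integral {0<..} (f N) = (\<Sum>s<N. of_real (integral {0<..} (gamma_log_integrand a s) / fact s) * w ^ s)" for N
    using fI by (rule integral_unique)
  ultimately show ?thesis by (simp add: sums_def)
qed

lemma higher_deriv_Gamma:
  assumes a: "0 < a"
  shows "(deriv ^^ s) (Gamma :: complex \<Rightarrow> complex) (of_real a) = of_real (integral {0<..} (gamma_log_integrand a s))"
proof -
  define F where "F = Abs_fps (\<lambda>s. complex_of_real (integral {0<..} (gamma_log_integrand a s) / fact s))"
  have rad: "fps_conv_radius F \<ge> ereal (a / 2)"
    unfolding fps_conv_radius_def
  proof -
    have "norm (of_real (a / 2) :: complex) < a" using a by simp
    from sums_summable[OF gamma_taylor[OF a this]]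
    have "conv_radius (fps_nth F) \<ge> norm (of_real (a / 2) :: complex)"
      by (intro conv_radius_geI) (simp add: F_def)
    then show "ereal (a / 2) \<le> conv_radius (fps_nth F)" using a by simp
  qed
  have "(Gamma \<circ> (\<lambda>x. of_real a + x)) has_fps_expansion F"
    unfolding has_fps_expansion_def
  proof
    have "ereal 0 < ereal (a / 2)" using a by simp
    then show "0 < fps_conv_radius F" using rad by (metis less_le_trans zero_ereal_def)
    have "eventually (\<lambda>w::complex. w \<in> ball 0 a) (nhds 0)" using a by (intro eventually_nhds_in_open) auto
    then show "eventually (\<lambda>w. eval_fps F w = (Gamma \<circ> (\<lambda>x. of_real a + x)) w) (nhds 0)"
    proof eventually_elim
      case (elim w)
      then have "(\<lambda>s. fps_nth F s * w ^ s) sums Gamma (of_real a + w)" using gamma_taylor[OF a, of w] by (simp add: F_def)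
      then show ?case by (simp add: eval_fps_def sums_iff)
    qed
  qed
  from fps_nth_fps_expansion[OF this, of s]
  have "of_real (integral {0<..} (gamma_log_integrand a s)) = (deriv ^^ s) (Gamma \<circ> (\<lambda>x. of_real a + x)) (0::complex)"
    by (simp add: F_def field_simps)
  then show ?thesis by (subst higher_deriv_shift_0) simp
qed

section \<open>Splitting Euler's integral at 1\<close>

text \<open>Integration by parts: the derivative of \<open>h\<close> is b times the integrand for s
  + 1 plus (s + 1) times the one for s, and \<open>h\<close> vanishes at both ends.\<close>

lemma power_log_integral:
  fixes b :: real
  assumes b: "0 < b"
  shows "((\<lambda>t. t powr (b - 1) * ln t ^ s) has_integral ((- 1) ^ s * fact s / b ^ (s + 1))) {0..1}"
proof (induction s)
  case 0
  have "((\<lambda>t. t powr (b - 1)) has_integral (1 powr (b - 1 + 1) / (b - 1 + 1))) {0..1}"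
    by (rule has_integral_powr_from_0) (use b in auto)
  then show ?case by simp
next
  case (Suc s)
  define h where "h t = t powr b * ln t ^ Suc s" for t :: real
  have "((\<lambda>t. b * (t powr (b - 1) * ln t ^ Suc s) + real (Suc s) * (t powr (b - 1) * ln t ^ s)) has_integral (h 1 - h 0)) {0..1}"
  proof (rule fundamental_theorem_of_calculus_interior)
    show "continuous_on {0..1} h"
      unfolding continuous_on_eq_continuous_within
    proof
      fix x :: real assume x: "x \<in> {0..1}"
      show "continuous (at x within {0..1}) h"
      proof (cases "x = 0")
        case False
        then have "isCont h x" unfolding h_def using x by (intro continuous_intros) auto
        then show ?thesis by (rule continuous_at_imp_continuous_at_within)
      next
        case True
        \<comment> \<open>With this exponent \<open>h t\<close> is the (s + 1)-st power of t^c ln t,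
          so the limit at 0 reduces to a single logarithm.\<close>
        define c where "c = b / real (Suc s)"
        have c: "0 < c" using b by (simp add: c_def)
        have "((\<lambda>t. t powr c * ln t) \<longlongrightarrow> 0) (at_right 0)" using c by real_asymp
        then have "((\<lambda>t. (t powr c * ln t) ^ Suc s) \<longlongrightarrow> 0 ^ Suc s) (at_right 0)" by (intro tendsto_power)
        moreover have "eventually (\<lambda>t. (t powr c * ln t) ^ Suc s = h t) (at_right 0)"
          using eventually_at_right_less[of "0::real"]
        proof eventually_elim
          case (elim t)
          have "(t powr c) ^ Suc s = t powr b"
            using elim by (subst powr_realpow[symmetric]) (auto simp: powr_powr c_def)
          then show ?case by (simp only: h_def power_mult_distrib)
        qed
        ultimately have "(h \<longlongrightarrow> 0 ^ Suc s) (at_right 0)" by (rule Lim_transform_eventually)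
        then have "(h \<longlongrightarrow> 0) (at_right 0)" by simp
        \<comment> \<open>The default value \<open>0 powr b = 0\<close> agrees with the
          limit.\<close>
        moreover have "h 0 = 0" by (simp add: h_def)
        ultimately show ?thesis
          unfolding True continuous_within by (auto simp: at_within_Icc_at_right)
      qed
    qed
    fix t :: real assume t: "t \<in> {0<..<1}"
    have "(h has_real_derivative b * (t powr (b - 1) * ln t ^ Suc s) + real (Suc s) * (t powr (b - 1) * ln t ^ s)) (at t)"
    proof -
      have e: "t powr b = t * t powr (b - 1)" using t by (simp add: powr_diff)
      have "real (Suc s) * ln t ^ s * (1 / t) * t powr b = real (Suc s) * (t powr (b - 1) * ln t ^ s)"
        unfolding e using t by simp
      moreover have "(h has_real_derivative (b * t powr (b - 1)) * ln t ^ Suc s + (real (Suc s) * ln t ^ s * (1 / t)) * t powr b) (at t)"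
      proof -
        have "((\<lambda>t. t powr b) has_real_derivative b * t powr (b - 1)) (at t)"
          using t by (intro has_real_derivative_powr) auto
        moreover have "((\<lambda>t. ln t ^ Suc s) has_real_derivative real (Suc s) * ln t ^ s * (1 / t)) (at t)"
          using DERIV_power_Suc[OF DERIV_ln_divide[of t], of s] t by (simp add: mult_ac add.commute)
        ultimately show ?thesis unfolding h_def by (rule DERIV_mult)
      qed
      ultimately show ?thesis by (simp only: mult.assoc)
    qed
    then show "(h has_vector_derivative b * (t powr (b - 1) * ln t ^ Suc s) + real (Suc s) * (t powr (b - 1) * ln t ^ s)) (at t)"
      by (simp add: has_real_derivative_iff_has_vector_derivative)
  qed auto
  then have "((\<lambda>t. b * (t powr (b - 1) * ln t ^ Suc s) + real (Suc s) * (t powr (b - 1) * ln t ^ s)) has_integral 0) {0..1}"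
    by (simp add: h_def)
  from has_integral_diff[OF this has_integral_mult_right[OF Suc.IH, of "real (Suc s)"]]
  have "((\<lambda>t. b * (t powr (b - 1) * ln t ^ Suc s)) has_integral (- (real (Suc s) * ((- 1) ^ s * fact s / b ^ (s + 1))))) {0..1}"
    by simp
  from has_integral_mult_right[OF this, of "1 / b"]
  have "((\<lambda>t. t powr (b - 1) * ln t ^ Suc s) has_integral (1 / b * (- (real (Suc s) * ((- 1) ^ s * fact s / b ^ (s + 1)))))) {0..1}"
    using b by simp
  moreover have "1 / b * (- (real (Suc s) * ((- 1) ^ s * fact s / b ^ (s + 1)))) = (- 1) ^ Suc s * fact (Suc s) / b ^ (Suc s + 1)"
    using b by (simp add: field_simps)
  ultimately show ?case by (simp only:)
qed

text \<open>exp (-t) is expanded and integrated termwise by \<open>power_log_integral\<close> with b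
  = a + n; on (0, 1] its partial sums are bounded by exp 1, which gives the majorant.\<close>

lemma gamma_log_lower_part:
  assumes a: "0 < a"
  shows "(\<lambda>n. (- 1) ^ n / fact n * ((- 1) ^ s * fact s / (a + real n) ^ (s + 1))) sums integral {0<..1} (gamma_log_integrand a s)"
proof -
  define f where "f N t = (\<Sum>n<N. (- 1) ^ n / fact n * (t powr (a + real n - 1) * ln t ^ s))" for N :: nat and t
  have J: "((\<lambda>t. t powr (b - 1) * ln t ^ s) has_integral ((- 1) ^ s * fact s / b ^ (s + 1))) {0<..1}" if "0 < b" for b :: real
    by (rule has_integral_spike_set_eq[THEN iffD1, OF _ _ power_log_integral[OF that]])
      (rule negligible_subset[of "{0}"], simp, force)+
  have fI: "(f N has_integral (\<Sum>n<N. (- 1) ^ n / fact n * ((- 1) ^ s * fact s / (a + real n) ^ (s + 1)))) {0<..1}" for N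
    unfolding f_def using a by (intro has_integral_sum has_integral_mult_right J) auto
  have expand: "(- 1) ^ n / fact n * (t powr (a + real n - 1) * ln t ^ s) = t powr (a - 1) * ln t ^ s * ((- t) ^ n / fact n)"
    if "0 < t" for t n
  proof -
    have "t powr (a + real n - 1) = t powr ((a - 1) + real n)" by (simp add: algebra_simps)
    also have "\<dots> = t powr (a - 1) * t ^ n" using that by (simp only: powr_add powr_realpow)
    finally have "t powr (a + real n - 1) = t powr (a - 1) * t ^ n" .
    then show ?thesis by (simp add: power_minus[of t] field_simps)
  qed
  have "(\<lambda>t. \<bar>t powr (a - 1) * ln t ^ s\<bar>) integrable_on {0<..1}"
  proof -
    have "(\<lambda>t. (- 1) ^ s * (t powr (a - 1) * ln t ^ s)) integrable_on {0<..1}"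
      using J[OF a] by (intro integrable_on_mult_right) blast
    moreover have "(- 1) ^ s * (t powr (a - 1) * ln t ^ s) = \<bar>t powr (a - 1) * ln t ^ s\<bar>" if "t \<in> {0<..1}" for t
    proof -
      have "\<bar>ln t\<bar> ^ s = (- ln t) ^ s" using that by simp
      then show ?thesis by (simp add: abs_mult power_abs power_minus[of "ln t"])
    qed
    ultimately show ?thesis by (rule integrable_eq)
  qed
  then have maj: "(\<lambda>t. exp 1 * \<bar>t powr (a - 1) * ln t ^ s\<bar>) integrable_on {0<..1}" by (rule integrable_on_mult_right)
  have "(\<lambda>N. integral {0<..1} (f N)) \<longlonglongrightarrow> integral {0<..1} (gamma_log_integrand a s)"
  proof (rule dominated_convergence(2)[OF _ maj])
    show "f N integrable_on {0<..1}" for N using fI by blast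
    show "norm (f N t) \<le> exp 1 * \<bar>t powr (a - 1) * ln t ^ s\<bar>" if "t \<in> {0<..1}" for N t
    proof -
      have t: "0 < t" "t \<le> 1" using that by auto
      have "\<bar>\<Sum>n<N. (- t) ^ n / fact n\<bar> \<le> (\<Sum>n<N. inverse (fact n) * t ^ n)"
        using t by (intro order.trans[OF sum_abs] sum_mono) (auto simp: abs_mult power_abs field_simps)
      also have "\<dots> \<le> (\<Sum>n. inverse (fact n) * t ^ n)"
        by (rule sum_le_suminf[OF summable_exp]) (use t in auto)
      also have "\<dots> = exp t" by (simp add: exp_def scaleR_conv_of_real)
      also have "\<dots> \<le> exp 1" using t by simp
      finally have "\<bar>t powr (a - 1) * ln t ^ s\<bar> * \<bar>\<Sum>n<N. (- t) ^ n / fact n\<bar> \<le> \<bar>t powr (a - 1) * ln t ^ s\<bar> * exp 1"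
        by (intro mult_left_mono) auto
      moreover have "f N t = t powr (a - 1) * ln t ^ s * (\<Sum>n<N. (- t) ^ n / fact n)"
        unfolding f_def sum_distrib_left using t expand by (intro sum.cong) auto
      ultimately show ?thesis by (simp add: abs_mult mult_ac)
    qed
    show "(\<lambda>N. f N t) \<longlonglongrightarrow> gamma_log_integrand a s t" if "t \<in> {0<..1}" for t
    proof -
      have "(\<lambda>n. (- t) ^ n / fact n) sums exp (- t)" using exp_converges[of "- t"] by (simp add: field_simps)
      from sums_mult[OF this, of "t powr (a - 1) * ln t ^ s"]
      moreover have "f N t = (\<Sum>n<N. t powr (a - 1) * ln t ^ s * ((- t) ^ n / fact n))" for N
        unfolding f_def using that by (intro sum.cong refl expand) auto
      ultimately show ?thesis unfolding sums_def by (simp only:)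
    qed
  qed
  moreover have "integral {0<..1} (f N) = (\<Sum>n<N. (- 1) ^ n / fact n * ((- 1) ^ s * fact s / (a + real n) ^ (s + 1)))" for N
    using fI by (rule integral_unique)
  ultimately show ?thesis by (simp add: sums_def)
qed

lemma gamma_log_upper_part:
  assumes a: "0 < a"
  shows "((\<lambda>u. (1 + u) powr (a - 1) * ln (1 + u) ^ s * exp (- u)) has_integral exp 1 * integral {1..} (gamma_log_integrand a s)) {0..}"
proof -
  have img: "(\<lambda>u::real. 1 + u) ` {0..} = {1..}"
  proof (intro equalityI subsetI)
    fix x :: real assume "x \<in> {1..}"
    then show "x \<in> (\<lambda>u. 1 + u) ` {0..}" by (intro image_eqI[of _ _ "x - 1"]) auto
  qed auto
  have "gamma_log_integrand a s absolutely_integrable_on {1..}"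
    by (rule set_integrable_subset[OF gamma_log_absolutely_integrable[OF a]]) auto
  moreover have "(\<lambda>u. \<bar>1\<bar> * gamma_log_integrand a s (1 + u)) absolutely_integrable_on {0..} \<and>
      integral {0..} (\<lambda>u. \<bar>1\<bar> * gamma_log_integrand a s (1 + u)) = integral {1..} (gamma_log_integrand a s)
      \<longleftrightarrow> gamma_log_integrand a s absolutely_integrable_on ((\<lambda>u. 1 + u) ` {0..}) \<and>
        integral ((\<lambda>u. 1 + u) ` {0..}) (gamma_log_integrand a s) = integral {1..} (gamma_log_integrand a s)"
    by (rule has_absolute_integral_change_of_variables_1') (auto intro!: derivative_eq_intros)
  ultimately have "(\<lambda>u. gamma_log_integrand a s (1 + u)) absolutely_integrable_on {0..} \<and>
      integral {0..} (\<lambda>u. gamma_log_integrand a s (1 + u)) = integral {1..} (gamma_log_integrand a s)"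
    unfolding img by simp
  then have "((\<lambda>u. gamma_log_integrand a s (1 + u)) has_integral integral {1..} (gamma_log_integrand a s)) {0..}"
    using set_lebesgue_integral_eq_integral(1) integrable_integral by fastforce
  from has_integral_mult_right[OF this, of "exp 1"] show ?thesis
    by (rule has_integral_eq[rotated]) (simp add: exp_minus exp_add exp_diff field_simps)
qed

theorem higher_deriv_Gamma_decomposition:
  assumes a: "0 < a"
  obtains v where
    "((\<lambda>u. (1 + u) powr (a - 1) * ln (1 + u) ^ s * exp (- u)) has_integral v) {0..}"
    "(deriv ^^ s) (Gamma :: complex \<Rightarrow> complex) (of_real a) = of_real
       ((\<Sum>n. (- 1) ^ n / fact n * ((- 1) ^ s * fact s / (a + real n) ^ (s + 1))) + exp (- 1) * v)"
proof -
  let ?f = "gamma_log_integrand a s"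
  have i: "?f integrable_on {0<..1}" "?f integrable_on {1..}"
    by (rule set_lebesgue_integral_eq_integral(1)[OF set_integrable_subset[OF gamma_log_absolutely_integrable[OF a]]]; auto)+
  have "{0<..1} \<inter> {1..} = {1::real}" by auto
  then have "(?f has_integral (integral {0<..1} ?f + integral {1..} ?f)) ({0<..1} \<union> {1..})"
    by (intro has_integral_Un[OF integrable_integral[OF i(1)] integrable_integral[OF i(2)]]) simp
  moreover have "{0<..1} \<union> {1..} = {0::real<..}" by auto
  ultimately have "integral {0<..} ?f = integral {0<..1} ?f + integral {1..} ?f" by (simp add: integral_unique)
  then have "integral {0<..} ?f = integral {0<..1} ?f + exp (- 1) * (exp 1 * integral {1..} ?f)" by (simp add: exp_minus)
  moreover have "integral {0<..1} ?f = (\<Sum>n. (- 1) ^ n / fact n * ((- 1) ^ s * fact s / (a + real n) ^ (s + 1)))"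
    using gamma_log_lower_part[OF a] by (simp only: sums_iff)
  ultimately show thesis
    by (intro that[OF gamma_log_upper_part[OF a]]) (simp only: higher_deriv_Gamma[OF a])
qed

section \<open>Algebraic numbers and E-functions\<close>

lemma Rats_sum: "(\<And>i. i \<in> S \<Longrightarrow> f i \<in> \<rat>) \<Longrightarrow> (\<Sum>i\<in>S. f i) \<in> (\<rat> :: 'a::field_char_0 set)"
  by (induction S rule: infinite_finite_induct) (auto intro: Rats_add)

lemma common_denominator:
  assumes "finite S"
  shows "\<exists>D::nat. 0 < D \<and> (\<forall>x\<in>S. of_nat D * x \<in> (\<int> :: rat set))"
  using assms
proof (induction S)
  case empty
  show ?case by (rule exI[of _ 1]) simp
next
  case (insert x S)
  then obtain D where D: "0 < D" "\<And>y. y \<in> S \<Longrightarrow> of_nat D * y \<in> \<int>" by blast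
  obtain p q where pq: "quotient_of x = (p, q)" by (cases "quotient_of x") auto
  have q: "0 < q" using quotient_of_denom_pos[OF pq] .
  have "of_nat (nat q) * x = of_int p" using q quotient_of_div[OF pq] by simp
  then have "of_nat (D * nat q) * x = of_int (int D * p)" by simp
  moreover have "of_nat (D * nat q) * y \<in> \<int>" if "y \<in> S" for y
  proof -
    have "of_nat (D * nat q) * y = of_nat (nat q) * (of_nat D * y)" by simp
    then show ?thesis using Ints_mult[OF Ints_of_nat D(2)[OF that]] by metis
  qed
  ultimately show ?case using D(1) q by (intro exI[of _ "D * nat q"]) (auto simp del: of_nat_mult of_int_mult)
qed

text \<open>More unknowns than equations. After clearing denominators this is
  \<open>siegel_lemma\<close> with a sufficiently large box.\<close>

lemma rational_system_solvable:
  fixes a :: "nat \<Rightarrow> nat \<Rightarrow> rat"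
  assumes "E < V"
  obtains b :: "nat \<Rightarrow> int" where "\<exists>k<V. b k \<noteq> 0" "\<And>e. e < E \<Longrightarrow> (\<Sum>k<V. a e k * of_int (b k)) = 0"
proof -
  obtain D :: nat where D: "0 < D" "\<And>e k. e < E \<Longrightarrow> k < V \<Longrightarrow> of_nat D * a e k \<in> \<int>"
    using common_denominator[of "(\<lambda>(e, k). a e k) ` ({..<E} \<times> {..<V})"] by auto
  define c where "c e k = \<lfloor>of_nat D * a e k\<rfloor>" for e k
  have c: "of_int (c e k) = of_nat D * a e k" if "e < E" "k < V" for e k
    using D(2)[OF that] by (auto simp: c_def elim!: Ints_cases)
  define H where "H = (\<Sum>e<E. \<Sum>k<V. nat \<bar>c e k\<bar>)"
  define X where "X = V * (H + 1)"
  \<comment> \<open>The count needs X^E (Y + 1)^E < (Y + 1)^(E + 1), that is X^E < Y + 1.\<close>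
  define Y where "Y = X ^ E"
  have cH: "\<bar>c e k\<bar> \<le> int H" if "e < E" "k < V" for e k
  proof -
    have "nat \<bar>c e k\<bar> \<le> (\<Sum>k<V. nat \<bar>c e k\<bar>)" using that by (intro member_le_sum[of k "{..<V}"]) auto
    also have "\<dots> \<le> H" unfolding H_def using that by (intro member_le_sum[of e "{..<E}"]) auto
    finally show ?thesis by linarith
  qed
  have big: "(V * H * Y + 1) ^ E < (Y + 1) ^ V"
  proof -
    have X1: "1 \<le> X" using assms by (simp add: X_def Suc_le_eq)
    have "V * H * Y + 1 \<le> X * (Y + 1)" using X1 by (simp add: X_def algebra_simps)
    then have "(V * H * Y + 1) ^ E \<le> X ^ E * (Y + 1) ^ E" by (metis power_mono power_mult_distrib zero_le)
    also have "\<dots> < (Y + 1) * (Y + 1) ^ E" by (simp add: Y_def)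
    also have "\<dots> \<le> (Y + 1) ^ V" using assms by (simp flip: power_Suc add: power_increasing del: power_Suc)
    finally show ?thesis .
  qed
  obtain b where b: "\<exists>k<V. b k \<noteq> 0" "\<And>e. e < E \<Longrightarrow> (\<Sum>k<V. c e k * b k) = 0"
    by (rule siegel_lemma[of E V c H Y, OF cH big]) (assumption | meson)+
  show thesis
  proof (rule that[OF b(1)])
    fix e assume e: "e < E"
    have "of_nat D * (\<Sum>k<V. a e k * of_int (b k)) = (\<Sum>k<V. of_int (c e k) * of_int (b k))"
      unfolding sum_distrib_left by (intro sum.cong) (auto simp: c[OF e])
    also have "\<dots> = of_int (\<Sum>k<V. c e k * b k)" by simp
    finally show "(\<Sum>k<V. a e k * of_int (b k)) = 0" using b(2)[OF e] D(1) by simp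
  qed
qed

lemma rationally_dependent:
  fixes a :: "nat \<Rightarrow> nat \<Rightarrow> rat" and t x :: "nat \<Rightarrow> 'a::field_char_0"
  assumes "E < V" "\<And>k. k < V \<Longrightarrow> x k = (\<Sum>e<E. of_rat (a e k) * t e)"
  obtains b :: "nat \<Rightarrow> int" where "\<exists>k<V. b k \<noteq> 0" "(\<Sum>k<V. of_int (b k) * x k) = 0"
proof -
  obtain b :: "nat \<Rightarrow> int" where b: "\<exists>k<V. b k \<noteq> 0" "\<And>e. e < E \<Longrightarrow> (\<Sum>k<V. a e k * of_int (b k)) = 0"
    using rational_system_solvable[OF assms(1), of a] by blast
  have "(\<Sum>k<V. of_int (b k) * x k) = (\<Sum>k<V. \<Sum>e<E. of_rat (a e k * of_int (b k)) * t e)"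
    by (intro sum.cong) (auto simp: assms(2) sum_distrib_left of_rat_mult mult_ac)
  also have "\<dots> = (\<Sum>e<E. of_rat (\<Sum>k<V. a e k * of_int (b k)) * t e)"
    by (subst sum.swap) (simp add: of_rat_sum sum_distrib_right)
  also have "\<dots> = 0" using b(2) by simp
  finally show thesis using that b(1) by blast
qed

text \<open>Explicit coefficients in the first d powers, with d the degree of an annihilating
  polynomial, allow dimension counts to be run through \<open>rationally_dependent\<close>.\<close>

lemma algebraic_power_reduction:
  fixes \<alpha> :: complex
  assumes "algebraic \<alpha>"
  obtains d :: nat and c :: "nat \<Rightarrow> nat \<Rightarrow> rat" where "\<And>k. \<alpha> ^ k = (\<Sum>l<d. of_rat (c k l) * \<alpha> ^ l)"
proof -
  obtain p where p: "\<And>i. coeff p i \<in> \<int>" "p \<noteq> 0" "poly p \<alpha> = 0" using assms unfolding algebraic_def by blast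
  define d where "d = degree p"
  have d: "0 < d"
  proof (rule ccontr)
    assume "\<not> 0 < d"
    then have "degree p = 0" by (simp add: d_def)
    then obtain a where "p = [:a:]" by (rule degree_eq_zeroE)
    then show False using p by simp
  qed
  have "\<exists>z. coeff p i = of_int z" for i using p(1)[of i] by (auto elim: Ints_cases)
  then obtain z where z: "\<And>i. coeff p i = of_int (z i)" by metis
  have zd: "z d \<noteq> 0" using p(2) z[of d] by (auto simp: d_def)
  have top: "\<alpha> ^ d = (\<Sum>l<d. of_rat (- of_int (z l) / of_int (z d)) * \<alpha> ^ l)"
  proof -
    have "0 = (\<Sum>l\<le>d. of_int (z l) * \<alpha> ^ l)" using p(3) z by (simp add: poly_altdef d_def)
    also have "\<dots> = (\<Sum>l<d. of_int (z l) * \<alpha> ^ l) + of_int (z d) * \<alpha> ^ d"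
      by (simp add: lessThan_Suc_atMost[symmetric])
    finally have "of_int (z d) * \<alpha> ^ d = - (\<Sum>l<d. of_int (z l) * \<alpha> ^ l)" by (simp add: eq_neg_iff_add_eq_0 add.commute)
    then have "\<alpha> ^ d = - (\<Sum>l<d. of_int (z l) * \<alpha> ^ l) / of_int (z d)" using zd by (simp add: field_simps)
    also have "\<dots> = (\<Sum>l<d. of_rat (- of_int (z l) / of_int (z d)) * \<alpha> ^ l)"
      by (simp add: of_rat_divide of_rat_minus sum_divide_distrib sum_negf)
    finally show ?thesis .
  qed
  have "\<exists>c. \<alpha> ^ k = (\<Sum>l<d. of_rat (c l) * \<alpha> ^ l)" for k
  proof (induction k)
    case 0
    have "(\<Sum>l<d. of_rat (if l = 0 then 1 else 0) * \<alpha> ^ l) = (\<Sum>l<d. if l = 0 then 1 else 0)"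
      by (intro sum.cong) auto
    then show ?case using d by (intro exI[of _ "\<lambda>l. if l = 0 then 1 else 0"]) simp
  next
    case (Suc k)
    then obtain c where c: "\<alpha> ^ k = (\<Sum>l<d. of_rat (c l) * \<alpha> ^ l)" by blast
    obtain d' where d': "d = Suc d'" using d gr0_implies_Suc by blast
    define c2 where "c2 l = (if l = 0 then 0 else c (l - 1)) + c d' * (- of_int (z l) / of_int (z d))" for l
    have "\<alpha> ^ Suc k = (\<Sum>l<d'. of_rat (c l) * \<alpha> ^ Suc l) + of_rat (c d') * \<alpha> ^ d"
      unfolding power_Suc[of \<alpha> k] c d' by (simp add: distrib_left sum_distrib_left mult_ac)
    also have "(\<Sum>l<d'. of_rat (c l) * \<alpha> ^ Suc l) = (\<Sum>l<d. of_rat (if l = 0 then 0 else c (l - 1)) * \<alpha> ^ l)"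
      unfolding d' by (subst sum.lessThan_Suc_shift) simp
    also have "of_rat (c d') * \<alpha> ^ d = (\<Sum>l<d. of_rat (c d' * (- of_int (z l) / of_int (z d))) * \<alpha> ^ l)"
      unfolding top sum_distrib_left by (simp only: of_rat_mult mult.assoc)
    finally have "\<alpha> ^ Suc k = (\<Sum>l<d. of_rat (c2 l) * \<alpha> ^ l)"
      by (simp only: c2_def of_rat_add distrib_right sum.distrib)
    then show ?case by blast
  qed
  then obtain c where "\<And>k. \<alpha> ^ k = (\<Sum>l<d. of_rat (c k l) * \<alpha> ^ l)" by metis
  then show thesis by (rule that)
qed

text \<open>The powers of \<open>poly g \<alpha>\<close> lie in the rational span of d powers of
  \<alpha>, so d + 1 of them are dependent.\<close>

lemma algebraic_poly:
  fixes \<alpha> :: complex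
  assumes "algebraic \<alpha>" "\<And>i. coeff g i \<in> \<rat>"
  shows "algebraic (poly g \<alpha>)"
proof -
  obtain d :: nat and c :: "nat \<Rightarrow> nat \<Rightarrow> rat" where c: "\<And>k. \<alpha> ^ k = (\<Sum>l<d. of_rat (c k l) * \<alpha> ^ l)"
    using algebraic_power_reduction[OF assms(1)] by blast
  have rat: "coeff (g ^ j) i \<in> \<rat>" for i j
  proof (induction j arbitrary: i)
    case (Suc j)
    show ?case unfolding power_Suc coeff_mult by (intro Rats_sum Rats_mult Suc assms)
  qed (auto simp: coeff_1)
  then have "\<forall>i j. \<exists>r. coeff (g ^ j) i = of_rat r" unfolding Rats_def by blast
  then obtain r where r: "\<And>i j. coeff (g ^ j) i = of_rat (r i j)" by (metis (no_types))
  have "poly g \<alpha> ^ j = (\<Sum>l<d. of_rat (\<Sum>i\<le>degree (g ^ j). r i j * c i l) * \<alpha> ^ l)" for j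
  proof -
    have "poly g \<alpha> ^ j = (\<Sum>i\<le>degree (g ^ j). of_rat (r i j) * \<alpha> ^ i)"
      by (subst poly_power[symmetric]) (simp only: poly_altdef r)
    also have "\<dots> = (\<Sum>i\<le>degree (g ^ j). \<Sum>l<d. of_rat (r i j * c i l) * \<alpha> ^ l)"
      by (intro sum.cong refl) (subst c, simp add: sum_distrib_left of_rat_mult mult_ac)
    also have "\<dots> = (\<Sum>l<d. of_rat (\<Sum>i\<le>degree (g ^ j). r i j * c i l) * \<alpha> ^ l)"
      by (subst sum.swap) (simp add: of_rat_sum sum_distrib_right)
    finally show ?thesis .
  qed
  then obtain b :: "nat \<Rightarrow> int" where b: "\<exists>k<Suc d. b k \<noteq> 0" "(\<Sum>k<Suc d. of_int (b k) * poly g \<alpha> ^ k) = 0"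
    using rationally_dependent[of d "Suc d" "\<lambda>j. poly g \<alpha> ^ j" "\<lambda>l j. \<Sum>i\<le>degree (g ^ j). r i j * c i l" "\<lambda>l. \<alpha> ^ l"]
    by blast
  define h where "h = (\<Sum>k<Suc d. monom (of_int (b k)) k :: complex poly)"
  have coeff_h: "coeff h k = (if k < Suc d then of_int (b k) else 0)" for k
    unfolding h_def coeff_sum by (simp add: coeff_monom)
  show ?thesis
  proof (rule algebraicI)
    show "coeff h k \<in> \<int>" for k by (simp add: coeff_h)
    show "h \<noteq> 0" using b(1) coeff_h by (metis coeff_0 of_int_eq_0_iff)
    show "poly h (poly g \<alpha>) = 0" using b(2) by (simp add: h_def poly_sum poly_monom)
  qed
qed

lemma algebraic_add_rational:
  assumes "algebraic (\<alpha> :: complex)" "r \<in> \<rat>"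
  shows "algebraic (\<alpha> + r)"
  using algebraic_poly[OF assms(1), of "[:r, 1:]"] assms(2) by (simp add: coeff_pCons add.commute split: nat.split)

lemma Rats_subset_Qbar: "\<rat> \<subseteq> Qbar"
  using algebraic_add_rational[of 0] by (auto simp: Qbar_def)

lemma Gal_poly:
  assumes \<sigma>: "\<sigma> \<in> Gal_Qbar" and \<alpha>: "algebraic \<alpha>" and p: "\<And>i. coeff p i \<in> \<rat>"
  shows "\<sigma> (poly p \<alpha>) = poly p (\<sigma> \<alpha>)"
  using p
proof (induction p)
  case 0
  then show ?case using \<sigma> by (simp add: Gal_Qbar_def)
next
  case (pCons c p)
  have c: "c \<in> \<rat>" using pCons.prems[of 0] by simp
  have p: "coeff p i \<in> \<rat>" for i using pCons.prems[of "Suc i"] by simp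
  have q: "poly p \<alpha> \<in> Qbar" "\<alpha> \<in> Qbar" "c \<in> Qbar"
    using algebraic_poly[OF \<alpha> p] \<alpha> Rats_subset_Qbar c by (auto simp: Qbar_def)
  have "\<alpha> * poly p \<alpha> = poly (pCons 0 p) \<alpha>" by simp
  then have "\<alpha> * poly p \<alpha> \<in> Qbar"
    using algebraic_poly[OF \<alpha>, of "pCons 0 p"] p by (auto simp: Qbar_def coeff_pCons split: nat.split)
  then have "\<sigma> (c + \<alpha> * poly p \<alpha>) = \<sigma> c + \<sigma> \<alpha> * \<sigma> (poly p \<alpha>)"
    using \<sigma> q unfolding Gal_Qbar_def by simp
  also have "\<sigma> c = c" using \<sigma> c by (simp add: Gal_Qbar_def)
  finally show ?case using pCons.IH[OF p] by simp
qed

text \<open>All conjugates are among the finitely many roots of one integer polynomial.\<close>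

lemma Gal_bounded:
  assumes "algebraic \<alpha>"
  obtains B :: real where "\<And>\<sigma>. \<sigma> \<in> Gal_Qbar \<Longrightarrow> norm (\<sigma> \<alpha>) \<le> B"
proof -
  obtain p where p: "\<And>i. coeff p i \<in> \<int>" "p \<noteq> 0" "poly p \<alpha> = 0" using assms unfolding algebraic_def by blast
  have fin: "finite {x. poly p x = 0}" using p(2) poly_roots_finite by blast
  have "norm (\<sigma> \<alpha>) \<le> Max (norm ` {x. poly p x = 0})" if \<sigma>: "\<sigma> \<in> Gal_Qbar" for \<sigma>
  proof -
    have rat: "coeff p i \<in> \<rat>" for i using p(1)[of i] Ints_subset_Rats by blast
    have "poly p (\<sigma> \<alpha>) = \<sigma> (poly p \<alpha>)" by (rule Gal_poly[OF \<sigma> assms rat, symmetric])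
    also have "\<dots> = 0" using \<sigma> p(3) by (simp add: Gal_Qbar_def)
    finally show ?thesis using fin by (intro Max_ge) auto
  qed
  then show thesis using that by blast
qed

lemma algebraic_int_add_int:
  assumes "algebraic_int (x :: complex)" "z \<in> \<int>"
  shows "algebraic_int (x + z)"
proof -
  obtain p where p: "lead_coeff p = 1" "\<And>i. coeff p i \<in> \<int>" "poly p x = 0" using assms(1) by (auto elim: algebraic_int.cases)
  have int: "coeff (pcompose q [:- z, 1:]) i \<in> \<int>" if "\<And>i. coeff q i \<in> \<int>" for q i
    using that
  proof (induction q arbitrary: i)
    case (pCons a q)
    have a: "a \<in> \<int>" using pCons.prems[of 0] by simp
    have q: "coeff (pcompose q [:- z, 1:]) i \<in> \<int>" for i
      using pCons.IH pCons.prems[of "Suc _"] by simp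
    show ?case
      unfolding pcompose_pCons coeff_add coeff_mult
      using a assms(2) q by (intro Ints_add Ints_sum Ints_mult q) (auto simp: coeff_pCons split: nat.split)
  qed simp
  show ?thesis
  proof (rule algebraic_int.intros)
    show "lead_coeff (pcompose p [:- z, 1:]) = 1" using p(1) by (subst lead_coeff_comp) auto
    show "\<forall>i. coeff (pcompose p [:- z, 1:]) i \<in> \<int>" using int[of p] p(2) by blast
    show "poly (pcompose p [:- z, 1:]) (x + z) = 0" using p(3) by (simp add: poly_pcompose)
  qed
qed

text \<open>The leading coefficient of an integer equation serves as denominator. All multiples
  \<open>D * n\<close> are included because the denominators of the rational parts, which grow with
  the index, are multiplied onto it later.\<close>

lemma algebraic_denominator:
  assumes "algebraic (\<alpha> :: complex)"
  obtains D :: nat where "0 < D" "\<And>n::nat. algebraic_int (of_nat (D * n) * \<alpha>)"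
proof -
  obtain p where p: "\<And>i. coeff p i \<in> \<int>" "p \<noteq> 0" "poly p \<alpha> = 0" using assms unfolding algebraic_def by blast
  define e where "e = degree p"
  obtain l where l: "lead_coeff p = of_int l" using p(1) by (auto elim: Ints_cases)
  have l0: "l \<noteq> 0" using l p(2) by auto
  have e: "0 < e"
  proof (rule ccontr)
    assume "\<not> 0 < e"
    then have "degree p = 0" by (simp add: e_def)
    then obtain a where "p = [:a:]" by (rule degree_eq_zeroE)
    then show False using p by simp
  qed
  have *: "algebraic_int (of_int (N * l) * \<alpha>)" for N
  proof -
    \<comment> \<open>This is l^(e-1) N^e p(X / (N l)), which is monic because l is the leading
      coefficient of \<open>p\<close>.\<close>
    define q where "q = monom 1 e + (\<Sum>i<e. monom (coeff p i * of_int (l ^ (e - 1 - i) * N ^ (e - i))) i)"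
    have coeff_q: "coeff q i = (if i = e then 1 else if i < e then coeff p i * of_int (l ^ (e - 1 - i) * N ^ (e - i)) else 0)" for i
      unfolding q_def coeff_add coeff_sum by (auto simp: coeff_monom)
    have deg: "degree q = e"
      by (rule antisym[OF degree_le le_degree]) (auto simp: coeff_q)
    show ?thesis
    proof (rule algebraic_int.intros)
      show "lead_coeff q = 1" by (simp add: deg coeff_q)
      show "\<forall>i. coeff q i \<in> \<int>" using p(1) by (auto simp: coeff_q simp del: of_int_mult of_int_power)
      have "poly q (of_int (N * l) * \<alpha>) = (of_int (N * l) * \<alpha>) ^ e
          + (\<Sum>i<e. coeff p i * of_int (l ^ (e - 1 - i) * N ^ (e - i)) * (of_int (N * l) * \<alpha>) ^ i)"
        by (simp add: q_def poly_sum poly_monom)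
      also have "(of_int (N * l) * \<alpha>) ^ e = of_int (N ^ e * l ^ (e - 1)) * (coeff p e * \<alpha> ^ e)"
        using e l by (cases e) (simp_all add: e_def power_mult_distrib mult_ac)
      also have "(\<Sum>i<e. coeff p i * of_int (l ^ (e - 1 - i) * N ^ (e - i)) * (of_int (N * l) * \<alpha>) ^ i)
          = (\<Sum>i<e. of_int (N ^ e * l ^ (e - 1)) * (coeff p i * \<alpha> ^ i))"
      proof (rule sum.cong[OF refl])
        fix i assume "i \<in> {..<e}"
        then have "l ^ (e - 1) = l ^ (e - 1 - i) * l ^ i" "N ^ e = N ^ (e - i) * N ^ i" by (simp_all flip: power_add)
        then show "coeff p i * of_int (l ^ (e - 1 - i) * N ^ (e - i)) * (of_int (N * l) * \<alpha>) ^ i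
            = of_int (N ^ e * l ^ (e - 1)) * (coeff p i * \<alpha> ^ i)"
          by (simp add: power_mult_distrib mult_ac)
      qed
      also have "of_int (N ^ e * l ^ (e - 1)) * (coeff p e * \<alpha> ^ e) + (\<Sum>i<e. of_int (N ^ e * l ^ (e - 1)) * (coeff p i * \<alpha> ^ i))
          = of_int (N ^ e * l ^ (e - 1)) * (\<Sum>i\<le>e. coeff p i * \<alpha> ^ i)"
        by (simp add: sum_distrib_left distrib_left lessThan_Suc_atMost[symmetric])
      also have "(\<Sum>i\<le>e. coeff p i * \<alpha> ^ i) = 0" using p(3) by (simp add: poly_altdef e_def)
      finally show "poly q (of_int (N * l) * \<alpha>) = 0" by simp
    qed
  qed
  show thesis
  proof (rule that[of "nat \<bar>l\<bar>"])
    show "0 < nat \<bar>l\<bar>" using l0 by simp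
    fix n :: nat
    have "of_nat (nat \<bar>l\<bar> * n) = (of_int (sgn l * int n * l) :: complex)"
    proof -
      have "int (nat \<bar>l\<bar> * n) = sgn l * int n * l" by (simp add: sgn_if)
      then show ?thesis by (metis of_int_of_nat_eq)
    qed
    then show "algebraic_int (of_nat (nat \<bar>l\<bar> * n) * \<alpha>)" using *[of "sgn l * int n"] by (simp only:)
  qed
qed

lemma arith_geom_rational:
  assumes "arith_geom r"
  shows "r n \<in> \<rat>"
proof -
  obtain D :: "nat \<Rightarrow> nat" where "0 < D n" "of_nat (D n) * r n \<in> \<int>" using assms unfolding arith_geom_def by blast
  then have "(of_nat (D n) * r n) / of_nat (D n) \<in> \<rat>" using Ints_subset_Rats by (intro Rats_divide) auto
  then show ?thesis using \<open>0 < D n\<close> by simp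
qed

text \<open>The E-functions that occur have exponential coefficients \<alpha> + r n with one fixed
  algebraic \<alpha>: the series e^x (A - c f) is of this shape, and \<alpha> = 0 covers rational
  coefficients. A conjugate is \<sigma> \<alpha> + r n, so its bound combines the bound on the
  conjugates of \<alpha> with the growth of \<open>r\<close>.\<close>

lemma E_functionI:
  assumes \<alpha>: "algebraic \<alpha>" and r: "arith_geom r" and F: "F = Abs_fps (\<lambda>n. (\<alpha> + r n) / fact n)"
    and ode: "satisfies_linear_ode F"
  shows "E_function F"
proof -
  obtain C :: nat and D where C: "1 \<le> C" "\<And>n. 0 < D n" "\<And>n. D n \<le> C ^ (n + 1)" "\<And>n. norm (r n) \<le> real C ^ (n + 1)"
    "\<And>n k. k \<le> n \<Longrightarrow> of_nat (D n) * r k \<in> \<int>" using r unfolding arith_geom_def by blast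
  obtain B where B: "\<And>\<sigma>. \<sigma> \<in> Gal_Qbar \<Longrightarrow> norm (\<sigma> \<alpha>) \<le> B" using Gal_bounded[OF \<alpha>] by blast
  obtain D\<alpha> :: nat where D\<alpha>: "0 < D\<alpha>" "\<And>n::nat. algebraic_int (of_nat (D\<alpha> * n) * \<alpha>)" using algebraic_denominator[OF \<alpha>] by blast
  define K where "K = max \<bar>B\<bar> 1 + real C + real (D\<alpha> * C)"
  have K: "1 \<le> K" "real C + \<bar>B\<bar> \<le> K" "real (D\<alpha> * C) \<le> K" "0 \<le> real C"
    using of_nat_0_le_iff[of C, where 'a = real] of_nat_0_le_iff[of "D\<alpha> * C", where 'a = real] unfolding K_def by linarith+
  show ?thesis
    unfolding E_function_def
  proof (intro exI[of _ "\<lambda>n. \<alpha> + r n"] conjI exI[of _ K] allI ballI)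
    show "F = Abs_fps (\<lambda>n. (\<alpha> + r n) / fact n)" by (rule F)
    show "\<alpha> + r n \<in> Qbar" for n using algebraic_add_rational[OF \<alpha> arith_geom_rational[OF r]] by (simp add: Qbar_def)
    show "satisfies_linear_ode F" by (rule ode)
    show "0 < K" using K(1) by simp
    show "norm (\<sigma> (\<alpha> + r n)) \<le> K ^ (n + 1)" if \<sigma>: "\<sigma> \<in> Gal_Qbar" for n \<sigma>
    proof -
      have "r n \<in> \<rat>" using arith_geom_rational[OF r] .
      then have "\<sigma> (\<alpha> + r n) = \<sigma> \<alpha> + r n"
        using \<sigma> \<alpha> Rats_subset_Qbar unfolding Gal_Qbar_def Qbar_def by auto
      then have "norm (\<sigma> (\<alpha> + r n)) \<le> norm (\<sigma> \<alpha>) + norm (r n)" using norm_triangle_ineq by metis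
      also have "\<dots> \<le> \<bar>B\<bar> + real C ^ (n + 1)" using B[OF \<sigma>] C(4)[of n] by linarith
      also have "\<dots> \<le> (\<bar>B\<bar> + real C) * real C ^ n + (\<bar>B\<bar> + real C) * 0"
      proof -
        have "\<bar>B\<bar> * 1 \<le> \<bar>B\<bar> * real C ^ n" using C(1) by (intro mult_left_mono one_le_power) auto
        then show ?thesis by (simp add: distrib_right)
      qed
      also have "\<dots> \<le> K * K ^ n" using K by (simp, intro mult_mono power_mono) auto
      finally show ?thesis by simp
    qed
    show "real (common_denom (\<lambda>n. \<alpha> + r n) n) \<le> K ^ (n + 1)" for n
    proof -
      have "common_denom (\<lambda>n. \<alpha> + r n) n \<le> D\<alpha> * D n"
        unfolding common_denom_def
      proof (rule Least_le, intro conjI allI impI)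
        show "0 < D\<alpha> * D n" using D\<alpha> C(2) by simp
        fix k assume k: "k \<le> n"
        have "of_nat (D\<alpha> * D n) * (\<alpha> + r k) = of_nat (D\<alpha> * D n) * \<alpha> + of_nat D\<alpha> * (of_nat (D n) * r k)"
          by (simp add: algebra_simps)
        then show "algebraic_int (of_nat (D\<alpha> * D n) * (\<alpha> + r k))"
          using algebraic_int_add_int[OF D\<alpha>(2) Ints_mult[OF Ints_of_nat C(5)[OF k]]] by simp
      qed
      also have "\<dots> \<le> D\<alpha> ^ (n + 1) * C ^ (n + 1)"
        using D\<alpha>(1) by (intro mult_mono C(3) self_le_power) auto
      finally have "real (common_denom (\<lambda>n. \<alpha> + r n) n) \<le> real (D\<alpha> ^ (n + 1) * C ^ (n + 1))" by (rule of_nat_mono)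
      also have "\<dots> = real (D\<alpha> * C) ^ (n + 1)" by (simp only: power_mult_distrib of_nat_mult of_nat_power)
      also have "\<dots> \<le> K ^ (n + 1)" using K by (intro power_mono) auto
      finally show ?thesis .
    qed
  qed
qed

section \<open>Differential operators with rational coefficients\<close>

text \<open>\<open>m\<close> is the exact order. Tracking the nonzero top coefficient shows that
  composite operators are not zero, without computing their coefficients.\<close>

definition rat_op :: "nat \<Rightarrow> (complex fps \<Rightarrow> complex fps) \<Rightarrow> bool" where
  "rat_op m L \<longleftrightarrow> (\<exists>c :: nat \<Rightarrow> complex poly. (\<forall>i l. coeff (c i) l \<in> \<rat>) \<and> c m \<noteq> 0 \<and>
     (\<forall>F. L F = (\<Sum>i\<le>m. fps_of_poly (c i) * (fps_deriv ^^ i) F)))"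

lemma rat_op_id: "rat_op 0 (\<lambda>F. F)"
  unfolding rat_op_def by (rule exI[of _ "\<lambda>_. 1"]) (simp add: coeff_1)

lemma rat_op_deriv:
  assumes "rat_op m L"
  shows "rat_op (Suc m) (\<lambda>F. fps_deriv (L F))"
proof -
  obtain c :: "nat \<Rightarrow> complex poly" where c: "\<And>i l. coeff (c i) l \<in> \<rat>" "c m \<noteq> 0" "\<And>F. L F = (\<Sum>i\<le>m. fps_of_poly (c i) * (fps_deriv ^^ i) F)"
    using assms unfolding rat_op_def by blast
  define d where "d i = (if i \<le> m then pderiv (c i) else 0) + (if i = 0 then 0 else c (i - 1))" for i
  show ?thesis
    unfolding rat_op_def
  proof (intro exI[of _ d] conjI allI)
    show "coeff (d i) l \<in> \<rat>" for i l using c(1) by (auto simp: d_def coeff_pderiv intro!: Rats_add Rats_mult)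
    show "d (Suc m) \<noteq> 0" using c(2) by (simp add: d_def)
    fix F :: "complex fps"
    let ?D = "\<lambda>i. (fps_deriv ^^ i) F"
    have "fps_deriv (L F) = (\<Sum>i\<le>m. fps_of_poly (pderiv (c i)) * ?D i) + (\<Sum>i\<le>m. fps_of_poly (c i) * ?D (Suc i))"
      unfolding c(3) fps_deriv_sum by (simp add: fps_of_poly_pderiv sum.distrib algebra_simps)
    also have "(\<Sum>i\<le>m. fps_of_poly (pderiv (c i)) * ?D i) = (\<Sum>i\<le>Suc m. fps_of_poly (if i \<le> m then pderiv (c i) else 0) * ?D i)"
      by simp
    also have "(\<Sum>i\<le>m. fps_of_poly (c i) * ?D (Suc i)) = (\<Sum>i\<le>Suc m. fps_of_poly (if i = 0 then 0 else c (i - 1)) * ?D i)"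
      by (subst sum.atMost_Suc_shift) simp
    finally show "fps_deriv (L F) = (\<Sum>i\<le>Suc m. fps_of_poly (d i) * ?D i)"
      by (simp only: d_def fps_of_poly_add distrib_right sum.distrib)
  qed
qed

text \<open>As \<open>m' < m\<close>, the top coefficient of the sum is \<open>q * c m\<close>,
  which cannot cancel.\<close>

lemma rat_op_combine:
  assumes "rat_op m L" "rat_op m' L'" "m' < m" "\<And>l. coeff q l \<in> \<rat>" "\<And>l. coeff r l \<in> \<rat>" "q \<noteq> 0"
  shows "rat_op m (\<lambda>F. fps_of_poly q * L F + fps_of_poly r * L' F)"
proof -
  obtain c :: "nat \<Rightarrow> complex poly" where c: "\<And>i l. coeff (c i) l \<in> \<rat>" "c m \<noteq> 0" "\<And>F. L F = (\<Sum>i\<le>m. fps_of_poly (c i) * (fps_deriv ^^ i) F)"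
    using assms(1) unfolding rat_op_def by blast
  obtain c' :: "nat \<Rightarrow> complex poly" where c': "\<And>i l. coeff (c' i) l \<in> \<rat>" "\<And>F. L' F = (\<Sum>i\<le>m'. fps_of_poly (c' i) * (fps_deriv ^^ i) F)"
    using assms(2) unfolding rat_op_def by blast
  define d where "d i = q * c i + (if i \<le> m' then r * c' i else 0)" for i
  show ?thesis
    unfolding rat_op_def
  proof (intro exI[of _ d] conjI allI)
    have "coeff (p * p') l \<in> \<rat>" if "\<And>l. coeff p l \<in> \<rat>" "\<And>l. coeff p' l \<in> \<rat>" for p p' :: "complex poly" and l
      unfolding coeff_mult using that by (intro Rats_sum Rats_mult) auto
    then show "coeff (d i) l \<in> \<rat>" for i l using c(1) c'(1) assms(4,5) by (auto simp: d_def intro!: Rats_add)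
    show "d m \<noteq> 0" using c(2) assms(3,6) by (simp add: d_def)
    fix F :: "complex fps"
    let ?D = "\<lambda>i. (fps_deriv ^^ i) F"
    have "fps_of_poly r * L' F = (\<Sum>i\<le>m'. fps_of_poly (r * c' i) * ?D i)"
      unfolding c'(2) by (simp add: sum_distrib_left fps_of_poly_mult mult.assoc)
    also have "\<dots> = (\<Sum>i\<le>m. fps_of_poly (if i \<le> m' then r * c' i else 0) * ?D i)"
      using assms(3) by (intro sum.mono_neutral_cong_left) auto
    finally have 1: "fps_of_poly r * L' F = \<dots>" .
    have "fps_of_poly q * L F = (\<Sum>i\<le>m. fps_of_poly (q * c i) * ?D i)"
      unfolding c(3) by (simp add: sum_distrib_left fps_of_poly_mult mult.assoc)
    then show "fps_of_poly q * L F + fps_of_poly r * L' F = (\<Sum>i\<le>m. fps_of_poly (d i) * ?D i)"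
      unfolding 1 d_def fps_of_poly_add distrib_right sum.distrib by simp
  qed
qed

lemma rat_op_ode:
  assumes "rat_op m L" "L F = 0"
  shows "satisfies_linear_ode F"
proof -
  obtain c :: "nat \<Rightarrow> complex poly" where c: "\<And>i l. coeff (c i) l \<in> \<rat>" "c m \<noteq> 0" "\<And>F. L F = (\<Sum>i\<le>m. fps_of_poly (c i) * (fps_deriv ^^ i) F)"
    using assms(1) unfolding rat_op_def by blast
  have fls_sum: "fps_to_fls (sum f S) = (\<Sum>i\<in>S. fps_to_fls (f i))" for f :: "nat \<Rightarrow> complex fps" and S
    by (induction S rule: infinite_finite_induct) auto
  define k where "k i = fps_to_fls (fps_of_poly (c i))" for i
  show ?thesis
    unfolding satisfies_linear_ode_def
  proof (rule exI[of _ m], rule exI[of _ k], intro conjI allI impI)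
    show "k i \<in> Qbar_rat_funs" if "i \<le> m" for i
    proof -
      have "k i = fps_to_fls (fps_of_poly (c i)) / fps_to_fls (fps_of_poly 1)" by (simp add: k_def)
      moreover have "coeff 1 l \<in> Qbar" for l :: nat by (auto simp: coeff_1 Qbar_def)
      moreover have "coeff (c i) l \<in> Qbar" for l using c(1) Rats_subset_Qbar by blast
      ultimately show ?thesis unfolding Qbar_rat_funs_def using one_neq_zero by blast
    qed
    show "\<exists>i\<le>m. k i \<noteq> 0" using c(2) by (intro exI[of _ m]) (simp add: k_def)
    have "(\<Sum>i\<le>m. k i * fps_to_fls ((fps_deriv ^^ i) F)) = fps_to_fls (L F)"
      unfolding c(3) fls_sum k_def fls_times_fps_to_fls ..
    then show "(\<Sum>i\<le>m. k i * fps_to_fls ((fps_deriv ^^ i) F)) = 0" using assms(2) by simp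
  qed
qed

text \<open>Under the Borel transform, \<open>borel_op b\<close> corresponds to \<open>binomial_op b\<close>, which annihilates
  \<open>(1 + x)\<^sup>b\<close>.\<close>

definition borel_op :: "complex \<Rightarrow> complex fps \<Rightarrow> complex fps" where
  "borel_op b F = fps_of_poly [:0, 1:] * fps_deriv (fps_deriv F)
     + fps_of_poly 1 * (fps_of_poly [:1, 1:] * fps_deriv F + fps_of_poly [:- b:] * F)"

lemma rat_op_borel_op:
  assumes "b \<in> \<rat>"
  shows "rat_op (2 * k) (borel_op b ^^ k)"
proof (induction k)
  case 0
  then show ?case using rat_op_id by (simp add: id_def)
next
  case (Suc k)
  let ?L = "borel_op b ^^ k"
  have D: "rat_op (Suc (2 * k)) (\<lambda>F. fps_deriv (?L F))" by (rule rat_op_deriv[OF Suc])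
  have "rat_op (Suc (2 * k)) (\<lambda>F. fps_of_poly [:1, 1:] * fps_deriv (?L F) + fps_of_poly [:- b:] * ?L F)"
    by (rule rat_op_combine[OF D Suc]) (use assms in \<open>auto simp: coeff_pCons split: nat.split\<close>)
  from rat_op_combine[OF rat_op_deriv[OF D] this, of "[:0, 1:]" 1]
  have "rat_op (Suc (Suc (2 * k))) (\<lambda>F. borel_op b (?L F))"
    unfolding borel_op_def by (simp add: coeff_pCons coeff_1 split: nat.split)
  then show ?case by simp
qed

definition binomial_op :: "complex \<Rightarrow> complex fps \<Rightarrow> complex fps" where
  "binomial_op b h = (1 + fps_X) * fps_deriv h - fps_const b * h"

lemma borel_op_borel:
  "borel_op b (Abs_fps (\<lambda>n. fps_nth h n / fact n)) = Abs_fps (\<lambda>n. fps_nth (binomial_op b h) n / fact n)"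
proof (rule fps_ext)
  fix n :: nat
  have pc: "fps_of_poly [:0, 1:] = (fps_X :: complex fps)" "fps_of_poly [:1, 1:] = (1 + fps_X :: complex fps)"
    "fps_of_poly [:- b:] = fps_const (- b)"
    by (auto simp: fps_of_poly_pCons fps_of_poly_const)
  have X: "fps_nth (fps_X * fps_deriv F) n = of_nat n * fps_nth F n" for F :: "complex fps"
    by (cases n) simp_all
  have cancel: "of_nat (n + 1) * (x / fact (n + 1)) = x / (fact n :: complex)" for x
  proof -
    have "(of_nat (n + 1) :: complex) \<noteq> 0" by (simp only: of_nat_eq_0_iff)
    moreover have "(fact (n + 1) :: complex) = of_nat (n + 1) * fact n" by simp
    ultimately show ?thesis by (simp del: of_nat_add of_nat_Suc)
  qed
  have "fps_nth (borel_op b (Abs_fps (\<lambda>n. fps_nth h n / fact n))) n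
      = of_nat n * (of_nat (n + 1) * (fps_nth h (n + 1) / fact (n + 1)))
        + (of_nat (n + 1) * (fps_nth h (n + 1) / fact (n + 1)) + of_nat n * (fps_nth h n / fact n) + - b * (fps_nth h n / fact n))"
    by (simp only: borel_op_def pc fps_add_nth fps_of_poly_1 mult_1_left distrib_right X fps_deriv_nth
        fps_mult_left_const_nth fps_nth_Abs_fps)
  also have "\<dots> = (of_nat (n + 1) * fps_nth h (n + 1) + of_nat n * fps_nth h n - b * fps_nth h n) / fact n"
    unfolding cancel by (simp add: add_divide_distrib diff_divide_distrib distrib_right)
  also have "of_nat (n + 1) * fps_nth h (n + 1) + of_nat n * fps_nth h n - b * fps_nth h n = fps_nth (binomial_op b h) n"
    by (simp only: binomial_op_def fps_add_nth fps_sub_nth mult_1_left distrib_right X fps_deriv_nth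
        fps_mult_left_const_nth)
  finally show "fps_nth (borel_op b (Abs_fps (\<lambda>n. fps_nth h n / fact n))) n
      = fps_nth (Abs_fps (\<lambda>n. fps_nth (binomial_op b h) n / fact n)) n" by simp
qed

lemma borel_op_funpow_borel:
  "(borel_op b ^^ k) (Abs_fps (\<lambda>n. fps_nth h n / fact n)) = Abs_fps (\<lambda>n. fps_nth ((binomial_op b ^^ k) h) n / fact n)"
  by (induction k) (simp_all add: borel_op_borel)

lemma binomial_op_const_mult: "binomial_op b (fps_const c * h) = fps_const c * binomial_op b h"
  by (simp add: binomial_op_def algebra_simps)

lemma binomial_op_funpow_const_mult: "(binomial_op b ^^ k) (fps_const c * h) = fps_const c * (binomial_op b ^^ k) h"
  by (induction k) (simp_all add: binomial_op_const_mult)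

text \<open>The operator annihilates (1 + x)^b and so differentiates only the logarithm, whose
  derivative is 1 / (1 + x). For k = 0 the factor \<open>of_nat k\<close> makes the right side
  vanish.\<close>

lemma binomial_op_binomial_log:
  "binomial_op b (fps_binomial b * fps_ln 1 ^ k) = fps_const (of_nat k) * (fps_binomial b * fps_ln 1 ^ (k - 1))"
proof -
  have inv: "(1 + fps_X) * inverse (1 + fps_X) = (1 :: complex fps)"
    by (rule inverse_mult_eq_1') simp
  have 1: "(1 + fps_X) * fps_deriv (fps_binomial b) = fps_const b * fps_binomial b"
    unfolding fps_binomial_deriv using inv by (simp add: fps_divide_unit mult_ac)
  have 2: "(1 + fps_X) * fps_deriv (fps_ln 1 :: complex fps) = 1"
    unfolding fps_ln_deriv using inv by simp
  have "(1 + fps_X) * fps_deriv (fps_binomial b * fps_ln 1 ^ k)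
      = ((1 + fps_X) * fps_deriv (fps_binomial b)) * fps_ln 1 ^ k
        + fps_binomial b * (of_nat k * ((1 + fps_X) * fps_deriv (fps_ln 1)) * fps_ln 1 ^ (k - 1))"
    by (simp add: fps_deriv_power' algebra_simps)
  also have "\<dots> = fps_const b * (fps_binomial b * fps_ln 1 ^ k) + fps_const (of_nat k) * (fps_binomial b * fps_ln 1 ^ (k - 1))"
    unfolding 1 2 by (simp add: fps_of_nat mult_ac)
  finally show ?thesis by (simp add: binomial_op_def)
qed

lemma binomial_op_funpow_binomial_log: "(binomial_op b ^^ Suc k) (fps_binomial b * fps_ln 1 ^ k) = 0"
proof (induction k)
  case 0
  then show ?case using binomial_op_binomial_log[of b 0] by simp
next
  case (Suc k)
  have "(binomial_op b ^^ Suc (Suc k)) (fps_binomial b * fps_ln 1 ^ Suc k)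
      = (binomial_op b ^^ Suc k) (binomial_op b (fps_binomial b * fps_ln 1 ^ Suc k))"
    by (subst funpow_Suc_right) simp
  also have "\<dots> = fps_const (of_nat (Suc k)) * (binomial_op b ^^ Suc k) (fps_binomial b * fps_ln 1 ^ k)"
    by (subst binomial_op_binomial_log, subst binomial_op_funpow_const_mult) simp
  finally show ?case using Suc.IH by simp
qed

lemma G_function_binomial_log:
  fixes a :: rat
  assumes "0 < a"
  shows "G_function (fps_binomial (of_rat a - 1) * fps_ln 1 ^ s)"
proof -
  let ?b = "of_rat a - 1 :: complex"
  let ?g = "fps_binomial ?b * fps_ln 1 ^ s"
  have r: "arith_geom (fps_nth ?g)" by (rule arith_geom_binomial_log[OF assms])
  have b: "?b \<in> \<rat>" by (intro Rats_diff Rats_of_rat Rats_1)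
  have "(borel_op ?b ^^ Suc s) (Abs_fps (\<lambda>n. fps_nth ?g n / fact n)) = 0"
    unfolding borel_op_funpow_borel binomial_op_funpow_binomial_log by (simp add: fps_eq_iff)
  then have "satisfies_linear_ode (Abs_fps (\<lambda>n. fps_nth ?g n / fact n))"
    by (rule rat_op_ode[OF rat_op_borel_op[OF b]])
  then have "E_function (Abs_fps (\<lambda>n. fps_nth ?g n / fact n))"
    by (intro E_functionI[of 0 "fps_nth ?g"] r) auto
  then show ?thesis
    using arith_geom_rational[OF r] Rats_subset_Qbar unfolding G_function_def by blast
qed

section \<open>The Borel-Laplace integral as an element of \<open>D_values\<close>\<close>

lemma has_fps_expansion_Ln: "(\<lambda>u::complex. ln (1 + u)) has_fps_expansion fps_ln 1"
proof (rule has_fps_expansionI)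
  have "eventually (\<lambda>u::complex. u \<in> ball 0 1) (nhds 0)" by (intro eventually_nhds_in_open) auto
  then show "eventually (\<lambda>u. (\<lambda>n. fps_nth (fps_ln 1) n * u ^ n) sums ln (1 + u :: complex)) (nhds 0)"
  proof eventually_elim
    case (elim u)
    have "fps_nth (fps_ln 1) n = (- 1) ^ Suc n / (of_nat n :: complex)" for n
      by (cases n) (simp_all add: fps_ln_nth)
    then show ?case using Ln_series[of u] elim by simp
  qed
qed

lemma of_real_of_rat: "of_real (of_rat a) = (of_rat a :: complex)"
  by (cases a) (simp add: of_rat_rat)

text \<open>The Borel transform can be singular only at u = -1, opposite to the ray of integration.
  A sector of half-angle 1 < pi / 2 stays in the right half-plane, where the principal branches are
  holomorphic and grow at most exponentially.\<close>

lemma borel_continuation_binomial_log: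
  fixes b :: real
  assumes f: "borel_transform f = fps_binomial (of_real b) * fps_ln 1 ^ s"
  shows "borel_continuation f 0 (\<lambda>u. (1 + u) powr of_real b * ln (1 + u) ^ s)"
  unfolding borel_continuation_def
proof (intro conjI)
  show "(\<lambda>u. (1 + u) powr of_real b * ln (1 + u) ^ s) has_fps_expansion borel_transform f"
    unfolding f by (intro has_fps_expansion_mult has_fps_expansion_binomial_complex has_fps_expansion_power has_fps_expansion_Ln)
  have pos: "0 < Re u" if u: "u \<in> sector (- 0) 1" for u
  proof -
    obtain r \<psi> where u: "u = rcis r \<psi>" "0 < r" "\<bar>\<psi> - (- 0)\<bar> < 1"
      using u unfolding sector_def by blast
    have "0 < cos \<psi>" using u(3) pi_gt3 by (intro cos_gt_zero_pi) auto
    then show ?thesis using u by (simp add: rcis_def)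
  qed
  have bound: "norm ((1 + u) powr of_real b * ln (1 + u) ^ s) \<le> (fact s * exp pi) * exp ((\<bar>b\<bar> + 1) * norm u)"
    if "0 < Re u" for u :: complex
  proof -
    have nz: "1 + u \<noteq> 0" using that by (auto simp: complex_eq_iff)
    have ge: "1 \<le> norm (1 + u)" using that complex_Re_le_cmod[of "1 + u"] by simp
    have le: "norm (1 + u) \<le> 1 + norm u" using norm_triangle_ineq[of 1 u] by simp
    have l0: "0 \<le> ln (norm (1 + u))" using ge by simp
    have "0 < norm (1 + u)" "0 < 1 + norm u" using ge le by linarith+
    then have "ln (norm (1 + u)) \<le> ln (1 + norm u)" using le by (simp only: ln_le_cancel_iff)
    then have l1: "ln (norm (1 + u)) \<le> norm u" using ln_add_one_self_le_self[of "norm u"] by simp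
    have "norm ((1 + u) powr of_real b) = exp (b * ln (norm (1 + u)))"
      using nz by (simp add: powr_def norm_exp_eq_Re)
    also have "b * ln (norm (1 + u)) \<le> \<bar>b\<bar> * norm u"
      using mult_mono[OF abs_ge_self l1 abs_ge_zero l0, of b] .
    finally have p: "norm ((1 + u) powr of_real b) \<le> exp (\<bar>b\<bar> * norm u)" by simp
    have "norm (ln (1 + u)) \<le> \<bar>Re (ln (1 + u))\<bar> + \<bar>Im (ln (1 + u))\<bar>" by (rule cmod_le)
    also have "\<dots> \<le> norm u + pi"
      using nz l0 l1 Im_Ln_le_pi[OF nz] mpi_less_Im_Ln[OF nz] by (intro add_mono) auto
    finally have "norm (ln (1 + u)) ^ s \<le> (norm u + pi) ^ s" by (intro power_mono) auto
    also have "\<dots> \<le> fact s * exp (norm u + pi)" by (intro power_le_fact_exp) auto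
    finally have "norm (ln (1 + u) ^ s) \<le> fact s * exp (norm u + pi)" by (simp add: norm_power)
    then have "norm ((1 + u) powr of_real b) * norm (ln (1 + u) ^ s) \<le> exp (\<bar>b\<bar> * norm u) * (fact s * exp (norm u + pi))"
      using p by (intro mult_mono) auto
    also have "\<dots> = (fact s * exp pi) * exp ((\<bar>b\<bar> + 1) * norm u)" by (simp add: exp_add algebra_simps)
    finally show ?thesis by (simp add: norm_mult)
  qed
  show "\<exists>\<epsilon>>0. (\<lambda>u. (1 + u) powr of_real b * ln (1 + u) ^ s) holomorphic_on sector (- 0) \<epsilon> \<and>
        (\<exists>K B. \<forall>u\<in>sector (- 0) \<epsilon>. norm ((1 + u) powr of_real b * ln (1 + u) ^ s) \<le> K * exp (B * norm u))"
  proof (rule exI[of _ "1 :: real"], intro conjI)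
    have "1 + u \<notin> \<real>\<^sub>\<le>\<^sub>0" if "u \<in> sector (- 0) 1" for u
      using pos[OF that] by (auto simp: complex_nonpos_Reals_iff)
    then show "(\<lambda>u. (1 + u) powr of_real b * ln (1 + u) ^ s) holomorphic_on sector (- 0) 1"
      by (intro holomorphic_intros) auto
    show "\<exists>K B. \<forall>u\<in>sector (- 0) 1. norm ((1 + u) powr of_real b * ln (1 + u) ^ s) \<le> K * exp (B * norm u)"
      using bound pos by blast
  qed simp
qed

lemma binomial_log_integral_in_D_values:
  fixes a :: rat
  assumes a: "0 < a"
    and v: "((\<lambda>u. (1 + u) powr (of_rat a - 1) * ln (1 + u) ^ s * exp (- u)) has_integral v) {0..}"
  shows "complex_of_real v \<in> D_values"
proof -
  let ?b = "of_rat a - 1 :: real"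
  define g :: "complex fps" where "g = fps_binomial (of_rat a - 1) * fps_ln 1 ^ s"
  define f where "f = Abs_fps (\<lambda>n. fact n * fps_nth g n)"
  have "Rev_E_function f"
    unfolding Rev_E_function_def f_def using G_function_binomial_log[OF a, of s] g_def by blast
  have "borel_transform f = g" by (simp add: borel_transform_def f_def fps_eq_iff)
  also have "g = fps_binomial (of_real ?b) * fps_ln 1 ^ s" by (simp add: g_def of_real_of_rat)
  finally have bc: "borel_continuation f 0 (\<lambda>u. (1 + u) powr of_real ?b * ln (1 + u) ^ s)"
    by (rule borel_continuation_binomial_log)
  then have "\<not> anti_Stokes f 0" unfolding anti_Stokes_def by blast
  have "((\<lambda>r. complex_of_real ((1 + r) powr ?b * ln (1 + r) ^ s * exp (- r))) has_integral of_real v) {0..}"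
    using v by (rule has_integral_of_real)
  then have "((\<lambda>r. (1 + rcis r (- 0)) powr of_real ?b * ln (1 + rcis r (- 0)) ^ s * exp (- 1 * rcis r (- 0)) * cis (- 0))
      has_integral of_real v) {0..}"
  proof (rule has_integral_eq[rotated])
    fix r :: real assume "r \<in> {0..}"
    then have r: "0 < 1 + r" by simp
    have "complex_of_real ((1 + r) powr ?b) = (1 + of_real r) powr of_real ?b"
      using powr_of_real[of "1 + r" ?b] r by simp
    moreover have "complex_of_real (ln (1 + r)) = ln (1 + of_real r)"
      using Ln_of_real[OF r] by simp
    moreover have "complex_of_real (exp (- r)) = exp (- of_real r)" by (simp add: exp_of_real[symmetric])
    ultimately show "complex_of_real ((1 + r) powr ?b * ln (1 + r) ^ s * exp (- r))
        = (1 + rcis r (- 0)) powr of_real ?b * ln (1 + rcis r (- 0)) ^ s * exp (- 1 * rcis r (- 0)) * cis (- 0)"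
      by (simp only: of_real_mult of_real_power rcis_def minus_zero cis_zero mult_1_right mult_minus1)
  qed
  with bc have "has_1_sum f 0 1 (of_real v)"
    unfolding has_1_sum_def by (intro conjI exI[of _ "of_real v"] exI) auto
  then show ?thesis
    unfolding D_values_def using \<open>Rev_E_function f\<close> \<open>\<not> anti_Stokes f 0\<close> by auto
qed

text \<open>Up to the factor \<open>(- 1)\<^sup>s s!\<close>, the series with \<open>\<kappa> = a\<close> and \<open>j = s + 1\<close> takes at 1 the value of the
  integral of \<open>t\<^sup>a\<^sup>-\<^sup>1 (ln t)\<^sup>s e\<^sup>-\<^sup>t\<close> over \<open>[0, 1]\<close>.\<close>

definition gamma_series :: "complex \<Rightarrow> nat \<Rightarrow> complex fps" where
  "gamma_series \<kappa> j = Abs_fps (\<lambda>n. (- 1) ^ n / (fact n * (\<kappa> + of_nat n) ^ j))"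

lemma gamma_series_0: "gamma_series \<kappa> 0 = fps_exp (- 1)"
  by (simp add: gamma_series_def fps_eq_iff)

lemma gamma_series_euler:
  assumes "\<And>n. \<kappa> + of_nat n \<noteq> 0"
  shows "fps_X * fps_deriv (gamma_series \<kappa> (Suc j)) = - (fps_const \<kappa> * gamma_series \<kappa> (Suc j)) + gamma_series \<kappa> j"
proof (rule fps_ext)
  fix n :: nat
  have "fps_nth (fps_X * fps_deriv F) n = of_nat n * fps_nth F n" for F :: "complex fps"
    by (cases n) simp_all
  moreover have "fps_nth (gamma_series \<kappa> j) n = (\<kappa> + of_nat n) * fps_nth (gamma_series \<kappa> (Suc j)) n"
    using assms[of n] by (simp add: gamma_series_def)
  ultimately show "fps_nth (fps_X * fps_deriv (gamma_series \<kappa> (Suc j))) n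
      = fps_nth (- (fps_const \<kappa> * gamma_series \<kappa> (Suc j)) + gamma_series \<kappa> j) n"
    by (simp only: fps_add_nth fps_neg_nth fps_mult_left_const_nth) (simp add: algebra_simps)
qed

lemma arith_geom_egf_gamma_series:
  assumes "0 < a"
  shows "arith_geom (egf (gamma_series (of_rat a) j))"
proof -
  have "egf (gamma_series (of_rat a) j) = (\<lambda>n. (- 1) ^ n / (of_rat a + of_nat n) ^ j)"
    by (auto simp: egf_def gamma_series_def fun_eq_iff)
  then show ?thesis using arith_geom_reciprocal_powers[OF assms, of j] by simp
qed

lemma arith_geom_egf_of_int: "arith_geom (egf (fps_const (of_int z)))"
proof (rule arith_geomI[where D = "\<lambda>_. 1" and C = 1 and C' = "nat \<bar>z\<bar> + 1"])
  fix n k :: nat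
  have "norm (egf (fps_const (of_int z)) n) \<le> real_of_int \<bar>z\<bar>" by (simp add: egf_def)
  also have "\<dots> \<le> real (nat \<bar>z\<bar> + 1) ^ 1" by simp
  also have "\<dots> \<le> real (nat \<bar>z\<bar> + 1) ^ (n + 1)" by (intro power_increasing) auto
  finally show "norm (egf (fps_const (of_int z)) n) \<le> real (nat \<bar>z\<bar> + 1) ^ (n + 1)" .
  show "of_nat 1 * egf (fps_const (of_int z)) k \<in> \<int>" by (simp add: egf_def)
qed auto

lemma arith_geom_egf_exp: "arith_geom (egf (fps_exp 1))"
  by (rule arith_geomI[where D = "\<lambda>_. 1" and C = 1 and C' = 1]) (auto simp: egf_def)

text \<open>Conjugation of \<open>x d/dx + \<kappa>\<close>, which lowers the index of \<open>gamma_series \<kappa>\<close>, by the exponential.\<close>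

definition exp_twist :: "complex \<Rightarrow> complex fps \<Rightarrow> complex fps" where
  "exp_twist \<kappa> F = fps_of_poly [:0, 1:] * fps_deriv F + fps_of_poly [:\<kappa>, - 1:] * F"

lemma rat_op_exp_twist:
  assumes "\<kappa> \<in> \<rat>"
  shows "rat_op k (exp_twist \<kappa> ^^ k)"
proof (induction k)
  case 0
  then show ?case using rat_op_id by (simp add: id_def)
next
  case (Suc k)
  have "rat_op (Suc k) (\<lambda>F. exp_twist \<kappa> ((exp_twist \<kappa> ^^ k) F))"
    unfolding exp_twist_def[of \<kappa> "(exp_twist \<kappa> ^^ k) _"]
    by (rule rat_op_combine[OF rat_op_deriv[OF Suc] Suc]) (use assms in \<open>auto simp: coeff_pCons split: nat.split\<close>)
  then show ?case by simp
qed

text \<open>Each twist lowers the index of the gamma series by one and multiplies \<open>A\<close>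
  by \<kappa>. At index 0 the series is exp (-x), which the factor exp (x) cancels, leaving the
  constant.\<close>

lemma exp_twist_gamma_series:
  assumes "\<And>n. \<kappa> + of_nat n \<noteq> 0"
  shows "(exp_twist \<kappa> ^^ k) (fps_exp 1 * (fps_const A - fps_const c * gamma_series \<kappa> k))
    = fps_exp 1 * fps_const (A * \<kappa> ^ k) - fps_const c"
proof (induction k arbitrary: A)
  case 0
  have "fps_exp 1 * gamma_series \<kappa> 0 = 1"
    unfolding gamma_series_0 fps_exp_add_mult[symmetric] by simp
  then show ?case by (simp add: right_diff_distrib mult.left_commute)
next
  case (Suc k)
  let ?G = "fps_const A - fps_const c * gamma_series \<kappa> (Suc k)"
  have pc: "fps_of_poly [:0, 1:] = (fps_X :: complex fps)" "fps_of_poly [:\<kappa>, - 1:] = fps_const \<kappa> - fps_X"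
    by (auto simp: fps_of_poly_pCons fps_of_poly_const)
  have "exp_twist \<kappa> (fps_exp 1 * ?G) = fps_exp 1 * (fps_X * fps_deriv ?G + fps_const \<kappa> * ?G)"
    unfolding exp_twist_def pc by (simp add: algebra_simps)
  also have "fps_X * fps_deriv ?G = - (fps_const c * (fps_X * fps_deriv (gamma_series \<kappa> (Suc k))))"
    by (simp add: algebra_simps)
  also have "\<dots> + fps_const \<kappa> * ?G = fps_const (A * \<kappa>) - fps_const c * gamma_series \<kappa> k"
    unfolding gamma_series_euler[OF assms] by (simp add: algebra_simps flip: fps_const_mult)
  finally have "exp_twist \<kappa> (fps_exp 1 * ?G) = fps_exp 1 * (fps_const (A * \<kappa>) - fps_const c * gamma_series \<kappa> k)" .
  then show ?case unfolding funpow_Suc_right comp_def by (simp only: Suc.IH) (simp add: mult_ac)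
qed

lemma of_rat_pos_add_of_nat_neq_0:
  fixes a :: rat
  assumes "0 < a"
  shows "of_rat a + of_nat n \<noteq> (0 :: complex)"
proof -
  have "of_rat a + of_nat n = (of_rat (a + of_nat n) :: complex)" by (simp add: of_rat_add)
  moreover have "a + of_nat n \<noteq> 0" using assms by (simp add: add_pos_nonneg less_imp_neq[symmetric])
  ultimately show ?thesis by simp
qed

text \<open>The algebraic number \<open>A\<close> enters e^x (A - c f) as the constant part of all
  exponential coefficients, which is the shape that \<open>E_functionI\<close> handles.\<close>

lemma gamma_series_E_value:
  fixes a :: rat
  assumes a: "0 < a" and A: "algebraic A"
  shows "exp 1 * (A - of_int c * eval_fps (gamma_series (of_rat a) r) 1) \<in> E_values"
proof -
  let ?f = "gamma_series (of_rat a) r"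
  define h where "h = fps_exp 1 * (fps_const A - fps_const (of_int c) * ?f)"
  note nz = of_rat_pos_add_of_nat_neq_0[OF a]
  let ?L = "exp_twist (of_rat a) ^^ r"
  have L: "rat_op r ?L" by (rule rat_op_exp_twist) simp
  \<comment> \<open>The \<open>r\<close> twists leave a multiple of exp (x) and a constant; D^2 - D
    annihilates both.\<close>
  have "rat_op (Suc (Suc r)) (\<lambda>F. fps_of_poly 1 * fps_deriv (fps_deriv (?L F)) + fps_of_poly (- 1) * fps_deriv (?L F))"
    by (rule rat_op_combine[OF rat_op_deriv[OF rat_op_deriv[OF L]] rat_op_deriv[OF L]]) (auto simp: coeff_1)
  moreover have "fps_of_poly 1 * fps_deriv (fps_deriv (?L h)) + fps_of_poly (- 1) * fps_deriv (?L h) = 0"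
    unfolding h_def exp_twist_gamma_series[OF nz] by (simp add: fps_of_poly_uminus)
  ultimately have ode: "satisfies_linear_ode h" by (rule rat_op_ode)
  define r' where "r' = egf (fps_const (of_int (- c)) * (fps_exp 1 * ?f))"
  have "arith_geom r'"
    unfolding r'_def by (intro arith_geom_egf_mult arith_geom_egf_of_int arith_geom_egf_exp arith_geom_egf_gamma_series a)
  moreover have "h = Abs_fps (\<lambda>n. (A + r' n) / fact n)"
  proof (rule fps_ext)
    fix n
    have "h = fps_const A * fps_exp 1 + fps_const (of_int (- c)) * (fps_exp 1 * ?f)"
      by (simp add: h_def algebra_simps flip: fps_const_neg)
    moreover have "r' n / fact n = fps_nth (fps_const (of_int (- c)) * (fps_exp 1 * ?f)) n"
      by (simp add: r'_def egf_def)
    ultimately show "fps_nth h n = fps_nth (Abs_fps (\<lambda>n. (A + r' n) / fact n)) n"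
      by (simp add: add_divide_distrib del: of_int_minus)
  qed
  ultimately have E: "E_function h" using E_functionI[OF A _ _ ode] by blast
  have rad: "fps_conv_radius ?f = \<infinity>" by (rule fps_conv_radius_egf[OF arith_geom_egf_gamma_series[OF a]])
  have "fps_conv_radius (fps_const (of_int c) * ?f) \<ge> min (fps_conv_radius (fps_const (of_int c :: complex))) (fps_conv_radius ?f)"
    by (rule fps_conv_radius_mult)
  then have rad2: "fps_conv_radius (fps_const (of_int c) * ?f) = \<infinity>" using rad by simp
  have "fps_conv_radius (fps_const A - fps_const (of_int c) * ?f)
      \<ge> min (fps_conv_radius (fps_const A)) (fps_conv_radius (fps_const (of_int c) * ?f))"
    by (rule fps_conv_radius_diff)
  then have rad3: "fps_conv_radius (fps_const A - fps_const (of_int c) * ?f) = \<infinity>" using rad2 by simp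
  have "eval_fps h 1 = exp 1 * (A - of_int c * eval_fps ?f 1)"
    unfolding h_def by (simp add: eval_fps_mult eval_fps_diff rad rad2 rad3)
  moreover have "1 \<in> Qbar" using Rats_subset_Qbar by auto
  ultimately show ?thesis unfolding E_values_def using E by force
qed

section \<open>Algebraic independence and the conclusion\<close>

lemma rationally_dependent_family:
  fixes a :: "'e \<Rightarrow> 'i \<Rightarrow> rat" and t :: "'e \<Rightarrow> 'a::field_char_0" and x :: "'i \<Rightarrow> 'a"
  assumes fin: "finite I" "finite J" and card: "card J < card I"
    and x: "\<And>i. i \<in> I \<Longrightarrow> x i = (\<Sum>e\<in>J. of_rat (a e i) * t e)"
  obtains b :: "'i \<Rightarrow> int" where "\<exists>i\<in>I. b i \<noteq> 0" "(\<Sum>i\<in>I. of_int (b i) * x i) = 0"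
proof -
  obtain h where h: "bij_betw h {..<card I} I"
    using ex_bij_betw_nat_finite[OF fin(1)] by (auto simp: atLeast0LessThan)
  obtain g where g: "bij_betw g {..<card J} J"
    using ex_bij_betw_nat_finite[OF fin(2)] by (auto simp: atLeast0LessThan)
  have "x (h k) = (\<Sum>e<card J. of_rat (a (g e) (h k)) * t (g e))" if "k < card I" for k
    using x[OF bij_betwE[OF h, rule_format, of k]] that
      sum.reindex_bij_betw[OF g, of "\<lambda>e. of_rat (a e (h k)) * t e"] by simp
  then obtain b :: "nat \<Rightarrow> int" where b: "\<exists>k<card I. b k \<noteq> 0" "(\<Sum>k<card I. of_int (b k) * x (h k)) = 0"
    by (rule rationally_dependent[OF card]) blast+
  let ?h' = "the_inv_into {..<card I} h"
  have h': "?h' (h k) = k" if "k < card I" for k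
    using the_inv_into_f_f[of h "{..<card I}" k] h that by (auto simp: bij_betw_def)
  show thesis
  proof (rule that[of "\<lambda>i. b (?h' i)"])
    obtain k where k: "k < card I" "b k \<noteq> 0" using b(1) by blast
    then show "\<exists>i\<in>I. b (?h' i) \<noteq> 0"
      using h' bij_betwE[OF h] by (intro bexI[of _ "h k"]) auto
    have "(\<Sum>i\<in>I. of_int (b (?h' i)) * x i) = (\<Sum>k<card I. of_int (b (?h' (h k))) * x (h k))"
      by (rule sum.reindex_bij_betw[OF h, symmetric])
    also have "\<dots> = (\<Sum>k<card I. of_int (b k) * x (h k))" by (intro sum.cong) (auto simp: h')
    finally show "(\<Sum>i\<in>I. of_int (b (?h' i)) * x i) = 0" using b(2) by simp
  qed
qed

text \<open>To be used with x = 1/e and F = f(1). As F = (A - x v) / c, every x^j F^k lies in the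
  rational span of the A^l v^l' x^t with l < dA, l' < dv and t \<le> 2 L; this grows linearly in L,
  the number of products quadratically.\<close>

lemma algebraic_combination_dependent:
  fixes A v x F :: complex and c :: int
  assumes A: "algebraic A" and v: "algebraic v" and c: "c \<noteq> 0" and F: "A = of_int c * F + x * v"
  obtains L and b :: "nat \<times> nat \<Rightarrow> int" where "\<exists>j\<le>L. \<exists>k\<le>L. b (j, k) \<noteq> 0"
    "(\<Sum>j\<le>L. \<Sum>k\<le>L. of_int (b (j, k)) * (x ^ j * F ^ k)) = 0"
proof -
  obtain dA :: nat and cA :: "nat \<Rightarrow> nat \<Rightarrow> rat" where cA: "\<And>k. A ^ k = (\<Sum>l<dA. of_rat (cA k l) * A ^ l)"
    using algebraic_power_reduction[OF A] by blast
  obtain dv :: nat and cv :: "nat \<Rightarrow> nat \<Rightarrow> rat" where cv: "\<And>k. v ^ k = (\<Sum>l<dv. of_rat (cv k l) * v ^ l)"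
    using algebraic_power_reduction[OF v] by blast
  \<comment> \<open>The span then has at most dA dv (2 L + 1) = L^2 + L / 2 generators, fewer than
    (L + 1)^2.\<close>
  define L where "L = 2 * (dA * dv)"
  define I where "I = {..L} \<times> {..L}"
  define J where "J = {..<dA} \<times> ({..<dv} \<times> {..2 * L})"
  have card: "card J < card I"
    by (simp add: I_def J_def L_def card_cartesian_product algebra_simps)
  define w :: "nat \<Rightarrow> nat \<Rightarrow> rat" where "w k i = of_nat (k choose i) * (- 1) ^ i / of_int c ^ k" for k i
  define m :: "nat \<Rightarrow> nat \<Rightarrow> nat \<Rightarrow> nat \<times> nat \<times> nat \<Rightarrow> rat"
    where "m i j k = (\<lambda>(l, l', t). if t = i + j then cA (k - i) l * cv i l' else 0)" for i j k
  define T where "T = (\<lambda>(l, l', t). A ^ l * (v ^ l' * x ^ t))"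
  define a :: "nat \<times> nat \<times> nat \<Rightarrow> nat \<times> nat \<Rightarrow> rat"
    where "a e = (\<lambda>(j, k). \<Sum>i\<le>k. w k i * m i j k e)" for e
  have mono: "A ^ (k - i) * (v ^ i * x ^ (i + j)) = (\<Sum>e\<in>J. of_rat (m i j k e) * T e)"
    if "i \<le> k" "j \<le> L" "k \<le> L" for i j k
  proof -
    have inner: "(\<Sum>t\<le>2 * L. of_rat (m i j k (l, l', t)) * T (l, l', t))
        = (of_rat (cA (k - i) l) * A ^ l) * ((of_rat (cv i l') * v ^ l') * x ^ (i + j))" for l l'
    proof -
      have "(\<Sum>t\<le>2 * L. of_rat (m i j k (l, l', t)) * T (l, l', t))
          = (\<Sum>t\<le>2 * L. if t = i + j then of_rat (cA (k - i) l * cv i l') * (A ^ l * (v ^ l' * x ^ t)) else 0)"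
        by (intro sum.cong) (auto simp: m_def T_def)
      also have "\<dots> = of_rat (cA (k - i) l * cv i l') * (A ^ l * (v ^ l' * x ^ (i + j)))"
        using that by simp
      finally show ?thesis by (simp add: of_rat_mult)
    qed
    have "(\<Sum>e\<in>J. of_rat (m i j k e) * T e) = (\<Sum>l<dA. \<Sum>l'<dv. \<Sum>t\<le>2 * L. of_rat (m i j k (l, l', t)) * T (l, l', t))"
      unfolding J_def sum.cartesian_product by (intro sum.cong) auto
    also have "\<dots> = (\<Sum>l<dA. of_rat (cA (k - i) l) * A ^ l) * ((\<Sum>l'<dv. of_rat (cv i l') * v ^ l') * x ^ (i + j))"
      unfolding inner by (simp only: sum_distrib_left sum_distrib_right) (rule sum.swap)
    finally show ?thesis unfolding cA[symmetric] cv[symmetric] by simp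
  qed
  have span: "x ^ j * F ^ k = (\<Sum>e\<in>J. of_rat (a e (j, k)) * T e)" if "j \<le> L" "k \<le> L" for j k
  proof -
    have c': "of_int c \<noteq> (0 :: complex)" using c by simp
    have "F = (- (x * v) + A) / of_int c" using F c' by (simp add: field_simps)
    then have "F ^ k = (\<Sum>i\<le>k. of_nat (k choose i) * (- (x * v)) ^ i * A ^ (k - i)) / of_int c ^ k"
      by (simp only: power_divide binomial_ring)
    also have "\<dots> = (\<Sum>i\<le>k. of_rat (w k i) * (A ^ (k - i) * (v ^ i * x ^ i)))"
      unfolding sum_divide_distrib
      by (intro sum.cong refl) (simp add: w_def of_rat_mult of_rat_divide of_rat_power of_rat_minus power_minus[of "x * v"] power_mult_distrib)
    finally have "x ^ j * F ^ k = (\<Sum>i\<le>k. of_rat (w k i) * (A ^ (k - i) * (v ^ i * x ^ (i + j))))"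
      by (simp add: sum_distrib_left power_add mult_ac)
    also have "\<dots> = (\<Sum>i\<le>k. \<Sum>e\<in>J. of_rat (w k i * m i j k e) * T e)"
      using that by (intro sum.cong refl) (simp add: mono of_rat_mult sum_distrib_left mult.assoc)
    also have "\<dots> = (\<Sum>e\<in>J. of_rat (a e (j, k)) * T e)"
      by (subst sum.swap) (simp add: a_def of_rat_sum sum_distrib_right)
    finally show ?thesis .
  qed
  have "(case i of (j, k) \<Rightarrow> x ^ j * F ^ k) = (\<Sum>e\<in>J. of_rat (a e i) * T e)" if "i \<in> I" for i
    using that span by (auto simp: I_def)
  moreover have "finite I" "finite J" by (auto simp: I_def J_def)
  ultimately obtain b :: "nat \<times> nat \<Rightarrow> int" where b: "\<exists>i\<in>I. b i \<noteq> 0"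
    "(\<Sum>i\<in>I. of_int (b i) * (case i of (j, k) \<Rightarrow> x ^ j * F ^ k)) = 0"
    using rationally_dependent_family[of I J "\<lambda>i. case i of (j, k) \<Rightarrow> x ^ j * F ^ k" a T] card by blast
  have "(\<Sum>j\<le>L. \<Sum>k\<le>L. of_int (b (j, k)) * (x ^ j * F ^ k)) = (\<Sum>i\<in>I. of_int (b i) * (case i of (j, k) \<Rightarrow> x ^ j * F ^ k))"
    unfolding I_def sum.cartesian_product by (intro sum.cong) auto
  then show thesis using that[of L b] b by (auto simp: I_def)
qed

context exp_tower_functions
begin

text \<open>A relation between the first and the last function of the tower is extended by zero to
  all monomials of degree at most \<open>d\<close>; products of degree at most \<open>L\<close> in
  each of the two stay within \<open>2 * L \<le> d\<close>.\<close>

lemma two_values_independent: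
  fixes c :: "nat \<times> nat \<Rightarrow> int"
  assumes rel: "(\<Sum>j\<le>L. \<Sum>k\<le>L. of_int (c (j, k)) * (eval_fps (y 0) 1 ^ j * eval_fps (y q) 1 ^ k)) = 0"
    and L: "2 * L \<le> d" "j0 \<le> L" "k0 \<le> L"
  shows "c (j0, k0) = 0"
proof -
  define e :: "nat \<times> nat \<Rightarrow> nat \<Rightarrow> nat" where "e p = (\<lambda>i. if i = 0 then fst p else if i = q then snd p else 0)" for p
  let ?S = "{..L} \<times> {..L}"
  have e0: "e p 0 = fst p" "e p q = snd p" for p using q by (auto simp: e_def)
  have two: "{0, q} \<subseteq> {..q}" "0 \<noteq> q" using q by auto
  have inj: "inj_on e ?S" by (rule inj_onI) (metis e0 prod_eqI)
  have sub: "e ` ?S \<subseteq> mons"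
  proof (intro subsetI, elim imageE)
    fix k p assume p: "p \<in> ?S" "k = e p"
    have "(\<Sum>j\<le>q. e p j) = (\<Sum>j\<in>{0, q}. e p j)"
      by (rule sum.mono_neutral_right) (use two in \<open>auto simp: e_def\<close>)
    also have "\<dots> \<le> d" using p L two(2) by (auto simp: e0)
    finally show "k \<in> mons" using p(2) by (auto simp: mons_def e_def)
  qed
  have prod: "(\<Prod>j\<le>q. eval_fps (y j) 1 ^ e p j) = eval_fps (y 0) 1 ^ fst p * eval_fps (y q) 1 ^ snd p" for p
  proof -
    have "(\<Prod>j\<le>q. eval_fps (y j) 1 ^ e p j) = (\<Prod>j\<in>{0, q}. eval_fps (y j) 1 ^ e p j)"
      by (rule prod.mono_neutral_right) (use two in \<open>auto simp: e_def\<close>)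
    then show ?thesis using two(2) by (simp add: e0)
  qed
  define C where "C k = (if k \<in> e ` ?S then c (k 0, k q) else 0)" for k
  have "(\<Sum>k\<in>mons. of_int (C k) * (\<Prod>j\<le>q. eval_fps (y j) 1 ^ k j))
      = (\<Sum>k\<in>e ` ?S. of_int (C k) * (\<Prod>j\<le>q. eval_fps (y j) 1 ^ k j))"
    by (rule sum.mono_neutral_right) (use finite_mons sub in \<open>auto simp: C_def\<close>)
  also have "\<dots> = (\<Sum>p\<in>?S. of_int (c p) * (eval_fps (y 0) 1 ^ fst p * eval_fps (y q) 1 ^ snd p))"
    unfolding sum.reindex[OF inj] by (intro sum.cong) (auto simp: C_def e0 prod)
  also have "\<dots> = (\<Sum>j\<le>L. \<Sum>k\<le>L. of_int (c (j, k)) * (eval_fps (y 0) 1 ^ j * eval_fps (y q) 1 ^ k))"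
    unfolding sum.cartesian_product by (intro sum.cong) auto
  finally have "(\<Sum>k\<in>mons. of_int (C k) * (\<Prod>j\<le>q. eval_fps (y j) 1 ^ k j)) = 0" using rel by simp
  moreover have "e (j0, k0) \<in> mons" using sub L by auto
  ultimately have "C (e (j0, k0)) = 0" by (rule tower_values_independent)
  then show ?thesis using L by (auto simp: C_def e0)
qed

end

section \<open>The two towers of gamma series\<close>

lemma arith_geom_egf_X: "arith_geom (egf fps_X)"
  by (rule arith_geomI[where D = "\<lambda>_. 1" and C = 1 and C' = 1]) (auto simp: egf_def)

lemma tower_of_nonintegral:
  fixes a :: rat
  assumes a: "0 < a" "a \<notin> \<int>" and r: "1 \<le> r" and d: "1 \<le> d"
  obtains da where "exp_tower_functions r d (of_rat a) 0 1 (gamma_series (of_rat a)) da"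
proof -
  obtain p n :: nat where pn: "0 < p" "0 < n" "of_rat a = (of_nat p / of_nat n :: complex)"
    using positive_rat_as_fraction[OF a(1)] .
  note euler = gamma_series_euler[OF of_rat_pos_add_of_nat_neq_0[OF a(1)]]
  have notint: "of_rat a \<notin> (\<int> :: complex set)"
  proof
    assume "of_rat a \<in> (\<int> :: complex set)"
    then obtain z where "of_rat a = (of_int z :: complex)" by (elim Ints_cases)
    then have "of_rat a = (of_rat (of_int z) :: complex)" by simp
    then have "a = of_int z" by (simp only: of_rat_eq_iff)
    then show False using a(2) by simp
  qed
  have "exp_tower_functions r d (of_rat a) 0 1 (gamma_series (of_rat a)) n"
  proof
    show "1 \<le> r" "1 \<le> d" "0 < n" by (fact r, fact d, fact pn(2))
    show "of_rat a = (0::complex) \<and> poly 1 0 \<noteq> (0::complex) \<or> of_rat a \<notin> (\<int> :: complex set) \<and> degree (1 :: complex poly) = 0 \<and> (1 :: complex poly) \<noteq> 0"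
      using notint by simp
    show "fps_X * fps_deriv (gamma_series (of_rat a) 0) = - (fps_X * gamma_series (of_rat a) 0)"
      "fps_nth (gamma_series (of_rat a) 0) 0 = 1" by (simp_all add: gamma_series_0 flip: fps_const_neg)
    show "fps_X * fps_deriv (gamma_series (of_rat a) 1) = - (fps_const (of_rat a) * gamma_series (of_rat a) 1)
        + fps_of_poly 0 + fps_of_poly 1 * gamma_series (of_rat a) 0"
      using euler[of 0] by simp
    show "fps_X * fps_deriv (gamma_series (of_rat a) j) = - (fps_const (of_rat a) * gamma_series (of_rat a) j)
        + gamma_series (of_rat a) (j - 1)" if "2 \<le> j" for j
      using euler[of "j - 1"] that by simp
    show "arith_geom (egf (gamma_series (of_rat a) j))" for j by (rule arith_geom_egf_gamma_series[OF a(1)])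
    show "of_nat n * of_rat a \<in> (\<int> :: complex set)" using pn by simp
    show "of_nat n * coeff 0 l \<in> (\<int> :: complex set)" for l by simp
    show "of_nat n * coeff 1 l \<in> (\<int> :: complex set)" for l by (simp add: coeff_1)
  qed
  then show thesis by (rule that)
qed

lemma euler_X_power_mult:
  fixes G :: "complex fps"
  shows "fps_X * fps_deriv (fps_X ^ N * G) = of_nat N * (fps_X ^ N * G) + fps_X ^ N * (fps_X * fps_deriv G)"
proof (induction N)
  case (Suc N)
  have "fps_X * fps_deriv (fps_X ^ Suc N * G) = fps_X * (fps_X ^ N * G) + fps_X * (fps_X * fps_deriv (fps_X ^ N * G))"
    by (simp add: mult.assoc distrib_left)
  then show ?case unfolding Suc.IH by (simp add: algebra_simps)
qed simp

text \<open>The left side is the integral of t^(N - 1) e^(-t) from 0 to x. Both sides have the same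
  derivative and no constant term.\<close>

lemma X_power_gamma_series_1:
  assumes "0 < N"
  shows "fps_X ^ N * gamma_series (of_nat N) 1 = fps_const (fact (N - 1)) *
    (1 - Abs_fps (\<lambda>i. if i < N then 1 / fact i else 0) * fps_exp (- 1))" (is "?H = fps_const _ * (1 - ?P * _)")
proof -
  obtain M where M: "N = Suc M" using assms gr0_implies_Suc by blast
  have nz: "of_nat N + of_nat n \<noteq> (0 :: complex)" for n using assms by (simp flip: of_nat_add)
  have "fps_X * fps_deriv ?H = of_nat N * ?H + fps_X ^ N * (fps_X * fps_deriv (gamma_series (of_nat N) (Suc 0)))"
    unfolding One_nat_def by (rule euler_X_power_mult)
  also have "\<dots> = fps_X * (fps_X ^ M * fps_exp (- 1))"
    unfolding gamma_series_euler[OF nz] gamma_series_0 by (simp add: M algebra_simps fps_of_nat[symmetric])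
  finally have H: "fps_deriv ?H = fps_X ^ M * fps_exp (- 1)" by simp
  have P: "?P - fps_deriv ?P = fps_const (1 / fact M) * fps_X ^ M"
    by (rule fps_ext) (auto simp: M fps_X_power_nth divide_simps simp del: of_nat_Suc)
  have "fps_deriv (fps_const (fact (N - 1)) * (1 - ?P * fps_exp (- 1)))
      = fps_const (fact M) * ((?P - fps_deriv ?P) * fps_exp (- 1))"
    by (simp add: M algebra_simps flip: fps_const_neg)
  also have "\<dots> = fps_deriv ?H" unfolding P H by (simp flip: mult.assoc)
  finally have "fps_deriv ?H = fps_deriv (fps_const (fact (N - 1)) * (1 - ?P * fps_exp (- 1)))" ..
  moreover have "fps_nth ?H 0 = 0" "fps_nth (fps_const (fact (N - 1)) * (1 - ?P * fps_exp (- 1))) 0 = 0"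
    using assms by simp_all
  ultimately show ?thesis unfolding fps_deriv_eq_iff by simp
qed

text \<open>Multiplication by x^N shifts the positive integer \<kappa> = N, which neither case of
  \<open>nonelementary\<close> admits, to 0. The elementary first series becomes the inhomogeneity
  B0 + B1 e^(-x) of the next equation, and B1 takes the nonzero value -(N - 1)! at 0.\<close>

lemma tower_of_integral:
  assumes N: "0 < N" and q: "1 \<le> q" and d: "1 \<le> d"
  obtains B0 B1 da where "exp_tower_functions q d 0 B0 B1
    (\<lambda>j. if j = 0 then fps_exp (- 1) else fps_X ^ N * gamma_series (of_nat N) (Suc j)) da"
proof -
  define y where "y j = (if j = 0 then fps_exp (- 1) else fps_X ^ N * gamma_series (of_nat N) (Suc j))" for j
  define B0 :: "complex poly" where "B0 = [:fact (N - 1):]"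
  define B1 :: "complex poly" where "B1 = (\<Sum>i<N. monom (- (fact (N - 1) / fact i)) i)"
  have coeff_B1: "coeff B1 l = (if l < N then - (fact (N - 1) / fact l) else 0)" for l
    unfolding B1_def coeff_sum by (simp add: coeff_monom)
  have nz: "of_nat N + of_nat n \<noteq> (0 :: complex)" for n using N by (simp flip: of_nat_add)
  have euler: "fps_X * fps_deriv (fps_X ^ N * gamma_series (of_nat N) (Suc j)) = fps_X ^ N * gamma_series (of_nat N) j" for j
  proof -
    show ?thesis
      unfolding euler_X_power_mult gamma_series_euler[OF nz] by (simp add: algebra_simps fps_of_nat[symmetric])
  qed
  have B: "fps_of_poly B0 + fps_of_poly B1 * fps_exp (- 1) = fps_X ^ N * gamma_series (of_nat N) 1"
  proof -
    have "fps_of_poly B1 = - (fps_const (fact (N - 1)) * Abs_fps (\<lambda>i. if i < N then 1 / fact i else 0))"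
      by (rule fps_ext) (simp add: coeff_B1)
    then show ?thesis
      unfolding X_power_gamma_series_1[OF N] by (simp add: B0_def fps_of_poly_const algebra_simps)
  qed
  have pos: "0 < (of_nat N :: rat)" using N by simp
  have "exp_tower_functions q d 0 B0 B1 y 1"
  proof
    show "1 \<le> q" "1 \<le> d" "0 < (1 :: nat)" by (fact q, fact d, simp)
    show "(0 :: complex) = 0 \<and> poly B1 0 \<noteq> 0 \<or> (0 :: complex) \<notin> \<int> \<and> degree B1 = 0 \<and> B1 \<noteq> 0"
      using N by (simp add: poly_0_coeff_0 coeff_B1)
    show "fps_X * fps_deriv (y 0) = - (fps_X * y 0)" "fps_nth (y 0) 0 = 1" by (simp_all add: y_def flip: fps_const_neg)
    show "fps_X * fps_deriv (y 1) = - (fps_const 0 * y 1) + fps_of_poly B0 + fps_of_poly B1 * y 0"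
      using euler[of 1] B by (simp add: y_def)
    show "fps_X * fps_deriv (y j) = - (fps_const 0 * y j) + y (j - 1)" if "2 \<le> j" for j
      using euler[of j] that by (simp add: y_def)
    show "arith_geom (egf (y j))" for j
    proof (cases "j = 0")
      case True
      then show ?thesis
        using arith_geom_egf_gamma_series[OF pos, of 0] by (simp add: y_def gamma_series_0)
    next
      case False
      then show ?thesis
        using arith_geom_egf_mult[OF arith_geom_egf_power[OF arith_geom_egf_X] arith_geom_egf_gamma_series[OF pos, of "Suc j"], of N]
        by (simp add: y_def)
    qed
    show "of_nat 1 * 0 \<in> (\<int> :: complex set)" by simp
    show "of_nat 1 * coeff B0 l \<in> \<int>" for l
      by (simp add: B0_def coeff_pCons split: nat.split) (metis Ints_of_nat of_nat_fact)
    show "of_nat 1 * coeff B1 l \<in> \<int>" for l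
    proof (cases "l < N")
      case True
      then have "fact l dvd (fact (N - 1) :: nat)" by (intro fact_dvd) simp
      then obtain k :: nat where "fact (N - 1) = fact l * k" by (elim dvdE)
      then have "(fact (N - 1) :: complex) = fact l * of_nat k" by (metis of_nat_fact of_nat_mult)
      then show ?thesis using True by (simp add: coeff_B1)
    qed (simp add: coeff_B1)
  qed
  then show thesis by (intro that) (simp only: y_def[abs_def])
qed

lemma exp_gamma_series_independent:
  fixes a :: rat and c :: "nat \<times> nat \<Rightarrow> int"
  assumes a: "0 < a" and r: "1 \<le> r" "\<not> (r = 1 \<and> a \<in> \<nat>)"
    and rel: "(\<Sum>j\<le>L. \<Sum>k\<le>L. of_int (c (j, k)) * (exp (- 1) ^ j * eval_fps (gamma_series (of_rat a) r) 1 ^ k)) = 0"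
    and jk: "j \<le> L" "k \<le> L"
  shows "c (j, k) = 0"
proof (cases "a \<in> \<int>")
  case False
  obtain da where T: "exp_tower_functions r (2 * L + 1) (of_rat a) 0 1 (gamma_series (of_rat a)) da"
    by (rule tower_of_nonintegral[OF a False r(1), of "2 * L + 1"]) auto
  show ?thesis
    by (rule exp_tower_functions.two_values_independent[OF T, where L = L and c = c, OF _ _ jk]) (use rel in \<open>simp_all add: gamma_series_0\<close>)
next
  case True
  then obtain z where z: "a = of_int z" by (elim Ints_cases)
  then obtain N where N: "a = of_nat N" "0 < N" using a by (intro that[of "nat z"]) auto
  \<comment> \<open>Integral \<open>a\<close> rules out r = 1, so a function remains after the
    elementary one is dropped.\<close>
  then have r2: "1 \<le> r - 1" using r by auto
  have ar: "of_rat a = (of_nat N :: complex)" using N by simp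
  let ?y = "\<lambda>j. if j = 0 then fps_exp (- 1) else fps_X ^ N * gamma_series (of_nat N) (Suc j)"
  obtain B0 B1 da where T: "exp_tower_functions (r - 1) (2 * L + 1) 0 B0 B1 ?y da"
    by (rule tower_of_integral[OF N(2) r2, of "2 * L + 1"]) auto
  have rad: "fps_conv_radius (gamma_series (of_nat N) r) = \<infinity>"
    using fps_conv_radius_egf[OF arith_geom_egf_gamma_series[OF a]] by (simp add: ar)
  have "eval_fps (?y (r - 1)) 1 = eval_fps (gamma_series (of_rat a) r) 1"
  proof -
    have "r - 1 \<noteq> 0" "Suc (r - 1) = r" using r2 by arith+
    then show ?thesis using rad by (simp only: if_False) (simp add: eval_fps_mult ar)
  qed
  then show ?thesis
    using exp_tower_functions.two_values_independent[OF T, where L = L and c = c, OF _ _ jk] rel by simp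
qed

theorem theorem2:
  fixes a :: rat and s :: nat
  assumes "E_values \<inter> D_values = Qbar"
    and "a > 0"
    and "\<not> (s = 0 \<and> a \<in> \<nat>)"
  shows "\<not> algebraic ((deriv ^^ s) (Gamma :: complex \<Rightarrow> complex) (of_rat a))"
proof
  let ?A = "(deriv ^^ s) (Gamma :: complex \<Rightarrow> complex) (of_rat a)"
  assume A: "algebraic ?A"
  let ?F = "eval_fps (gamma_series (of_rat a) (s + 1)) 1"
  define c :: int where "c = (- 1) ^ s * fact s"
  have "0 < real_of_rat a" using assms(2) by simp
  then obtain v where v: "((\<lambda>u. (1 + u) powr (of_rat a - 1) * ln (1 + u) ^ s * exp (- u)) has_integral v) {0..}"
    and dec: "(deriv ^^ s) (Gamma :: complex \<Rightarrow> complex) (of_real (of_rat a)) = of_real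
       ((\<Sum>n. (- 1) ^ n / fact n * ((- 1) ^ s * fact s / (of_rat a + real n) ^ (s + 1))) + exp (- 1) * v)"
    by (rule higher_deriv_Gamma_decomposition)
  define g where "g n = (- 1) ^ n / (fact n * (real_of_rat a + real n) ^ (s + 1))" for n
  have g: "complex_of_real (g n) = fps_nth (gamma_series (of_rat a) (s + 1)) n * 1 ^ n" for n
    by (simp add: g_def gamma_series_def flip: of_real_of_rat)
  have "summable (\<lambda>n. complex_of_real (g n))"
    unfolding g using fps_conv_radius_egf[OF arith_geom_egf_gamma_series[OF assms(2)]] by (intro summable_fps) simp
  then have sg: "summable g" by (simp add: summable_of_real_iff)
  have "complex_of_real (suminf g) = ?F"
    unfolding suminf_of_real[OF sg] eval_fps_def g ..
  moreover have "(\<Sum>n. (- 1) ^ n / fact n * ((- 1) ^ s * fact s / (of_rat a + real n) ^ (s + 1))) = of_int c * suminf g"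
    unfolding suminf_mult[OF sg, symmetric] by (intro suminf_cong) (simp add: g_def c_def)
  ultimately have AF: "?A = of_int c * ?F + exp (- 1) * of_real v"
    using dec by (simp add: of_real_of_rat flip: exp_of_real)
  have "exp 1 * (?A - of_int c * ?F) = of_real v"
    unfolding AF by (simp flip: exp_add mult.assoc)
  then have "of_real v \<in> E_values"
    using gamma_series_E_value[OF assms(2) A, of c "s + 1"] by simp
  moreover have "of_real v \<in> D_values"
    by (rule binomial_log_integral_in_D_values[OF assms(2) v])
  ultimately have valg: "algebraic (complex_of_real v)" using assms(1) unfolding Qbar_def by blast
  obtain L and b :: "nat \<times> nat \<Rightarrow> int" where b: "\<exists>j\<le>L. \<exists>k\<le>L. b (j, k) \<noteq> 0"
    "(\<Sum>j\<le>L. \<Sum>k\<le>L. of_int (b (j, k)) * (exp (- 1) ^ j * ?F ^ k)) = 0"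
    by (rule algebraic_combination_dependent[OF A valg _ AF]) (auto simp: c_def)
  then show False
    using exp_gamma_series_independent[OF assms(2), where r = "s + 1" and L = L and c = b] assms(3) by auto
qed

end
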